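(* Let $0\le\omega<\mu\le\pi$ and let $T=T_0+e_1T_1+\dots+e_nT_n$ be a paravector operator of type $\omega$ on $V_n$. Then the operators $\psi(T)$ given by the S-functional calculus are bounded linear operators on $V_n$, and for all $a,b\in\mathbb R$: $$(a\psi+b\varphi)(T)=a\psi(T)+b\varphi(T)\quad\text{for all }\psi,\varphi\in\Psi_L(\mathcal S^0_\mu)\text{ and for all }\psi,\varphi\in\Psi_R(\mathcal S^0_\mu);$$ moreover $$(\psi\varphi)(T)=\psi(T)\varphi(T)\quad\text{for all }\psi\in\Psi(\mathcal S^0_\mu),\ \varphi\in\Psi_L(\mathcal S^0_\mu),$$ $$(\psi\varphi)(T)=\psi(T)\varphi(T)\quad\text{for all }\psi\in\Psi_R(\mathcal S^0_\mu),\ \varphi\in\Psi(\mathcal S^0_\mu),$$ where $\psi\varphi$ denotes the pointwise product.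
   Context: $\mathbb R_n$ is the real Clifford algebra generated by $e_1,\dots,e_n$ with $e_ie_j+e_je_i=-2\delta_{ij}$; elements are $\sum_A e_Ax_A$ with $e_A=e_{i_1}\cdots e_{i_r}$ for $A=\{i_1<\dots<i_r\}$, $e_\emptyset=1$. Paravectors $x=x_0+\sum_{j=1}^n x_je_j$ are identified with $\mathbb R^{n+1}$; $\mathrm{Re}(x)=x_0$, $|x|^2=\sum_{j=0}^n x_j^2$, $\bar x=x_0-\sum_j x_je_j$. $\mathbb S=\{\sum_j x_je_j:\sum_j x_j^2=1\}$ and for $i\in\mathbb S$, $\mathbb C_i=\{u+iv:u,v\in\mathbb R\}$. A real differentiable $f:U\to\mathbb R_n$ ($U\subseteq\mathbb R^{n+1}$ open) is left slice hyperholomorphic if for all $i\in\mathbb S$ the restriction $f_i$ to $U\cap\mathbb C_i$ satisfies $\frac12(\partial_u f_i+i\partial_v f_i)=0$, right slice hyperholomorphic if $\frac12(\partial_u f_i+\partial_v f_i\,i)=0$, intrinsic if it is left (or right) slice hyperholomorphic and $f(U\cap\mathbb C_i)\subseteq\mathbb C_i$ for all $i$. $V$ is a real Banach space, $V_n=V\otimes\mathbb R_n$ (elements $\sum_B v_Be_B$), $\mathcal B(V_n)$ the bounded right $\mathbb R_n$-module homomorphisms of $V_n$. For linear operators $T_\mu:\mathcal D(T_\mu)\subseteq V\to V$ ($\mu=0,\dots,n$), the paravector operator $T=T_0+e_1T_1+\dots+e_nT_n$ has domain $\bigcap_\mu\mathcal D(T_\mu)$ (tensored with $\mathbb R_n$)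 and acts by $T(\sum_Bv_Be_B)=\sum_{\mu,B}T_\mu(v_B)e_\mu e_B$ ($e_0=1$). For closed $T$: $\rho_S(T)=\{s\in\mathbb R^{n+1}: Q_s(T):=(T^2-2\mathrm{Re}(s)T+|s|^2\mathcal I)^{-1}\in\mathcal B(V_n)\}$ (with $T^2-2\mathrm{Re}(s)T+|s|^2\mathcal I$ acting on $\mathcal D(T^2)$), $\sigma_S(T)=\mathbb R^{n+1}\setminus\rho_S(T)$, $S_L^{-1}(s,T)=Q_s(T)\bar s-TQ_s(T)$, $S_R^{-1}(s,T)=-(T-\mathcal I\bar s)Q_s(T)$. For $s\in\mathbb R^{n+1}\setminus\{0\}$, $\arg(s)\in[0,\pi]$ is the unique $\theta$ with $s=|s|e^{\theta i_s}$, $i_s=\underline s/|\underline s|$ for $\underline s=s-\mathrm{Re}(s)\ne0$ (any $i_s\in\mathbb S$ if $s$ real). $\mathcal S_\vartheta=\{s: s=0\text{ or }\arg(s)\le\vartheta\}$, $\mathcal S^0_\vartheta=\{s\ne0:\arg(s)<\vartheta\}$. $T$ is of type $\omega\in[0,\pi)$ if it is closed, densely defined, $\sigma_S(T)\subseteq\mathcal S_\omega$, and for every $\vartheta\in(\omega,\pi]$ there is $C_\vartheta$ with $\|S_L^{-1}(s,T)\|\le C_\vartheta/|s|$ and $\|S_R^{-1}(s,T)\|\le C_\vartheta/|s|$ for all nonzero $s\notin\mathcal S_\vartheta$. $\Psi_L(\mathcal S^0_\mu)$ (resp. $\Psi_R$, $\Psi$): left slice hyperholomorphic (resp. right slice hyperholomorphic,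 intrinsic) $f$ on $\mathcal S^0_\mu$ with $|f(s)|\le c|s|^\alpha/(1+|s|^{2\alpha})$ for some $\alpha,c>0$. S-functional calculus: for $i\in\mathbb S$ and a piecewise smooth path $\Gamma\subseteq\mathbb C_i$ which for some $\theta'\in(\omega,\mu)$ satisfies $\Gamma\setminus\{0\}\subseteq\mathcal S^0_\mu\setminus\mathcal S_{\theta'}$ and outside a ball coincides with the rays $re^{\pm i\theta}$ ($\theta\in(\omega,\mu)$), oriented from $\infty e^{i\theta}$ to $\infty e^{-i\theta}$, and $ds_i=-i\,ds$: $\psi(T):=\frac1{2\pi}\int_\Gamma S_L^{-1}(s,T)\,ds_i\,\psi(s)$ for $\psi\in\Psi_L(\mathcal S^0_\mu)$, $\psi(T):=\frac1{2\pi}\int_\Gamma\psi(s)\,ds_i\,S_R^{-1}(s,T)$ for $\psi\in\Psi_R(\mathcal S^0_\mu)$; these do not depend on $\Gamma$ or $i$, and for $\psi\in\Psi(\mathcal S^0_\mu)$ the two formulas agree. *)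

theory Defs
  imports "HOL-Analysis.Analysis"
begin

text \<open>Clifford algebra R_n. The generators e_1..e_n are indexed by a finite linearly
ordered type 'n (so n = CARD('n) >= 1). A Clifford number is a real vector indexed
by subsets A of 'n (coefficient of e_A); paravectors are real vectors indexed by
'n option (None = real part, Some j = coefficient of e_j).\<close>

type_synonym ('n) cliff = "real ^ ('n set)"
type_synonym ('n) para = "real ^ ('n option)"
type_synonym ('v, 'n) modn = "'v ^ ('n set)"

definition symd :: "'a set \<Rightarrow> 'a set \<Rightarrow> 'a set" where
  "symd A B = (A - B) \<union> (B - A)"

text \<open>e_A e_B = clsign A B e_(A symdiff B).\<close>
definition clsign :: "'n::linorder set \<Rightarrow> 'n set \<Rightarrow> real" where
  "clsign A B = (-1) ^ (card {(a, b). a \<in> A \<and> b \<in> B \<and> b < a} + card (A \<inter> B))"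

definition clmul :: "('n::{finite,linorder}) cliff \<Rightarrow> 'n cliff \<Rightarrow> 'n cliff" where
  "clmul a b = (\<chi> C. \<Sum>A\<in>UNIV. clsign A (symd A C) * a $ A * b $ (symd A C))"

text \<open>Left and right multiplication of elements of V_n = V \<otimes> R_n by Clifford numbers.\<close>
definition lmul :: "('n::{finite,linorder}) cliff \<Rightarrow> ('v::real_vector, 'n) modn \<Rightarrow> ('v, 'n) modn" where
  "lmul a v = (\<chi> C. \<Sum>A\<in>UNIV. (clsign A (symd A C) * a $ A) *\<^sub>R v $ (symd A C))"

definition rmul :: "('v::real_vector, 'n::{finite,linorder}) modn \<Rightarrow> 'n cliff \<Rightarrow> ('v, 'n) modn" where
  "rmul v a = (\<chi> C. \<Sum>A\<in>UNIV. (clsign A (symd A C) * a $ (symd A C)) *\<^sub>R v $ A)"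

definition rmod_hom :: "(('v::real_vector, 'n::{finite,linorder}) modn \<Rightarrow> ('v, 'n) modn) \<Rightarrow> bool" where
  "rmod_hom Q \<longleftrightarrow> (\<forall>v a. Q (rmul v a) = rmul (Q v) a)"

definition pv :: "('n::finite) para \<Rightarrow> 'n cliff" where
  "pv x = (\<chi> A. if A = {} then x $ None else if card A = 1 then x $ Some (the_elem A) else 0)"

definition cnj :: "('n::finite) para \<Rightarrow> 'n para" where
  "cnj x = (\<chi> j. if j = None then x $ j else - (x $ j))"

definition pone :: "('n::finite) para" where
  "pone = (\<chi> j. if j = None then 1 else 0)"

definition sph :: "('n::finite) para set" where
  "sph = {x. x $ None = 0 \<and> norm x = 1}"

definition Ci :: "('n::finite) para \<Rightarrow> 'n para set" where
  "Ci i = {x. \<exists>u v. x = u *\<^sub>R pone + v *\<^sub>R i}"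

text \<open>arg(s) in [0,pi]: s = |s| e^{theta i_s}, i.e. cos(arg s) = Re(s)/|s|.\<close>
definition parg :: "('n::finite) para \<Rightarrow> real" where
  "parg s = arccos (s $ None / norm s)"

definition Sect :: "real \<Rightarrow> ('n::finite) para set" where
  "Sect th = {s. s = 0 \<or> parg s \<le> th}"

definition Sect0 :: "real \<Rightarrow> ('n::finite) para set" where
  "Sect0 th = {s. s \<noteq> 0 \<and> parg s < th}"

text \<open>Slice hyperholomorphy (Cauchy-Riemann on every slice C_i; the partial derivatives
of the restriction f_i(u+iv) at x are the Frechet derivative of f in directions 1 and i).\<close>
definition left_sh :: "('n::{finite,linorder}) para set \<Rightarrow> ('n para \<Rightarrow> 'n cliff) \<Rightarrow> bool" where
  "left_sh U f \<longleftrightarrow> open U \<and> f differentiable_on U \<and>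
     (\<forall>x\<in>U. \<forall>i\<in>sph. x \<in> Ci i \<longrightarrow>
        (1/2) *\<^sub>R (frechet_derivative f (at x) pone
                    + clmul (pv i) (frechet_derivative f (at x) i)) = 0)"

definition right_sh :: "('n::{finite,linorder}) para set \<Rightarrow> ('n para \<Rightarrow> 'n cliff) \<Rightarrow> bool" where
  "right_sh U f \<longleftrightarrow> open U \<and> f differentiable_on U \<and>
     (\<forall>x\<in>U. \<forall>i\<in>sph. x \<in> Ci i \<longrightarrow>
        (1/2) *\<^sub>R (frechet_derivative f (at x) pone
                    + clmul (frechet_derivative f (at x) i) (pv i)) = 0)"

definition intrinsic :: "('n::{finite,linorder}) para set \<Rightarrow> ('n para \<Rightarrow> 'n cliff) \<Rightarrow> bool" where
  "intrinsic U f \<longleftrightarrow> (left_sh U f \<or> right_sh U f) \<and>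
     (\<forall>i\<in>sph. f ` (U \<inter> Ci i) \<subseteq> pv ` Ci i)"

definition decay :: "real \<Rightarrow> ('n::{finite,linorder} para \<Rightarrow> 'n cliff) \<Rightarrow> bool" where
  "decay mu f \<longleftrightarrow> (\<exists>alpha>0. \<exists>c>0. \<forall>s\<in>Sect0 mu.
      norm (f s) \<le> c * norm s powr alpha / (1 + norm s powr (2 * alpha)))"

definition PsiL :: "real \<Rightarrow> ('n::{finite,linorder} para \<Rightarrow> 'n cliff) \<Rightarrow> bool" where
  "PsiL mu f \<longleftrightarrow> left_sh (Sect0 mu) f \<and> decay mu f"

definition PsiR :: "real \<Rightarrow> ('n::{finite,linorder} para \<Rightarrow> 'n cliff) \<Rightarrow> bool" where
  "PsiR mu f \<longleftrightarrow> right_sh (Sect0 mu) f \<and> decay mu f"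

definition Psi :: "real \<Rightarrow> ('n::{finite,linorder} para \<Rightarrow> 'n cliff) \<Rightarrow> bool" where
  "Psi mu f \<longleftrightarrow> intrinsic (Sect0 mu) f \<and> decay mu f"

definition lin_op :: "'v::real_vector set \<Rightarrow> ('v \<Rightarrow> 'v) \<Rightarrow> bool" where
  "lin_op D T \<longleftrightarrow> subspace D \<and> (\<forall>x\<in>D. \<forall>y\<in>D. T (x + y) = T x + T y)
      \<and> (\<forall>c. \<forall>x\<in>D. T (c *\<^sub>R x) = c *\<^sub>R T x)"

text \<open>The paravector operator T = T_0 + sum e_j T_j on V_n (index None is T_0);
 D and Top give the domains and the component operators.\<close>
definition opdom :: "('n::{finite,linorder} option \<Rightarrow> 'v::real_vector set) \<Rightarrow> ('v, 'n) modn set" where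
  "opdom D = {v. \<forall>B \<mu>. v $ B \<in> D \<mu>}"

definition opT :: "('n::{finite,linorder} option \<Rightarrow> 'v::real_vector \<Rightarrow> 'v) \<Rightarrow> ('v, 'n) modn \<Rightarrow> ('v, 'n) modn" where
  "opT Top v = (\<chi> C. \<Sum>\<mu>\<in>UNIV.
       clsign (set_option \<mu>) (symd (set_option \<mu>) C) *\<^sub>R Top \<mu> (v $ symd (set_option \<mu>) C))"

definition opdom2 :: "('n::{finite,linorder} option \<Rightarrow> 'v::real_vector set) \<Rightarrow> ('n option \<Rightarrow> 'v \<Rightarrow> 'v) \<Rightarrow> ('v, 'n) modn set" where
  "opdom2 D Top = {v \<in> opdom D. opT Top v \<in> opdom D}"

definition Pop :: "('n::{finite,linorder} option \<Rightarrow> 'v::real_vector \<Rightarrow> 'v) \<Rightarrow> 'n para \<Rightarrow> ('v, 'n) modn \<Rightarrow> ('v, 'n) modn" where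
  "Pop Top s v = opT Top (opT Top v) - (2 * s $ None) *\<^sub>R opT Top v + (norm s ^ 2) *\<^sub>R v"

definition is_Qs :: "('n::{finite,linorder} option \<Rightarrow> 'v::real_normed_vector set) \<Rightarrow> ('n option \<Rightarrow> 'v \<Rightarrow> 'v) \<Rightarrow> 'n para \<Rightarrow> (('v, 'n) modn \<Rightarrow> ('v, 'n) modn) \<Rightarrow> bool" where
  "is_Qs D Top s Q \<longleftrightarrow> bounded_linear Q \<and> rmod_hom Q \<and>
      (\<forall>w. Q w \<in> opdom2 D Top \<and> Pop Top s (Q w) = w) \<and>
      (\<forall>v\<in>opdom2 D Top. Q (Pop Top s v) = v)"

definition rhoS :: "('n::{finite,linorder} option \<Rightarrow> 'v::real_normed_vector set) \<Rightarrow> ('n option \<Rightarrow> 'v \<Rightarrow> 'v) \<Rightarrow> 'n para set" where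
  "rhoS D Top = {s. \<exists>Q. is_Qs D Top s Q}"

definition sigmaS :: "('n::{finite,linorder} option \<Rightarrow> 'v::real_normed_vector set) \<Rightarrow> ('n option \<Rightarrow> 'v \<Rightarrow> 'v) \<Rightarrow> 'n para set" where
  "sigmaS D Top = - rhoS D Top"

definition Qs :: "('n::{finite,linorder} option \<Rightarrow> 'v::real_normed_vector set) \<Rightarrow> ('n option \<Rightarrow> 'v \<Rightarrow> 'v) \<Rightarrow> 'n para \<Rightarrow> ('v, 'n) modn \<Rightarrow> ('v, 'n) modn" where
  "Qs D Top s = (SOME Q. is_Qs D Top s Q)"

text \<open>Convention: an operator followed by a Clifford number a means composition with
 left multiplication by a on V_n (A a = A o L_a); a Clifford number followed by an
 operator means left multiplication of the result (a A = L_a o A).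
 S_L^{-1}(s,T) = Q_s(T) sbar - T Q_s(T),  S_R^{-1}(s,T) = -(T - I sbar) Q_s(T).\<close>
definition SLinv :: "('n::{finite,linorder} option \<Rightarrow> 'v::real_normed_vector set) \<Rightarrow> ('n option \<Rightarrow> 'v \<Rightarrow> 'v) \<Rightarrow> 'n para \<Rightarrow> ('v, 'n) modn \<Rightarrow> ('v, 'n) modn" where
  "SLinv D Top s v = Qs D Top s (lmul (pv (cnj s)) v) - opT Top (Qs D Top s v)"

definition SRinv :: "('n::{finite,linorder} option \<Rightarrow> 'v::real_normed_vector set) \<Rightarrow> ('n option \<Rightarrow> 'v \<Rightarrow> 'v) \<Rightarrow> 'n para \<Rightarrow> ('v, 'n) modn \<Rightarrow> ('v, 'n) modn" where
  "SRinv D Top s v = - (opT Top (Qs D Top s v) - lmul (pv (cnj s)) (Qs D Top s v))"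

definition op_closed :: "('n::{finite,linorder} option \<Rightarrow> 'v::real_normed_vector set) \<Rightarrow> ('n option \<Rightarrow> 'v \<Rightarrow> 'v) \<Rightarrow> bool" where
  "op_closed D Top \<longleftrightarrow> closed {(v, opT Top v) | v. v \<in> opdom D}"

definition type_op :: "real \<Rightarrow> ('n::{finite,linorder} option \<Rightarrow> 'v::real_normed_vector set) \<Rightarrow> ('n option \<Rightarrow> 'v \<Rightarrow> 'v) \<Rightarrow> bool" where
  "type_op \<omega> D Top \<longleftrightarrow> 0 \<le> \<omega> \<and> \<omega> < pi \<and> op_closed D Top \<and> closure (opdom D) = UNIV \<and>
     sigmaS D Top \<subseteq> Sect \<omega> \<and>
     (\<forall>\<theta>v. \<omega> < \<theta>v \<and> \<theta>v \<le> pi \<longrightarrow> (\<exists>C. \<forall>s. s \<noteq> 0 \<and> s \<notin> Sect \<theta>v \<longrightarrow>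
         onorm (SLinv D Top s) \<le> C / norm s \<and> onorm (SRinv D Top s) \<le> C / norm s))"

text \<open>The integration path: the two rays r e^{\<plusminus>i\<theta>} in C_i, parametrised by t \<in> R,
 running from \<infinity> e^{i\<theta>} (t \<rightarrow> -\<infinity>) through 0 to \<infinity> e^{-i\<theta>} (t \<rightarrow> \<infinity>), and its derivative.\<close>
definition ray :: "real \<Rightarrow> ('n::finite) para \<Rightarrow> real \<Rightarrow> 'n para" where
  "ray \<theta> i t = \<bar>t\<bar> *\<^sub>R (cos \<theta> *\<^sub>R pone - (sgn t * sin \<theta>) *\<^sub>R i)"

definition dray :: "real \<Rightarrow> ('n::finite) para \<Rightarrow> real \<Rightarrow> 'n para" where
  "dray \<theta> i t = (if t < 0 then - (cos \<theta> *\<^sub>R pone + sin \<theta> *\<^sub>R i) else cos \<theta> *\<^sub>R pone - sin \<theta> *\<^sub>R i)"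

text \<open>ds_i = -i ds, as Clifford number (times dt).\<close>
definition dsi :: "real \<Rightarrow> ('n::{finite,linorder}) para \<Rightarrow> real \<Rightarrow> 'n cliff" where
  "dsi \<theta> i t = clmul (pv (- i)) (pv (dray \<theta> i t))"

definition SL_integrand where
  "SL_integrand D Top \<theta> i \<psi> v = (\<lambda>t. SLinv D Top (ray \<theta> i t) (lmul (clmul (dsi \<theta> i t) (\<psi> (ray \<theta> i t))) v))"

definition SR_integrand where
  "SR_integrand D Top \<theta> i \<psi> v = (\<lambda>t. lmul (clmul (\<psi> (ray \<theta> i t)) (dsi \<theta> i t)) (SRinv D Top (ray \<theta> i t) v))"

definition SLcalc :: "('n::{finite,linorder} option \<Rightarrow> 'v::real_normed_vector set) \<Rightarrow> ('n option \<Rightarrow> 'v \<Rightarrow> 'v) \<Rightarrow> real \<Rightarrow> 'n para \<Rightarrow> ('n para \<Rightarrow> 'n cliff) \<Rightarrow> ('v, 'n) modn \<Rightarrow> ('v, 'n) modn" where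
  "SLcalc D Top \<theta> i \<psi> v = (1 / (2 * pi)) *\<^sub>R integral UNIV (SL_integrand D Top \<theta> i \<psi> v)"

definition SRcalc :: "('n::{finite,linorder} option \<Rightarrow> 'v::real_normed_vector set) \<Rightarrow> ('n option \<Rightarrow> 'v \<Rightarrow> 'v) \<Rightarrow> real \<Rightarrow> 'n para \<Rightarrow> ('n para \<Rightarrow> 'n cliff) \<Rightarrow> ('v, 'n) modn \<Rightarrow> ('v, 'n) modn" where
  "SRcalc D Top \<theta> i \<psi> v = (1 / (2 * pi)) *\<^sub>R integral UNIV (SR_integrand D Top \<theta> i \<psi> v)"

end

theory Submission
  imports Defs "HOL-Complex_Analysis.Complex_Analysis" "HOL-Real_Asymp.Real_Asymp"
begin

text \<open>Fix \<open>i\<close>. On the slice \<open>\<complex>\<^sub>i\<close> a slice hyperholomorphic function is a finite combination, with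
Clifford coefficients, of complex holomorphic functions \<open>F\<close> with \<open>F (cnj z) = cnj (F z)\<close>. For such an
\<open>F\<close> the contributions of the two rays are conjugate, all Clifford units cancel, and both the left and
the right S-functional calculus reduce to \<open>1 / (2 \<pi> \<i>) \<integral> F(z) (z - T)\<^sup>-\<^sup>1 dz\<close>, where the resolvent acts on the
complexification of \<open>V\<^sub>n\<close> as an abstract real Banach space (forgetting its Clifford structure) and equals
\<open>(cnj z - T) Q\<^sub>z(T)\<close>. The product rule for this sectorial calculus follows from the
resolvent identity and Cauchy's formula on two sectors of different angles, in the coordinate \<open>\<zeta> = ln z\<close>
that turns sectors into strips. Intrinsic functions have only the coefficient \<open>1\<close>,
except for \<open>n = 1\<close>, where the Clifford algebra is commutative and commutes with \<open>T\<close>.\<close>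

section \<open>Improper integrals on the line\<close>

text \<open>Clifford values cannot be moved past T, with which they do not commute, so the product
  rule cannot be computed with the S-resolvents directly. Write \<open>(cnj z - T) Q\<close> as A -
  iB with real operators A and B, and let J be left multiplication by the unit i. Then the left
  S-resolvent is A - BJ and the right one A - JB. As Q depends only on Re s and |s|, A is even and B
  is odd under conjugation. For symmetric F the terms containing J therefore cancel between the
  rays, and the rest is the same for both sides. On the complexification the imaginary unit commutes
  with everything, so an honest resolvent identity holds. Two angles keep the Cauchy kernel bounded:
  one Cauchy integral then has its point outside the strip and vanishes, the other has it inside and
  reproduces the function. In the coordinate ln z, dz/z is the line element, sectoriality is a
  uniform bound, and the decay condition is domination by \<open>kap\<close>, whose explicit
  primitive supplies every estimate. For n = 1 a single slice is the whole paravector space, so the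
  condition on values of an intrinsic function is vacuous.\<close>

text \<open>The gauge integral over the line controls all boxes that contain a large ball, in
  particular the symmetric intervals. All limit arguments below are run along these.\<close>

lemma integral_UNIV_limit:
  fixes f :: "real \<Rightarrow> 'a::banach"
  assumes "f integrable_on UNIV"
  shows "((\<lambda>b. integral {-b..b} f) \<longlongrightarrow> integral UNIV f) at_top"
proof (rule tendstoI)
  fix e :: real assume e: "e > 0"
  have "(f has_integral integral UNIV f) UNIV"
    using assms by blast
  then obtain B where B: "B > 0"
    "\<And>a b. ball 0 B \<subseteq> cbox a b \<Longrightarrow> norm (integral (cbox a b) f - integral UNIV f) < e"
    unfolding has_integral_alt'[of f _ UNIV] using e by auto
  have "dist (integral {-b..b} f) (integral UNIV f) < e" if "b \<ge> B" for b
  proof -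
    have "ball 0 B \<subseteq> cbox (-b) b"
      using that by (auto simp: dist_real_def)
    from B(2)[OF this] show ?thesis
      by (simp add: dist_norm)
  qed
  then show "\<forall>\<^sub>F b in at_top. dist (integral {-b..b} f) (integral UNIV f) < e"
    using eventually_at_top_linorder by blast
qed

text \<open>The exceptional set \<open>S\<close> admits primitives with a kink: one frozen beyond a
  point, or one glued at the vertex of the integration path.\<close>

lemma has_integral_UNIV_antiderivative:
  fixes F f :: "real \<Rightarrow> 'a::banach"
  assumes "finite S" and cont: "continuous_on UNIV F"
    and der: "\<And>x. x \<notin> S \<Longrightarrow> (F has_vector_derivative f x) (at x)"
    and top: "(F \<longlongrightarrow> L) at_top" and bot: "(F \<longlongrightarrow> l) at_bot"
  shows "(f has_integral (L - l)) UNIV"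
proof -
  have ab: "(f has_integral (F b - F a)) (cbox a b)" if "a \<le> b" for a b
    using fundamental_theorem_of_calculus_interior_strong[OF \<open>finite S\<close> that, of F f]
      der continuous_on_subset[OF cont] by auto
  have int: "f integrable_on cbox a b" for a b
    using ab[of a b] by (cases "a \<le> b") auto
  have "\<exists>B>0. \<forall>a b. ball 0 B \<subseteq> cbox a b \<longrightarrow> norm (integral (cbox a b) f - (L - l)) < e"
    if e: "e > 0" for e
  proof -
    from tendstoD[OF top, of "e/2"] e obtain B1 where B1: "\<And>x. x \<ge> B1 \<Longrightarrow> dist (F x) L < e/2"
      unfolding eventually_at_top_linorder by auto
    from tendstoD[OF bot, of "e/2"] e obtain B2 where B2: "\<And>x. x \<le> B2 \<Longrightarrow> dist (F x) l < e/2"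
      unfolding eventually_at_bot_linorder by auto
    \<comment> \<open>The summand 1 puts both thresholds and the two test points below inside the
      open ball, so the ends of any larger box lie beyond the thresholds and in the right
      order.\<close>
    define B where "B = \<bar>B1\<bar> + \<bar>B2\<bar> + 1"
    have "norm (integral (cbox a b) f - (L - l)) < e" if sub: "ball 0 B \<subseteq> cbox a b" for a b
    proof -
      have "B1 \<in> ball 0 B" "B2 \<in> ball 0 B"
        by (auto simp: B_def)
      moreover have "-(\<bar>B1\<bar> + \<bar>B2\<bar>) \<in> ball 0 B" "\<bar>B1\<bar> + \<bar>B2\<bar> \<in> ball 0 B"
        by (auto simp: B_def)
      ultimately have "a \<le> B2" "b \<ge> B1" "a \<le> b"
        using sub by fastforce+
      then have "integral (cbox a b) f = F b - F a" "dist (F b) L < e/2" "dist (F a) l < e/2"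
        using ab B1 B2 by auto
      moreover have "norm (F b - F a - (L - l)) \<le> norm (F b - L) + norm (F a - l)"
        using norm_triangle_ineq4[of "F b - L" "F a - l"] by (simp add: algebra_simps)
      ultimately show ?thesis
        by (simp add: dist_norm)
    qed
    moreover have "B > 0" by (simp add: B_def)
    ultimately show ?thesis by blast
  qed
  then show ?thesis
    unfolding has_integral_alt'[of f _ UNIV] using int by simp
qed

text \<open>The decay bound \<open>\<bar>s\<bar>\<^sup>\<alpha> / (1 + \<bar>s\<bar>\<^sup>2\<^sup>\<alpha>)\<close> at \<open>\<bar>s\<bar> = exp x\<close>.\<close>

definition kap :: "real \<Rightarrow> real \<Rightarrow> real" where
  "kap \<alpha> x = exp (\<alpha> * x) / (1 + exp (2 * \<alpha> * x))"

lemma kap_pos: "kap \<alpha> x > 0"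
  by (simp add: kap_def add_pos_pos)

lemma kap_le_1: "kap \<alpha> x \<le> 1"
proof -
  have e: "exp (2 * \<alpha> * x) = exp (\<alpha> * x) ^ 2"
    by (simp add: power2_eq_square flip: exp_add)
  have "0 \<le> (exp (\<alpha> * x) - 1) ^ 2" by simp
  then have "2 * exp (\<alpha> * x) \<le> 1 + exp (\<alpha> * x) ^ 2"
    by (simp add: power2_eq_square algebra_simps)
  moreover have "exp (\<alpha> * x) > 0" by simp
  ultimately have "exp (\<alpha> * x) \<le> 1 + exp (\<alpha> * x) ^ 2" by linarith
  moreover have "1 + exp (\<alpha> * x) ^ 2 > 0" by (simp add: add_pos_pos)
  ultimately show ?thesis
    unfolding kap_def e by simp
qed

lemma continuous_on_kap [continuous_intros]:
  "continuous_on S f \<Longrightarrow> continuous_on S (\<lambda>x. kap \<alpha> (f x))"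
  unfolding kap_def
proof -
  have "1 + exp y \<noteq> 0" for y :: real
    using exp_gt_zero[of y] by linarith
  then show "continuous_on S f \<Longrightarrow> continuous_on S (\<lambda>x. exp (\<alpha> * f x) / (1 + exp (2 * \<alpha> * f x)))"
    by (intro continuous_intros) auto
qed

lemma kap_minus: "kap \<alpha> (-x) = kap \<alpha> x"
proof -
  have e: "exp (2 * \<alpha> * y) = exp (\<alpha> * y) ^ 2" for y
    by (simp add: power2_eq_square flip: exp_add)
  have "exp (\<alpha> * x) > 0" by simp
  then show ?thesis
    unfolding kap_def e by (simp add: exp_minus divide_simps add_pos_pos power2_eq_square)
qed

lemma kap_at_top: "\<alpha> > 0 \<Longrightarrow> (kap \<alpha> \<longlongrightarrow> 0) at_top"
  unfolding kap_def by real_asymp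


text \<open>\<open>kap\<close> is 1 / (2 cosh (\<open>\<alpha>\<close> x)). Its primitive, bounded
  by \<open>pi / 2 / \<alpha>\<close>, is the source of this constant in all later norm
  bounds.\<close>

lemma kap_antiderivative:
  assumes "\<alpha> > 0"
  shows "((\<lambda>x. arctan (exp (\<alpha> * x)) / \<alpha>) has_vector_derivative kap \<alpha> x) (at x)"
proof -
  have e: "exp (2 * \<alpha> * x) = exp (\<alpha> * x) ^ 2"
    by (simp add: power2_eq_square flip: exp_add)
  show ?thesis
    unfolding has_real_derivative_iff_has_vector_derivative[symmetric] kap_def e
    by (rule derivative_eq_intros refl)+ (use assms in \<open>simp_all add: divide_inverse mult.assoc[symmetric]\<close>)
qed

lemma kap_has_integral_UNIV:
  assumes "\<alpha> > 0" shows "(kap \<alpha> has_integral pi / 2 / \<alpha>) UNIV"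
proof -
  have "((\<lambda>x. arctan (exp (\<alpha> * x))) \<longlongrightarrow> pi / 2) at_top"
    using assms by real_asymp
  then have "((\<lambda>x. arctan (exp (\<alpha> * x)) / \<alpha>) \<longlongrightarrow> pi / 2 / \<alpha>) at_top"
    by (rule tendsto_divide[OF _ tendsto_const]) (use assms in simp)
  moreover have "((\<lambda>x. arctan (exp (\<alpha> * x)) / \<alpha>) \<longlongrightarrow> 0) at_bot"
    using assms by real_asymp
  moreover have "continuous_on UNIV (\<lambda>x. arctan (exp (\<alpha> * x)) / \<alpha>)"
    using assms by (intro continuous_intros) auto
  ultimately show ?thesis
    using has_integral_UNIV_antiderivative[of "{}" "\<lambda>x. arctan (exp (\<alpha> * x)) / \<alpha>" "kap \<alpha>" "(pi/2)/\<alpha>" 0]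
      kap_antiderivative[OF assms] by auto
qed

lemma kap_integrable: "\<alpha> > 0 \<Longrightarrow> kap \<alpha> integrable_on UNIV"
  using kap_has_integral_UNIV by blast

lemma kap_has_integral_atMost:
  assumes "\<alpha> > 0" shows "(kap \<alpha> has_integral arctan (exp (\<alpha> * x)) / \<alpha>) {..x}"
proof -
  \<comment> \<open>The primitive is frozen to the right of \<open>x\<close>, so the whole-line
    theorem applies to the integrand cut off at \<open>x\<close>, with \<open>x\<close> as
    exceptional point.\<close>
  let ?F = "\<lambda>t. arctan (exp (\<alpha> * min t x)) / \<alpha>"
  have "eventually (\<lambda>t. ?F t = arctan (exp (\<alpha> * x)) / \<alpha>) at_top"
    using eventually_ge_at_top[of x] by eventually_elim (simp add: min_absorb2)
  then have "(?F \<longlongrightarrow> arctan (exp (\<alpha> * x)) / \<alpha>) at_top"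
    by (rule tendsto_eventually)
  moreover have "(?F \<longlongrightarrow> 0) at_bot"
  proof (rule Lim_transform_eventually)
    show "((\<lambda>x. arctan (exp (\<alpha> * x)) / \<alpha>) \<longlongrightarrow> 0) at_bot"
      using assms by real_asymp
    show "eventually (\<lambda>t. arctan (exp (\<alpha> * t)) / \<alpha> = ?F t) at_bot"
      using eventually_le_at_bot[of x] by eventually_elim (simp add: min_absorb1)
  qed
  moreover have "continuous_on UNIV ?F"
    using assms by (intro continuous_intros) auto
  moreover have "(?F has_vector_derivative (if t \<in> {..x} then kap \<alpha> t else 0)) (at t)" if "t \<notin> {x}" for t
  proof (cases "t < x")
    case True
    then show ?thesis
      by (auto intro!: has_vector_derivative_transform_within_open[OF kap_antiderivative[OF assms], of "{..<x}"])
  next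
    case False
    then have "t > x" using that by auto
    then show ?thesis
      by (auto intro!: has_vector_derivative_transform_within_open[OF has_vector_derivative_const[of "arctan (exp (\<alpha> * x)) / \<alpha>"], of "{x<..}"])
  qed
  ultimately have "((\<lambda>t. if t \<in> {..x} then kap \<alpha> t else 0) has_integral (arctan (exp (\<alpha> * x)) / \<alpha> - 0)) UNIV"
    by (intro has_integral_UNIV_antiderivative[of "{x}" ?F]) auto
  then show ?thesis
    unfolding has_integral_restrict_UNIV by simp
qed

lemma integrable_dominated:
  fixes f :: "real \<Rightarrow> 'a::banach"
  assumes "continuous_on UNIV f" "\<And>x. norm (f x) \<le> h x" "h integrable_on UNIV"
  shows "f integrable_on UNIV"
  using assms by (intro integrable_on_all_intervals_UNIV[of f h])
    (auto intro!: integrable_continuous_interval intro: continuous_on_subset)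

lemma integrable_kap_dominated:
  fixes f :: "real \<Rightarrow> 'a::banach"
  assumes "continuous_on UNIV f" "\<And>x. norm (f x) \<le> M * kap \<alpha> x" "\<alpha> > 0"
  shows "f integrable_on UNIV" "norm (integral UNIV f) \<le> M * (pi / 2 / \<alpha>)"
proof -
  have h: "((\<lambda>x. M * kap \<alpha> x) has_integral M * (pi / 2 / \<alpha>)) UNIV"
    by (intro has_integral_mult_right kap_has_integral_UNIV assms)
  show f: "f integrable_on UNIV"
    using assms h by (intro integrable_dominated[of f "\<lambda>x. M * kap \<alpha> x"]) auto
  have "norm (integral UNIV f) \<le> integral UNIV (\<lambda>x. M * kap \<alpha> x)"
    using h by (intro integral_norm_bound_integral f assms) auto
  then show "norm (integral UNIV f) \<le> M * (pi / 2 / \<alpha>)"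
    using integral_unique[OF h] by simp
qed

text \<open>Domination by \<open>kap\<close> makes the integrals over \<open>{..x}\<close> converge
  and tend to 0 at the left end. The substitution below glues two such primitives, which requires
  their limits at both ends.\<close>

lemma antiderivative_with_limits:
  fixes f :: "real \<Rightarrow> 'a::banach"
  assumes cont: "continuous_on UNIV f" and bd: "\<And>x. norm (f x) \<le> M * kap \<alpha> x" and \<alpha>: "\<alpha> > 0"
  obtains F where "\<And>x. (F has_vector_derivative f x) (at x)"
    "(F \<longlongrightarrow> 0) at_bot" "(F \<longlongrightarrow> integral UNIV f) at_top"
proof -
  let ?F = "\<lambda>x. integral {..x} f"
  have f: "f integrable_on UNIV"
    by (rule integrable_kap_dominated[OF assms])
  have loc: "f integrable_on {a..b}" for a b
    using cont by (intro integrable_continuous_interval) (auto intro: continuous_on_subset)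
  have at: "f integrable_on {..x}" for x
  proof (rule integrable_on_all_intervals_integrable_bound[where g="\<lambda>x. M * kap \<alpha> x"])
    show "(\<lambda>y. if y \<in> {..x} then f y else 0) integrable_on cbox a b" for a b
    proof -
      have "{..x} \<inter> cbox a b = {a..min b x}" by auto
      then have "f integrable_on {..x} \<inter> cbox a b" using loc by metis
      then show ?thesis
        unfolding integrable_restrict_Int .
    qed
    show "(\<lambda>x. M * kap \<alpha> x) integrable_on {..x}"
      using kap_has_integral_atMost[OF \<alpha>, of x] by (auto intro!: integrable_on_mult_right)
  qed (use bd in auto)
  have ge: "?F y = ?F x + integral {x..y} f" if "x \<le> y" for x y
  proof -
    have "integral ({..x} \<union> {x..y}) f = ?F x + integral {x..y} f"
    proof (rule integral_Un[OF at loc])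
      have "{..x} \<inter> {x..y} = {x}" using that by auto
      then show "negligible ({..x} \<inter> {x..y})" by simp
    qed
    moreover have "{..x} \<union> {x..y} = {..y}" using that by auto
    ultimately show ?thesis by simp
  qed
  \<comment> \<open>Locally the half-line integral differs from an integral with base point
    \<open>x - 1\<close> by a constant, and the latter is differentiable on a compact
    interval.\<close>
  have der: "(?F has_vector_derivative f x) (at x)" for x
  proof -
    have "((\<lambda>u. integral {x-1..u} f) has_vector_derivative f x) (at x within {x-1..x+1})"
      by (intro integral_has_vector_derivative) (auto intro: continuous_on_subset[OF cont])
    then have "((\<lambda>u. integral {x-1..u} f) has_vector_derivative f x) (at x)"
      by (simp add: at_within_Icc_at)
    then have "((\<lambda>u. ?F (x-1) + integral {x-1..u} f) has_vector_derivative (0 + f x)) (at x)"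
      by (intro has_vector_derivative_add has_vector_derivative_const)
    then have "((\<lambda>u. ?F (x-1) + integral {x-1..u} f) has_vector_derivative f x) (at x)" by simp
    then show ?thesis
      by (rule has_vector_derivative_transform_within_open[of _ _ _ "{x-1<..}"])
        (auto intro!: ge[symmetric])
  qed
  have nF: "norm (?F x) \<le> M * (arctan (exp (\<alpha> * x)) / \<alpha>)" for x
  proof -
    have h: "((\<lambda>x. M * kap \<alpha> x) has_integral M * (arctan (exp (\<alpha> * x)) / \<alpha>)) {..x}"
      by (intro has_integral_mult_right kap_has_integral_atMost assms)
    have "norm (?F x) \<le> integral {..x} (\<lambda>x. M * kap \<alpha> x)"
      using h by (intro integral_norm_bound_integral at bd) auto
    then show ?thesis using integral_unique[OF h] by simp
  qed
  have bot: "(?F \<longlongrightarrow> 0) at_bot"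
  proof (rule Lim_null_comparison)
    show "\<forall>\<^sub>F x in at_bot. norm (?F x) \<le> M * (arctan (exp (\<alpha> * x)) / \<alpha>)"
      using nF by simp
    show "((\<lambda>x. M * (arctan (exp (\<alpha> * x)) / \<alpha>)) \<longlongrightarrow> 0) at_bot"
      using \<alpha> by (intro tendsto_mult_right_zero) real_asymp
  qed
  \<comment> \<open>\<open>?F b\<close> is \<open>?F (-b)\<close> plus a symmetric truncation, so
    the limit at the right end follows from the one at the left.\<close>
  have "((\<lambda>b. ?F (-b) + integral {-b..b} f) \<longlongrightarrow> 0 + integral UNIV f) at_top"
    by (intro tendsto_add integral_UNIV_limit f filterlim_compose[OF bot] filterlim_uminus_at_bot_at_top)
  then have "(?F \<longlongrightarrow> integral UNIV f) at_top"
    by (intro Lim_transform_eventually[where g="?F"])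
       (simp, rule eventually_mono[OF eventually_ge_at_top[of 0]], rule ge[symmetric], simp)
  with der bot show ?thesis by (intro that[of ?F])
qed

section \<open>Logarithmic change of variables on a path through 0\<close>

text \<open>The two half-lines are covered by t = exp x and t = - exp x. Since \<open>f\<close> may
  be unbounded near 0, the substitution is made in primitives, not in the integrals.\<close>

lemma has_integral_log_substitution:
  fixes f :: "real \<Rightarrow> 'a::banach"
  assumes p: "continuous_on UNIV (\<lambda>x. exp x *\<^sub>R f (exp x))" "\<And>x. norm (exp x *\<^sub>R f (exp x)) \<le> M * kap \<alpha> x"
    and m: "continuous_on UNIV (\<lambda>x. exp x *\<^sub>R f (- exp x))" "\<And>x. norm (exp x *\<^sub>R f (- exp x)) \<le> M * kap \<alpha> x"
    and \<alpha>: "\<alpha> > 0"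
  shows "(f has_integral (integral UNIV (\<lambda>x. exp x *\<^sub>R f (- exp x) + exp x *\<^sub>R f (exp x)))) UNIV"
proof -
  obtain P where P: "\<And>x. (P has_vector_derivative exp x *\<^sub>R f (exp x)) (at x)"
    "(P \<longlongrightarrow> 0) at_bot" "(P \<longlongrightarrow> integral UNIV (\<lambda>x. exp x *\<^sub>R f (exp x))) at_top"
    using antiderivative_with_limits[OF p \<alpha>] by blast
  obtain N where N: "\<And>x. (N has_vector_derivative exp x *\<^sub>R f (- exp x)) (at x)"
    "(N \<longlongrightarrow> 0) at_bot" "(N \<longlongrightarrow> integral UNIV (\<lambda>x. exp x *\<^sub>R f (- exp x))) at_top"
    using antiderivative_with_limits[OF m \<alpha>] by blast
  \<comment> \<open>Both branches tend to 0 at t = 0, because ln |t| tends to minus infinity there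
    and \<open>P\<close>, \<open>N\<close> vanish at that end. Hence \<open>F\<close> is continuous
    and 0 is the only exceptional point.\<close>
  define F where "F t = (if t > 0 then P (ln t) else if t < 0 then - N (ln (-t)) else 0)" for t
  have dpos: "(F has_vector_derivative f t) (at t)" if "t > 0" for t
  proof -
    have "((P \<circ> ln) has_vector_derivative (inverse t *\<^sub>R (exp (ln t) *\<^sub>R f (exp (ln t))))) (at t)"
      by (rule vector_diff_chain_at[OF DERIV_ln[OF that, unfolded has_real_derivative_iff_has_vector_derivative] P(1)])
    then have "((P \<circ> ln) has_vector_derivative f t) (at t)" using that by simp
    then show ?thesis
      by (rule has_vector_derivative_transform_within_open[of _ _ _ "{0<..}"]) (use that in \<open>auto simp: F_def\<close>)
  qed
  have dneg: "(F has_vector_derivative f t) (at t)" if "t < 0" for t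
  proof -
    have "((\<lambda>t. ln (-t)) has_vector_derivative (inverse t)) (at t)"
      unfolding has_real_derivative_iff_has_vector_derivative[symmetric]
      using that by (auto intro!: derivative_eq_intros simp: divide_simps)
    then have "((N \<circ> (\<lambda>t. ln (-t))) has_vector_derivative (inverse t *\<^sub>R (exp (ln (-t)) *\<^sub>R f (- exp (ln (-t)))))) (at t)"
      by (rule vector_diff_chain_at[OF _ N(1)])
    then have "((N \<circ> (\<lambda>t. ln (-t))) has_vector_derivative (- f t)) (at t)" using that by simp
    then have "((\<lambda>t. - (N \<circ> (\<lambda>t. ln (-t))) t) has_vector_derivative (- (- f t))) (at t)"
      by (rule has_vector_derivative_minus)
    then have "((\<lambda>t. - (N \<circ> (\<lambda>t. ln (-t))) t) has_vector_derivative f t) (at t)" by simp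
    then show ?thesis
      by (rule has_vector_derivative_transform_within_open[of _ _ _ "{..<0}"]) (use that in \<open>auto simp: F_def\<close>)
  qed
  have lnr: "filterlim (\<lambda>t::real. ln t) at_bot (at_right 0)"
    by real_asymp
  have lnl: "filterlim (\<lambda>t::real. ln (-t)) at_bot (at_left 0)"
    by real_asymp
  have c0: "isCont F 0"
  proof -
    have "(F \<longlongrightarrow> 0) (at_right 0)"
      by (rule Lim_transform_eventually[OF filterlim_compose[OF P(2) lnr]])
         (rule eventually_mono[OF eventually_at_right_less[of 0]], simp add: F_def)
    moreover have "((\<lambda>t. - N (ln (-t))) \<longlongrightarrow> - 0) (at_left 0)"
      by (intro tendsto_minus filterlim_compose[OF N(2) lnl])
    then have "(F \<longlongrightarrow> 0) (at_left 0)"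
      by (intro Lim_transform_eventually[where g=F]) (simp, simp add: F_def eventually_at_filter)
    ultimately show ?thesis
      by (simp add: isCont_def filterlim_split_at F_def)
  qed
  have "isCont F t" for t
  proof (cases t "0::real" rule: linorder_cases)
    case less
    show ?thesis by (rule has_vector_derivative_continuous[OF dneg[OF less]])
  next
    case equal
    then show ?thesis using c0 by simp
  next
    case greater
    show ?thesis by (rule has_vector_derivative_continuous[OF dpos[OF greater]])
  qed
  then have "continuous_on UNIV F" by (simp add: continuous_at_imp_continuous_on)
  moreover have "(F \<longlongrightarrow> integral UNIV (\<lambda>x. exp x *\<^sub>R f (exp x))) at_top"
    by (rule Lim_transform_eventually[OF filterlim_compose[OF P(3) ln_at_top]])
       (rule eventually_mono[OF eventually_gt_at_top[of 0]], simp add: F_def)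
  moreover have "(F \<longlongrightarrow> - integral UNIV (\<lambda>x. exp x *\<^sub>R f (- exp x))) at_bot"
  proof -
    have "filterlim (\<lambda>t::real. ln (-t)) at_top at_bot" by real_asymp
    then have "((\<lambda>t. - N (ln (-t))) \<longlongrightarrow> - integral UNIV (\<lambda>x. exp x *\<^sub>R f (- exp x))) at_bot"
      by (intro tendsto_minus filterlim_compose[OF N(3)])
    then show ?thesis
      by (rule Lim_transform_eventually)
         (rule eventually_mono[OF eventually_gt_at_bot[of 0]], simp add: F_def)
  qed
  ultimately have "(f has_integral (integral UNIV (\<lambda>x. exp x *\<^sub>R f (exp x)) - - integral UNIV (\<lambda>x. exp x *\<^sub>R f (- exp x)))) UNIV"
  proof (intro has_integral_UNIV_antiderivative[of "{0}" F])
    show "(F has_vector_derivative f x) (at x)" if "x \<notin> {0}" for x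
      using dpos[of x] dneg[of x] that by (cases "x > 0") auto
  qed auto
  moreover have "integral UNIV (\<lambda>x. exp x *\<^sub>R f (- exp x) + exp x *\<^sub>R f (exp x))
     = integral UNIV (\<lambda>x. exp x *\<^sub>R f (- exp x)) + integral UNIV (\<lambda>x. exp x *\<^sub>R f (exp x))"
    by (intro Henstock_Kurzweil_Integration.integral_add integrable_kap_dominated(1)[OF p \<alpha>] integrable_kap_dominated(1)[OF m \<alpha>])
  ultimately show ?thesis by (simp add: add.commute)
qed

section \<open>Interchange of integrals and displacement of lines\<close>

text \<open>The tail of each inner integral is at most \<open>M * kap \<alpha> s\<close> times the
  tail mass of \<open>kap \<beta>\<close>, which is integrable in \<open>s\<close> and tends to 0.
  So truncating both variables to one square is harmless.\<close>

lemma iterated_integral_UNIV_limit: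
  fixes F :: "real \<Rightarrow> real \<Rightarrow> 'a::banach"
  assumes cont: "continuous_on UNIV (\<lambda>(s, t). F s t)" and M: "M \<ge> 0" and \<alpha>: "\<alpha> > 0" and \<beta>: "\<beta> > 0"
    and bd: "\<And>s t. norm (F s t) \<le> M * kap \<alpha> s * kap \<beta> t"
  shows "(\<lambda>s. integral UNIV (F s)) integrable_on UNIV"
    "((\<lambda>b. integral {-b..b} (\<lambda>s. integral {-b..b} (F s))) \<longlongrightarrow> integral UNIV (\<lambda>s. integral UNIV (F s))) at_top"
proof -
  have cs: "continuous_on UNIV (F s)" for s
    using continuous_on_compose2[OF cont, of UNIV "\<lambda>t. (s, t)"]
    by (simp add: continuous_on_Pair)
  have ints: "F s integrable_on UNIV" for s
    using integrable_kap_dominated[OF cs bd \<beta>] by blast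
  \<comment> \<open>The mass of \<open>kap \<beta>\<close> outside the truncation interval.\<close>
  define \<tau> where "\<tau> b = integral UNIV (kap \<beta>) - integral {-b..b} (kap \<beta>)" for b
  have loc: "kap \<beta> integrable_on {a..b}" for a b
    by (intro integrable_continuous_interval continuous_intros)
  have \<tau>0: "\<tau> b \<ge> 0" for b
    unfolding \<tau>_def using integral_subset_le[OF subset_UNIV loc kap_integrable[OF \<beta>], of "-b" b] kap_pos
    by (auto intro: less_imp_le)
  have \<tau>: "(\<tau> \<longlongrightarrow> 0) at_top"
    unfolding \<tau>_def using tendsto_diff[OF tendsto_const integral_UNIV_limit[OF kap_integrable[OF \<beta>]], of "integral UNIV (kap \<beta>)"]
    by simp
  have diff: "norm (integral UNIV (F s) - integral {-b..b} (F s)) \<le> M * kap \<alpha> s * \<tau> b" for s b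
  proof -
    have li: "F s integrable_on {-b..b}"
      by (intro integrable_continuous_interval continuous_on_subset[OF cs]) auto
    have 1: "integral (UNIV - {-b..b}) (F s) = integral UNIV (F s) - integral {-b..b} (F s)"
      by (intro integral_setdiff ints li) auto
    have 2: "integral (UNIV - {-b..b}) (kap \<beta>) = \<tau> b"
      unfolding \<tau>_def by (intro integral_setdiff kap_integrable loc \<beta>) auto
    have 3: "kap \<beta> integrable_on (UNIV - {-b..b})"
      by (rule integrable_setdiff[OF integrable_integral[OF kap_integrable[OF \<beta>]] integrable_integral[OF loc]]) auto
    have "norm (integral (UNIV - {-b..b}) (F s)) \<le> integral (UNIV - {-b..b}) (\<lambda>t. M * kap \<alpha> s * kap \<beta> t)"
      by (intro integral_norm_bound_integral bd integrable_on_mult_right 3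
          integrable_setdiff[OF integrable_integral[OF ints] integrable_integral[OF li]]) auto
    then show ?thesis
      by (simp add: 1 2)
  qed
  have Ic: "continuous_on UNIV (\<lambda>s. integral {-b..b} (F s))" for b
  proof -
    have "continuous_on UNIV (\<lambda>s. integral (cbox (-b) b) (F s))"
      by (rule integral_continuous_on_param) (auto intro: continuous_on_subset[OF cont])
    then show ?thesis by simp
  qed
  \<comment> \<open>By \<open>kap_le_1\<close> the tail estimate is uniform in \<open>s\<close>, so
    the full inner integral is a uniform limit of continuous functions.\<close>
  have cont2: "continuous_on UNIV (\<lambda>s. integral UNIV (F s))"
  proof (rule uniform_limit_theorem[of _ "\<lambda>b s. integral {-b..b} (F s)" at_top])
    show "uniform_limit UNIV (\<lambda>b s. integral {-b..b} (F s)) (\<lambda>s. integral UNIV (F s)) at_top"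
    proof (rule uniform_limitI)
      fix e :: real assume e: "e > 0"
      have "((\<lambda>b. M * \<tau> b) \<longlongrightarrow> 0) at_top"
        using \<tau> by (rule tendsto_mult_right_zero)
      then have "\<forall>\<^sub>F b in at_top. M * \<tau> b < e"
        using e by (simp add: order_tendsto_iff)
      then show "\<forall>\<^sub>F b in at_top. \<forall>s\<in>UNIV. dist (integral {-b..b} (F s)) (integral UNIV (F s)) < e"
      proof eventually_elim
        case (elim b)
        have "dist (integral {-b..b} (F s)) (integral UNIV (F s)) < e" for s
        proof -
          have "dist (integral {-b..b} (F s)) (integral UNIV (F s)) \<le> M * kap \<alpha> s * \<tau> b"
            using diff[of s b] by (simp add: dist_norm norm_minus_commute)
          also have "\<dots> \<le> M * 1 * \<tau> b"
            using M \<tau>0 kap_le_1 by (intro mult_right_mono mult_left_mono) auto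
          finally show ?thesis using elim by simp
        qed
        then show ?case by simp
      qed
    qed
  qed (use Ic in auto)
  have nI: "norm (integral UNIV (F s)) \<le> M * (pi / 2 / \<beta>) * kap \<alpha> s" for s
    using integrable_kap_dominated(2)[OF cs bd \<beta>, of s] by (simp add: mult_ac)
  show II: "(\<lambda>s. integral UNIV (F s)) integrable_on UNIV"
    by (rule integrable_kap_dominated[OF cont2 nI \<alpha>])
  have lim1: "((\<lambda>b. integral {-b..b} (\<lambda>s. integral UNIV (F s))) \<longlongrightarrow> integral UNIV (\<lambda>s. integral UNIV (F s))) at_top"
    by (rule integral_UNIV_limit[OF II])
  have lim2: "((\<lambda>b. integral {-b..b} (\<lambda>s. integral {-b..b} (F s)) - integral {-b..b} (\<lambda>s. integral UNIV (F s))) \<longlongrightarrow> 0) at_top"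
  proof (rule Lim_null_comparison)
    show "((\<lambda>b. M * \<tau> b * (pi / 2 / \<alpha>)) \<longlongrightarrow> 0) at_top"
      using tendsto_mult_left_zero[OF tendsto_mult_right_zero[OF \<tau>]] by blast
    have "norm (integral {-b..b} (\<lambda>s. integral {-b..b} (F s)) - integral {-b..b} (\<lambda>s. integral UNIV (F s)))
       \<le> M * \<tau> b * (pi / 2 / \<alpha>)" for b
    proof -
      have i1: "(\<lambda>s. integral {-b..b} (F s)) integrable_on {-b..b}"
        by (intro integrable_continuous_interval continuous_on_subset[OF Ic]) auto
      have i2: "(\<lambda>s. integral UNIV (F s)) integrable_on {-b..b}"
        by (intro integrable_continuous_interval continuous_on_subset[OF cont2]) auto
      have kl: "kap \<alpha> integrable_on {-b..b}"
        by (intro integrable_continuous_interval continuous_intros)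
      have "norm (integral {-b..b} (\<lambda>s. integral {-b..b} (F s) - integral UNIV (F s)))
         \<le> integral {-b..b} (\<lambda>s. M * \<tau> b * kap \<alpha> s)"
      proof (rule integral_norm_bound_integral)
        fix s
        show "norm (integral {-b..b} (F s) - integral UNIV (F s)) \<le> M * \<tau> b * kap \<alpha> s"
          using diff[of s b] by (simp add: norm_minus_commute mult_ac)
      qed (auto intro!: integrable_diff i1 i2 kl integrable_on_mult_right)
      also have "\<dots> = M * \<tau> b * integral {-b..b} (kap \<alpha>)" by simp
      also have "\<dots> \<le> M * \<tau> b * (pi / 2 / \<alpha>)"
      proof (rule mult_left_mono)
        have "integral {-b..b} (kap \<alpha>) \<le> integral UNIV (kap \<alpha>)"
          using integral_subset_le[OF subset_UNIV kl kap_integrable[OF \<alpha>]] kap_pos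
          by (auto intro: less_imp_le)
        then show "integral {-b..b} (kap \<alpha>) \<le> pi / 2 / \<alpha>"
          using integral_unique[OF kap_has_integral_UNIV[OF \<alpha>]] by simp
      qed (use M \<tau>0 in auto)
      finally show ?thesis
        by (simp add: Henstock_Kurzweil_Integration.integral_diff[OF i1 i2])
    qed
    then show "\<forall>\<^sub>F b in at_top. norm (integral {-b..b} (\<lambda>s. integral {-b..b} (F s)) - integral {-b..b} (\<lambda>s. integral UNIV (F s)))
       \<le> M * \<tau> b * (pi / 2 / \<alpha>)" by simp
  qed
  show "((\<lambda>b. integral {-b..b} (\<lambda>s. integral {-b..b} (F s))) \<longlongrightarrow> integral UNIV (\<lambda>s. integral UNIV (F s))) at_top"
    using tendsto_add[OF lim2 lim1] by simp
qed

text \<open>On compact squares the order of integration is free, and both iterated integrals are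
  limits over the same squares.\<close>

lemma integral_UNIV_swap:
  fixes F :: "real \<Rightarrow> real \<Rightarrow> 'a::banach"
  assumes cont: "continuous_on UNIV (\<lambda>(s, t). F s t)" and M: "M \<ge> 0" and \<alpha>: "\<alpha> > 0" and \<beta>: "\<beta> > 0"
    and bd: "\<And>s t. norm (F s t) \<le> M * kap \<alpha> s * kap \<beta> t"
  shows "(\<lambda>s. integral UNIV (F s)) integrable_on UNIV"
    "(\<lambda>t. integral UNIV (\<lambda>s. F s t)) integrable_on UNIV"
    "integral UNIV (\<lambda>s. integral UNIV (F s)) = integral UNIV (\<lambda>t. integral UNIV (\<lambda>s. F s t))"
proof -
  have cont': "continuous_on UNIV (\<lambda>(t, s). F s t)"
    using continuous_on_compose2[OF cont, of UNIV "\<lambda>p. (snd p, fst p)"]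
    by (simp add: case_prod_unfold continuous_on_fst continuous_on_snd continuous_on_Pair)
  have bd': "norm (F s t) \<le> M * kap \<beta> t * kap \<alpha> s" for s t
    using bd[of s t] by (simp add: mult_ac)
  have eq: "integral {-b..b} (\<lambda>s. integral {-b..b} (F s)) = integral {-b..b} (\<lambda>t. integral {-b..b} (\<lambda>s. F s t))" for b
    using integral_swap_continuous[of "-b" "-b" b b F] continuous_on_subset[OF cont] by auto
  show "(\<lambda>s. integral UNIV (F s)) integrable_on UNIV"
    by (rule iterated_integral_UNIV_limit(1)[OF cont M \<alpha> \<beta> bd])
  show "(\<lambda>t. integral UNIV (\<lambda>s. F s t)) integrable_on UNIV"
    by (rule iterated_integral_UNIV_limit(1)[OF cont' M \<beta> \<alpha> bd'])
  show "integral UNIV (\<lambda>s. integral UNIV (F s)) = integral UNIV (\<lambda>t. integral UNIV (\<lambda>s. F s t))"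
    using tendsto_unique[OF _ iterated_integral_UNIV_limit(2)[OF cont M \<alpha> \<beta> bd]
       iterated_integral_UNIV_limit(2)[OF cont' M \<beta> \<alpha> bd', folded eq]] by simp
qed

text \<open>Cauchy's theorem between two horizontal lines for vector-valued functions.
  \<open>J\<close> stands for multiplication by the imaginary unit, and the two derivative
  hypotheses together are the Cauchy-Riemann equation.\<close>

lemma integral_line_shift:
  fixes F F' :: "real \<Rightarrow> real \<Rightarrow> 'a::banach"
  assumes ab: "a \<le> b" and J: "bounded_linear J"
    and dy: "\<And>y s. y \<in> {a..b} \<Longrightarrow> ((\<lambda>y. F y s) has_vector_derivative J (F' y s)) (at y within {a..b})"
    and ds: "\<And>y s. y \<in> {a..b} \<Longrightarrow> (F y has_vector_derivative F' y s) (at s)"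
    and cont: "continuous_on ({a..b} \<times> UNIV) (\<lambda>(y, s). F' y s)"
    and bd: "\<And>y s. y \<in> {a..b} \<Longrightarrow> norm (F y s) \<le> M * kap \<alpha> s" and \<alpha>: "\<alpha> > 0"
  shows "integral UNIV (F a) = integral UNIV (F b)"
proof -
  obtain C where C: "C > 0" "\<And>x. norm (J x) \<le> norm x * C"
    using bounded_linear.pos_bounded[OF J] by auto
  have cF: "continuous_on UNIV (F y)" if "y \<in> {a..b}" for y
    using ds[OF that] by (auto intro!: continuous_at_imp_continuous_on has_vector_derivative_continuous)
  have int: "F y integrable_on UNIV" if "y \<in> {a..b}" for y
    using integrable_kap_dominated[OF cF[OF that] bd[OF that] \<alpha>] by blast
  define I where "I n y = integral (cbox (-n) n) (F y)" for n y
  have bound: "norm (I n b - I n a) \<le> 2 * C * M * kap \<alpha> n * (b - a)" if n: "n \<ge> 0" for n :: real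
  proof -
    \<comment> \<open>The derivative in \<open>y\<close> is \<open>J\<close> of the derivative in
      \<open>s\<close>, whose integral over \<open>s\<close> leaves only boundary values. These
      decay like \<open>kap \<alpha> n\<close>.\<close>
    have der: "(I n has_vector_derivative J (F y n - F y (-n))) (at y within {a..b})" if y: "y \<in> {a..b}" for y
    proof -
      have "(I n has_vector_derivative integral (cbox (-n) n) (\<lambda>s. J (F' y s))) (at y within {a..b})"
        unfolding I_def
      proof (rule leibniz_rule_vector_derivative)
        show "continuous_on ({a..b} \<times> cbox (-n) n) (\<lambda>(y, s). J (F' y s))"
          using bounded_linear.continuous_on[OF J continuous_on_subset[OF cont, of "{a..b} \<times> cbox (-n) n"]]
          by (auto simp: case_prod_unfold)
        show "F y integrable_on cbox (-n) n" if "y \<in> {a..b}" for y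
          using cF[OF that] by (auto intro!: integrable_continuous_interval intro: continuous_on_subset)
      qed (use y dy in auto)
      moreover have "(F' y has_integral (F y n - F y (-n))) {-n..n}"
        by (rule fundamental_theorem_of_calculus)
          (use n in simp, rule has_vector_derivative_at_within[OF ds[OF y]])
      then have "((\<lambda>s. J (F' y s)) has_integral J (F y n - F y (-n))) {-n..n}"
        using has_integral_linear[OF _ J] by (auto simp: o_def)
      ultimately show ?thesis by (auto simp: integral_unique)
    qed
    have "norm (I n b - I n a) \<le> (2 * C * M * kap \<alpha> n) * norm (b - a)"
    proof (rule differentiable_bound[OF _ der[unfolded has_vector_derivative_def]])
      show "convex {a..b}" by simp
      fix y assume y: "y \<in> {a..b}"
      have "norm (F y n - F y (-n)) \<le> norm (F y n) + norm (F y (-n))" by (rule norm_triangle_ineq4)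
      also have "\<dots> \<le> 2 * M * kap \<alpha> n" using bd[OF y, of n] bd[OF y, of "-n"] by (simp add: kap_minus)
      finally have "norm (F y n - F y (-n)) * C \<le> 2 * M * kap \<alpha> n * C"
        using C(1) by simp
      then have "norm (J (F y n - F y (-n))) \<le> 2 * C * M * kap \<alpha> n"
        using C(2)[of "F y n - F y (-n)"] by (simp add: mult_ac)
      then show "onorm (\<lambda>x. x *\<^sub>R J (F y n - F y (-n))) \<le> 2 * C * M * kap \<alpha> n"
        using onorm_scaleR_left[of "\<lambda>x. x" "J (F y n - F y (-n))"] onorm_id[where 'a=real]
        by (simp add: bounded_linear_ident)
    qed (use ab in auto)
    then show ?thesis using ab by simp
  qed
  have "((\<lambda>n. I n b - I n a) \<longlongrightarrow> integral UNIV (F b) - integral UNIV (F a)) at_top"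
    unfolding I_def using integral_UNIV_limit[OF int] ab by (auto intro!: tendsto_diff)
  moreover have "((\<lambda>n. I n b - I n a) \<longlongrightarrow> 0) at_top"
  proof (rule Lim_null_comparison)
    show "\<forall>\<^sub>F n in at_top. norm (I n b - I n a) \<le> 2 * C * M * kap \<alpha> n * (b - a)"
      using eventually_ge_at_top[of 0] by eventually_elim (rule bound)
    show "((\<lambda>n. 2 * C * M * kap \<alpha> n * (b - a)) \<longlongrightarrow> 0) at_top"
      by (intro tendsto_mult_left_zero tendsto_mult_right_zero kap_at_top \<alpha>)
  qed
  ultimately have "integral UNIV (F b) - integral UNIV (F a) = 0"
    by (rule tendsto_unique[OF trivial_limit_at_top_linorder])
  then show ?thesis by simp
qed

section \<open>The Cauchy formula on a strip\<close>

text \<open>For \<open>z = exp \<zeta>\<close>, \<open>w = exp \<eta>\<close> the Cauchy kernel \<open>dz / (z - w)\<close> becomes \<open>kker (\<eta> - \<zeta>) d\<zeta>\<close>.\<close>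

definition kker :: "complex \<Rightarrow> complex" where
  "kker \<xi> = 1 / (1 - exp \<xi>)"

lemma exp_neq_1:
  fixes \<xi> :: complex
  assumes "0 < \<bar>Im \<xi>\<bar>" "\<bar>Im \<xi>\<bar> < 2 * pi"
  shows "exp \<xi> \<noteq> 1"
proof
  assume "exp \<xi> = 1"
  then obtain n :: int where n: "Im \<xi> = of_int (2 * n) * pi"
    unfolding exp_eq_1 by blast
  then have "n \<noteq> 0" using assms by auto
  then have "\<bar>of_int n :: real\<bar> \<ge> 1" by linarith
  then have "\<bar>of_int n :: real\<bar> * (2 * pi) \<ge> 1 * (2 * pi)"
    by (intro mult_right_mono) auto
  then have "\<bar>Im \<xi>\<bar> \<ge> 2 * pi"
    unfolding n by (simp add: abs_mult)
  then show False using assms by simp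
qed

text \<open>With z = exp \<open>\<zeta>\<close> and w = exp \<open>\<eta>\<close> this is z / (z -
  w) + w / (w - z) = 1.\<close>

lemma kker_add:
  assumes "exp \<xi> \<noteq> 1"
  shows "kker \<xi> + kker (-\<xi>) = 1"
  using assms by (simp add: kker_def exp_minus divide_simps) (simp add: algebra_simps)

text \<open>The bound does not depend on Re \<open>\<xi>\<close>: along a horizontal line that keeps
  the distance \<open>d\<close> from the poles at multiples of 2 pi i the kernel costs only a
  constant.\<close>

lemma norm_kker_le:
  assumes "0 < d" "d \<le> \<bar>Im \<xi>\<bar>" "\<bar>Im \<xi>\<bar> \<le> 2 * pi - d"
  shows "norm (kker \<xi>) \<le> sqrt (2 / (1 - cos d))"
proof -
  have d: "d \<le> pi" using assms by linarith
  define y where "y = \<bar>Im \<xi>\<bar>"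
  define \<rho> where "\<rho> = exp (Re \<xi>)"
  have cy: "cos y \<le> cos d"
  proof (cases "y \<le> pi")
    case True
    then show ?thesis
      using assms d by (intro cos_monotone_0_pi_le) (auto simp: y_def)
  next
    case False
    have "cos y = cos (2 * pi - y)" by (simp add: cos_diff)
    also have "\<dots> \<le> cos d"
      using assms d False by (intro cos_monotone_0_pi_le) (auto simp: y_def)
    finally show ?thesis .
  qed
  have cd: "cos d < 1"
    using assms d cos_monotone_0_pi[of 0 d] by simp
  have "(norm (1 - exp \<xi>))\<^sup>2 = (1 - \<rho> * cos y)\<^sup>2 + (\<rho> * sin (Im \<xi>))\<^sup>2"
    by (simp add: cmod_power2 Re_exp Im_exp \<rho>_def y_def abs_if)
  also have "(\<rho> * sin (Im \<xi>))\<^sup>2 = \<rho>\<^sup>2 - (\<rho> * cos y)\<^sup>2"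
    by (simp add: y_def abs_if power_mult_distrib sin_squared_eq algebra_simps)
  \<comment> \<open>Decomposition of 1 - 2 \<open>\<rho>\<close> cos y + \<open>\<rho>\<close>^2
    into two nonnegative squares. The second is dropped, and 1 + \<open>\<rho>\<close> is at least 1
    in the first.\<close>
  also have "(1 - \<rho> * cos y)\<^sup>2 + (\<rho>\<^sup>2 - (\<rho> * cos y)\<^sup>2) = (1 - cos y) / 2 * (1 + \<rho>)\<^sup>2 + (1 + cos y) / 2 * (1 - \<rho>)\<^sup>2"
    by (simp add: power2_eq_square field_simps)
  also have "\<dots> \<ge> (1 - cos d) / 2 * 1 + 0"
  proof (intro add_mono mult_mono)
    have "1 \<le> 1 + \<rho>" by (simp add: \<rho>_def)
    then show "1 \<le> (1 + \<rho>)\<^sup>2" by simp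
    have "0 \<le> 1 + cos y" using cos_ge_minus_one[of y] by linarith
    then show "0 \<le> (1 + cos y) / 2 * (1 - \<rho>)\<^sup>2" by simp
  qed (use cy in auto)
  finally have "(norm (1 - exp \<xi>))\<^sup>2 \<ge> (1 - cos d) / 2" by simp
  then have "norm (1 - exp \<xi>) \<ge> sqrt ((1 - cos d) / 2)"
    by (simp add: real_le_lsqrt)
  moreover have "sqrt ((1 - cos d) / 2) > 0" using cd by simp
  ultimately have "1 / norm (1 - exp \<xi>) \<le> 1 / sqrt ((1 - cos d) / 2)"
    by (intro divide_left_mono mult_pos_pos) linarith+
  then show ?thesis
    by (simp add: kker_def norm_divide real_sqrt_divide)
qed

text \<open>For the vertical sides of rectangles, where the imaginary part may vanish. There |1 -
  exp \<open>\<xi>\<close>| is at least |1 - exp (Re \<open>\<xi>\<close>)|, which is at least 1/2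
  because e is at least 2.\<close>

lemma norm_kker_le_2:
  assumes "\<bar>Re \<xi>\<bar> \<ge> 1"
  shows "norm (kker \<xi>) \<le> 2"
proof -
  have "\<bar>1 - exp (Re \<xi>)\<bar> \<ge> 1/2"
  proof (cases "Re \<xi> \<ge> 0")
    case True
    then show ?thesis using exp_ge_add_one_self[of "Re \<xi>"] assms by linarith
  next
    case False
    then have "exp (Re \<xi>) = inverse (exp (- Re \<xi>))" by (simp add: exp_minus)
    moreover have "exp (- Re \<xi>) \<ge> 2" using exp_ge_add_one_self[of "- Re \<xi>"] assms False by linarith
    ultimately have "exp (Re \<xi>) \<le> inverse 2"
      using le_imp_inverse_le[of 2 "exp (- Re \<xi>)"] by linarith
    moreover have "inverse 2 = (1/2 :: real)" by simp
    ultimately show ?thesis by linarith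
  qed
  also have "\<bar>1 - exp (Re \<xi>)\<bar> \<le> norm (1 - exp \<xi>)"
    using norm_triangle_ineq3[of 1 "exp \<xi>"] by simp
  finally have "norm (1 - exp \<xi>) \<ge> 1/2" .
  then have "1 / norm (1 - exp \<xi>) \<le> 1 / (1/2)"
    by (intro divide_left_mono) (auto intro: mult_pos_pos)
  then show ?thesis by (simp add: kker_def norm_divide)
qed

lemma continuous_on_kker:
  assumes "continuous_on S f" "\<And>x. x \<in> S \<Longrightarrow> exp (f x) \<noteq> 1"
  shows "continuous_on S (\<lambda>x. kker (f x))"
  unfolding kker_def by (intro continuous_intros assms) (use assms(2) in force)

lemma has_contour_integral_linepath_same_Im:
  assumes "a < b" and f: "(\<lambda>s. f (Complex s y)) integrable_on {a..b}"
  shows "(f has_contour_integral (integral {a..b} (\<lambda>s. f (Complex s y)))) (linepath (Complex a y) (Complex b y))"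
proof -
  let ?m = "b - a"
  have m: "?m > 0" using assms by simp
  have "((\<lambda>s. f (Complex s y)) has_integral (integral {a..b} (\<lambda>s. f (Complex s y)))) (cbox a b)"
    using f by (simp add: integrable_integral)
  from has_integral_affinity[OF this, of ?m a] m
  have "((\<lambda>x. f (Complex (?m * x + a) y)) has_integral ((1 / ?m) *\<^sub>R integral {a..b} (\<lambda>s. f (Complex s y))))
     ((\<lambda>x. (1 / ?m) * x + -((1 / ?m) * a)) ` {a..b})" by simp
  also have "(\<lambda>x. (1 / ?m) * x + -((1 / ?m) * a)) ` {a..b} = {0..1}"
  proof -
    have "(\<lambda>x. (1 / ?m) * x + -((1 / ?m) * a)) ` {a..b} = {(1 / ?m) * a + -((1 / ?m) * a)..(1 / ?m) * b + -((1 / ?m) * a)}"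
      using image_affinity_atLeastAtMost[of "1 / ?m" "-((1 / ?m) * a)" a b] m by simp
    moreover have "(1 / ?m) * b + -((1 / ?m) * a) = 1"
      using m by (metis diff_divide_distrib divide_self_if less_numeral_extra(3) mult.commute mult_1_right times_divide_eq_right uminus_add_conv_diff add.commute)
    ultimately show ?thesis by simp
  qed
  finally have "((\<lambda>x. f (Complex (?m * x + a) y) * of_real ?m) has_integral ((1 / ?m) *\<^sub>R integral {a..b} (\<lambda>s. f (Complex s y))) * of_real ?m) {0..1}"
    by (rule has_integral_mult_left)
  moreover have "((1 / ?m) *\<^sub>R integral {a..b} (\<lambda>s. f (Complex s y))) * of_real ?m = integral {a..b} (\<lambda>s. f (Complex s y))"
    using m by (simp add: scaleR_conv_of_real field_simps del: of_real_diff)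
  moreover have "linepath (Complex a y) (Complex b y) x = Complex (?m * x + a) y" for x
    by (simp add: linepath_def complex_eq_iff algebra_simps)
  moreover have "Complex b y - Complex a y = of_real ?m"
    by (simp add: complex_eq_iff)
  ultimately show ?thesis
    unfolding has_contour_integral_linepath by simp
qed

section \<open>Long rectangles in a strip\<close>

text \<open>A positively oriented rectangle runs rightwards below and leftwards above, whence the
  sign of the difference. The vertical sides have fixed length and an integrand that decays like
  \<open>kap\<close>. The value \<open>c\<close> is 0 or the residue term in the two
  applications.\<close>

lemma strip_boundary_integral:
  fixes f :: "complex \<Rightarrow> complex"
  assumes \<theta>: "0 < \<theta>" and \<alpha>: "\<alpha> > 0"
    and low: "(\<lambda>s. f (Complex s (-\<theta>))) integrable_on UNIV"
    and up: "(\<lambda>s. f (Complex s \<theta>)) integrable_on UNIV"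
    and rect: "\<And>b. b \<ge> b0 \<Longrightarrow> (f has_contour_integral c) (rectpath (Complex (-b) (-\<theta>)) (Complex b \<theta>))"
    and side: "\<And>b z. b \<ge> b0 \<Longrightarrow> \<bar>Re z\<bar> = b \<Longrightarrow> \<bar>Im z\<bar> \<le> \<theta> \<Longrightarrow> norm (f z) \<le> M * kap \<alpha> b"
  shows "integral UNIV (\<lambda>s. f (Complex s (-\<theta>))) - integral UNIV (\<lambda>s. f (Complex s \<theta>)) = c"
proof -
  define L where "L b = integral {-b..b} (\<lambda>s. f (Complex s (-\<theta>)))" for b
  define U where "U b = integral {-b..b} (\<lambda>s. f (Complex s \<theta>))" for b
  \<comment> \<open>Two vertical sides of length \<open>2 * \<theta>\<close> each give the factor
    4.\<close>
  have bound: "norm (L b - U b - c) \<le> 4 * \<theta> * M * kap \<alpha> b" if b: "b \<ge> b0" "b > 0" for b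
  proof -
    let ?a1 = "Complex (-b) (-\<theta>)" and ?a2 = "Complex b (-\<theta>)" and ?a3 = "Complex b \<theta>" and ?a4 = "Complex (-b) \<theta>"
    have r: "(f has_contour_integral c) (linepath ?a1 ?a2 +++ linepath ?a2 ?a3 +++ linepath ?a3 ?a4 +++ linepath ?a4 ?a1)"
      using rect[OF b(1)] by (simp add: rectpath_def Let_def)
    then have "f contour_integrable_on (linepath ?a1 ?a2 +++ linepath ?a2 ?a3 +++ linepath ?a3 ?a4 +++ linepath ?a4 ?a1)"
      by (auto simp: contour_integrable_on_def)
    then have i: "f contour_integrable_on linepath ?a1 ?a2" "f contour_integrable_on linepath ?a2 ?a3"
      "f contour_integrable_on linepath ?a3 ?a4" "f contour_integrable_on linepath ?a4 ?a1"
      by (auto simp: contour_integrable_join)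
    have "c = contour_integral (linepath ?a1 ?a2) f + contour_integral (linepath ?a2 ?a3) f
       + contour_integral (linepath ?a3 ?a4) f + contour_integral (linepath ?a4 ?a1) f"
      using contour_integral_unique[OF r] i by (simp add: contour_integral_join contour_integrable_join add.assoc)
    moreover have "contour_integral (linepath ?a1 ?a2) f = L b"
      unfolding L_def using b integrable_on_subcbox[OF low, of "-b" b]
      by (intro contour_integral_unique has_contour_integral_linepath_same_Im) auto
    moreover have "contour_integral (linepath ?a3 ?a4) f = - U b"
    proof -
      have "contour_integral (linepath ?a4 ?a3) f = U b"
        unfolding U_def using b integrable_on_subcbox[OF up, of "-b" b]
        by (intro contour_integral_unique has_contour_integral_linepath_same_Im) auto
      then show ?thesis
        using contour_integral_reversepath[of "linepath ?a4 ?a3" f] by simp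
    qed
    ultimately have eq: "L b - U b - c = - (contour_integral (linepath ?a2 ?a3) f + contour_integral (linepath ?a4 ?a1) f)"
      by (simp add: algebra_simps)
    have M: "0 \<le> M * kap \<alpha> b"
    proof -
      have "norm (f (Complex b 0)) \<le> M * kap \<alpha> b"
        using b \<theta> by (intro side) auto
      then show ?thesis using norm_ge_zero order_trans by blast
    qed
    have s1: "norm (contour_integral (linepath ?a2 ?a3) f) \<le> M * kap \<alpha> b * norm (?a3 - ?a2)"
      by (rule contour_integral_bound_linepath[OF i(2) M])
         (use b \<theta> in \<open>auto simp: closed_segment_same_Re closed_segment_eq_real_ivl intro!: side\<close>)
    have s2: "norm (contour_integral (linepath ?a4 ?a1) f) \<le> M * kap \<alpha> b * norm (?a1 - ?a4)"
      by (rule contour_integral_bound_linepath[OF i(4) M])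
         (use b \<theta> in \<open>auto simp: closed_segment_same_Re closed_segment_eq_real_ivl intro!: side\<close>)
    have n: "norm (?a3 - ?a2) = 2 * \<theta>" "norm (?a1 - ?a4) = 2 * \<theta>"
      using \<theta> cmod_eq_Im[of "?a3 - ?a2"] cmod_eq_Im[of "?a1 - ?a4"] by auto
    have "norm (L b - U b - c) \<le> norm (contour_integral (linepath ?a2 ?a3) f) + norm (contour_integral (linepath ?a4 ?a1) f)"
      unfolding eq norm_minus_cancel by (rule norm_triangle_ineq)
    also have "\<dots> \<le> 4 * \<theta> * M * kap \<alpha> b"
      using s1 s2 unfolding n by (simp add: algebra_simps)
    finally show ?thesis .
  qed
  have "((\<lambda>b. L b - U b - c) \<longlongrightarrow> 0) at_top"
  proof (rule Lim_null_comparison)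
    show "\<forall>\<^sub>F b in at_top. norm (L b - U b - c) \<le> 4 * \<theta> * M * kap \<alpha> b"
      using eventually_ge_at_top[of b0] eventually_gt_at_top[of 0] by eventually_elim (rule bound)
    show "((\<lambda>b. 4 * \<theta> * M * kap \<alpha> b) \<longlongrightarrow> 0) at_top"
      by (intro tendsto_mult_right_zero kap_at_top \<alpha>)
  qed
  moreover have "((\<lambda>b. L b - U b - c) \<longlongrightarrow> integral UNIV (\<lambda>s. f (Complex s (-\<theta>))) - integral UNIV (\<lambda>s. f (Complex s \<theta>)) - c) at_top"
    unfolding L_def U_def by (intro tendsto_intros integral_UNIV_limit low up)
  ultimately have "integral UNIV (\<lambda>s. f (Complex s (-\<theta>))) - integral UNIV (\<lambda>s. f (Complex s \<theta>)) - c = 0"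
    using tendsto_unique[OF trivial_limit_at_top_linorder] by blast
  then show ?thesis by simp
qed

lemma path_image_rectpath_strip:
  assumes "b > 0" "\<theta> > 0"
  shows "path_image (rectpath (Complex (-b) (-\<theta>)) (Complex b \<theta>)) \<subseteq> {z. \<bar>Im z\<bar> \<le> \<theta> \<and> \<bar>Re z\<bar> \<le> b \<and> (\<bar>Re z\<bar> = b \<or> \<bar>Im z\<bar> = \<theta>)}"
  using assms by (auto simp: path_image_rectpath_cbox_minus_box in_cbox_complex_iff in_box_complex_iff)

lemma convex_strip: "convex {z. \<bar>Im z\<bar> < m}"
proof -
  have "{z. \<bar>Im z\<bar> < m} = {z. Im z < m} \<inter> {z. Im z > - m}" by auto
  then show ?thesis by (simp add: convex_halfspace_Im_lt convex_halfspace_Im_gt convex_Int)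
qed

lemma open_strip: "open {z. \<bar>Im z\<bar> < m}"
proof -
  have "{z. \<bar>Im z\<bar> < m} = {z. Im z < m} \<inter> {z. Im z > - m}" by auto
  then show ?thesis by (simp add: open_halfspace_Im_lt open_halfspace_Im_gt open_Int)
qed

lemma kker_line_integrable:
  assumes hol: "G holomorphic_on {z. \<bar>Im z\<bar> < m}" and \<alpha>: "\<alpha> > 0"
    and bd: "\<And>z. \<bar>Im z\<bar> \<le> \<theta> \<Longrightarrow> norm (G z) \<le> M * kap \<alpha> (Re z)"
    and y: "\<bar>y\<bar> \<le> \<theta>" "\<theta> < m" and \<eta>: "0 < \<bar>Im \<eta> - y\<bar>" "\<bar>Im \<eta> - y\<bar> < 2 * pi"
  shows "continuous_on UNIV (\<lambda>s. G (Complex s y) * kker (\<eta> - Complex s y))"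
    "(\<lambda>s. G (Complex s y) * kker (\<eta> - Complex s y)) integrable_on UNIV"
proof -
  have cC: "continuous_on UNIV (\<lambda>s. Complex s y)"
    by (intro continuous_intros)
  have cG: "continuous_on UNIV (\<lambda>s. G (Complex s y))"
    by (rule continuous_on_compose2[OF holomorphic_on_imp_continuous_on[OF hol] cC]) (use y in auto)
  show c: "continuous_on UNIV (\<lambda>s. G (Complex s y) * kker (\<eta> - Complex s y))"
    by (intro continuous_on_mult cG continuous_on_kker continuous_on_diff continuous_on_const cC exp_neq_1) (use \<eta> in auto)
  \<comment> \<open>The distance of |Im \<open>\<eta>\<close> - y| from the nearest pole heights 0
    and 2 pi.\<close>
  define d where "d = min \<bar>Im \<eta> - y\<bar> (2 * pi - \<bar>Im \<eta> - y\<bar>)"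
  have "norm (G (Complex s y) * kker (\<eta> - Complex s y)) \<le> M * sqrt (2 / (1 - cos d)) * kap \<alpha> s" for s
  proof -
    have "norm (kker (\<eta> - Complex s y)) \<le> sqrt (2 / (1 - cos d))"
      by (rule norm_kker_le) (use \<eta> in \<open>auto simp: d_def\<close>)
    moreover have "norm (G (Complex s y)) \<le> M * kap \<alpha> s"
      using bd[of "Complex s y"] y by simp
    ultimately have "norm (G (Complex s y)) * norm (kker (\<eta> - Complex s y)) \<le> M * kap \<alpha> s * sqrt (2 / (1 - cos d))"
      by (intro mult_mono) (auto intro: order_trans[OF norm_ge_zero])
    then show ?thesis by (simp add: norm_mult mult_ac)
  qed
  then show "(\<lambda>s. G (Complex s y) * kker (\<eta> - Complex s y)) integrable_on UNIV"
    by (rule integrable_kap_dominated[OF c _ \<alpha>])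
qed

lemma kker_side_bound:
  assumes bd: "\<And>z. \<bar>Im z\<bar> \<le> \<theta> \<Longrightarrow> norm (G z) \<le> M * kap \<alpha> (Re z)"
    and b: "b \<ge> \<bar>Re \<eta>\<bar> + 1" "\<bar>Re z\<bar> = b" "\<bar>Im z\<bar> \<le> \<theta>"
  shows "norm (G z * kker (\<eta> - z)) \<le> 2 * M * kap \<alpha> b"
proof -
  have "norm (kker (\<eta> - z)) \<le> 2" by (rule norm_kker_le_2) (use b in auto)
  moreover have "norm (G z) \<le> M * kap \<alpha> b"
    using bd[OF b(3)] b(2) kap_minus[of \<alpha> "Re z"] by (auto simp: abs_if split: if_splits)
  ultimately have "norm (G z) * norm (kker (\<eta> - z)) \<le> M * kap \<alpha> b * 2"
    by (intro mult_mono) (auto intro: order_trans[OF norm_ge_zero])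
  then show ?thesis by (simp add: norm_mult)
qed

text \<open>In the logarithmic coordinate the kernel has poles at \<open>\<eta>\<close> and all its
  translates by multiples of 2 pi i. The two conditions on \<open>\<eta>\<close> keep every one of
  them out of the closed strip.\<close>

lemma Cauchy_strip_outside:
  assumes hol: "G holomorphic_on {z. \<bar>Im z\<bar> < m}" and \<alpha>: "\<alpha> > 0" and \<theta>: "0 < \<theta>" "\<theta> < m"
    and bd: "\<And>z. \<bar>Im z\<bar> \<le> \<theta> \<Longrightarrow> norm (G z) \<le> M * kap \<alpha> (Re z)"
    and \<eta>: "\<theta> < \<bar>Im \<eta>\<bar>" "\<bar>Im \<eta>\<bar> + \<theta> < 2 * pi"
  shows "integral UNIV (\<lambda>s. G (Complex s (-\<theta>)) * kker (\<eta> - Complex s (-\<theta>)))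
       - integral UNIV (\<lambda>s. G (Complex s \<theta>) * kker (\<eta> - Complex s \<theta>)) = 0"
proof (rule strip_boundary_integral[OF \<theta>(1) \<alpha>, where ?b0.0 = "\<bar>Re \<eta>\<bar> + 1" and M = "2 * M"])
  show "(\<lambda>s. G (Complex s (-\<theta>)) * kker (\<eta> - Complex s (-\<theta>))) integrable_on UNIV"
    "(\<lambda>s. G (Complex s \<theta>) * kker (\<eta> - Complex s \<theta>)) integrable_on UNIV"
    using \<theta> \<eta> by (auto intro!: kker_line_integrable(2)[OF hol \<alpha> bd])
  fix b :: real assume b: "b \<ge> \<bar>Re \<eta>\<bar> + 1"
  \<comment> \<open>Room by which the closed strip can be widened to an open convex one, still
    inside the domain of \<open>G\<close> and still free of poles.\<close>
  define e where "e = min (m - \<theta>) (min (\<bar>Im \<eta>\<bar> - \<theta>) (2 * pi - \<bar>Im \<eta>\<bar> - \<theta>))"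
  have e: "e > 0" "\<theta> + e \<le> m" "\<theta> + e \<le> \<bar>Im \<eta>\<bar>" "\<bar>Im \<eta>\<bar> + (\<theta> + e) \<le> 2 * pi"
    using \<theta> \<eta> by (auto simp: e_def)
  show "((\<lambda>z. G z * kker (\<eta> - z)) has_contour_integral 0) (rectpath (Complex (-b) (-\<theta>)) (Complex b \<theta>))"
  proof (rule Cauchy_theorem_convex_simple[OF _ convex_strip[of "\<theta> + e"]])
    have "exp (\<eta> - z) \<noteq> 1" if "\<bar>Im z\<bar> < \<theta> + e" for z
      by (rule exp_neq_1) (use that e \<eta> in auto)
    then show "(\<lambda>z. G z * kker (\<eta> - z)) holomorphic_on {z. \<bar>Im z\<bar> < \<theta> + e}"
      unfolding kker_def using e
      by (intro holomorphic_intros holomorphic_on_subset[OF hol]) fastforce+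
    show "path_image (rectpath (Complex (-b) (-\<theta>)) (Complex b \<theta>)) \<subseteq> {z. \<bar>Im z\<bar> < \<theta> + e}"
      using path_image_rectpath_strip[of b \<theta>] b \<theta> e by fastforce
  qed auto
qed (rule kker_side_bound[OF bd])

text \<open>The kernel is not literally a Cauchy kernel, so its simple pole is first rewritten as
  \<open>1 / (z - \<eta>)\<close> times a zero-free holomorphic factor.\<close>

lemma Cauchy_strip_inside:
  assumes hol: "G holomorphic_on {z. \<bar>Im z\<bar> < m}" and m: "m \<le> pi" and \<alpha>: "\<alpha> > 0" and \<theta>: "0 < \<theta>" "\<theta> < m"
    and bd: "\<And>z. \<bar>Im z\<bar> \<le> \<theta> \<Longrightarrow> norm (G z) \<le> M * kap \<alpha> (Re z)"
    and \<eta>: "\<bar>Im \<eta>\<bar> < \<theta>"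
  shows "integral UNIV (\<lambda>s. G (Complex s (-\<theta>)) * kker (\<eta> - Complex s (-\<theta>)))
       - integral UNIV (\<lambda>s. G (Complex s \<theta>) * kker (\<eta> - Complex s \<theta>)) = 2 * pi * \<i> * G \<eta>"
proof (rule strip_boundary_integral[OF \<theta>(1) \<alpha>, where ?b0.0 = "\<bar>Re \<eta>\<bar> + 1" and M = "2 * M"])
  show "(\<lambda>s. G (Complex s (-\<theta>)) * kker (\<eta> - Complex s (-\<theta>))) integrable_on UNIV"
    "(\<lambda>s. G (Complex s \<theta>) * kker (\<eta> - Complex s \<theta>)) integrable_on UNIV"
    using \<theta> \<eta> m by (auto intro!: kker_line_integrable(2)[OF hol \<alpha> bd])
  fix b :: real assume b: "b \<ge> \<bar>Re \<eta>\<bar> + 1"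
  \<comment> \<open>The quotient with its removable singularity filled in. Then
    \<open>G w * kker (\<eta> - w)\<close> equals
    \<open>(G w / q (w - \<eta>)) / (w - \<eta>)\<close>, to which Cauchy's integral formula
    applies.\<close>
  define q where "q \<xi> = (if \<xi> = 0 then 1 else (1 - exp (-\<xi>)) / \<xi>)" for \<xi> :: complex
  have "(\<lambda>z. if z = 0 then deriv (\<lambda>\<xi>. - exp (-\<xi>)) 0 else (- exp (-z) - (- exp (-0))) / (z - 0)) holomorphic_on (UNIV :: complex set)"
    by (rule pole_lemma) (auto intro!: holomorphic_intros)
  moreover have "deriv (\<lambda>\<xi>. - exp (-\<xi>)) 0 = (1::complex)"
    by (rule DERIV_imp_deriv) (auto intro!: derivative_eq_intros)
  ultimately have q: "q holomorphic_on UNIV"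
    by (elim holomorphic_transform) (auto simp: q_def)
  \<comment> \<open>\<open>q\<close> vanishes only at nonzero multiples of 2 pi i. They are out of
    reach because two points of the strip differ in height by less than 2 pi, as \<open>m\<close> is
    at most pi.\<close>
  have q0: "q (z - \<eta>) \<noteq> 0" if "\<bar>Im z\<bar> < m" for z
  proof (cases "z = \<eta>")
    case False
    have "exp (- (z - \<eta>)) \<noteq> 1"
    proof
      assume "exp (- (z - \<eta>)) = 1"
      then have "Re (- (z - \<eta>)) = 0" and "\<not> (0 < \<bar>Im (- (z - \<eta>))\<bar> \<and> \<bar>Im (- (z - \<eta>))\<bar> < 2 * pi)"
        using exp_neq_1[of "- (z - \<eta>)"] unfolding exp_eq_1 by auto
      moreover have "\<bar>Im (- (z - \<eta>))\<bar> < 2 * pi" using that m \<eta> \<theta> by auto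
      ultimately have "z = \<eta>" by (auto simp: complex_eq_iff)
      then show False using False by simp
    qed
    then show ?thesis using False by (auto simp: q_def)
  qed (simp add: q_def)
  have h: "(\<lambda>z. G z / q (z - \<eta>)) holomorphic_on {z. \<bar>Im z\<bar> < m}"
    using q0 by (intro holomorphic_intros hol holomorphic_on_compose_gen[OF _ q, unfolded o_def]) auto
  let ?R = "rectpath (Complex (-b) (-\<theta>)) (Complex b \<theta>)"
  have sub: "path_image ?R \<subseteq> {z. \<bar>Im z\<bar> < m} - {\<eta>}"
    using path_image_rectpath_strip[of b \<theta>] b \<theta> \<eta> by fastforce
  have "((\<lambda>w. (G w / q (w - \<eta>)) / (w - \<eta>)) has_contour_integral (2 * pi * \<i> * winding_number ?R \<eta> * (G \<eta> / q (\<eta> - \<eta>)))) ?R"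
    by (rule Cauchy_integral_formula_convex_simple[OF convex_strip h _ _ sub])
       (use \<eta> \<theta> in \<open>auto simp: interior_open[OF open_strip]\<close>)
  moreover have "winding_number ?R \<eta> = 1"
    using b \<eta> by (intro winding_number_rectpath) (auto simp: in_box_complex_iff)
  ultimately have "((\<lambda>w. (G w / q (w - \<eta>)) / (w - \<eta>)) has_contour_integral (2 * pi * \<i> * G \<eta>)) ?R"
    by (simp add: q_def)
  then show "((\<lambda>z. G z * kker (\<eta> - z)) has_contour_integral (2 * pi * \<i> * G \<eta>)) ?R"
  proof (rule has_contour_integral_eq)
    fix w assume "w \<in> path_image ?R"
    then have "w \<noteq> \<eta>" using sub by auto
    then show "G w / q (w - \<eta>) / (w - \<eta>) = G w * kker (\<eta> - w)"
      by (simp add: q_def kker_def)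
  qed
qed (rule kker_side_bound[OF bd])

section \<open>Functional calculus for a resolvent on a strip\<close>

text \<open>Multiplication by complex scalars on the complexification of a real vector space, whose
elements \<open>x + i y\<close> are represented as pairs.\<close>

definition csc :: "complex \<Rightarrow> 'a::real_vector \<times> 'a \<Rightarrow> 'a \<times> 'a" where
  "csc c p = (Re c *\<^sub>R fst p - Im c *\<^sub>R snd p, Re c *\<^sub>R snd p + Im c *\<^sub>R fst p)"

lemma csc_csc: "csc a (csc b p) = csc (a * b) p"
  by (simp add: csc_def scaleR_diff_right scaleR_add_right scaleR_diff_left scaleR_add_left)

lemma csc_1 [simp]: "csc 1 p = p"
  by (simp add: csc_def)

text \<open>The product norm of a complexified Banach space need not be complex homogeneous.
  Cauchy-Schwarz bounds each component by |c| |p|, and adding the two components gives the factor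
  2.\<close>

lemma norm_csc_le: "norm (csc c p) \<le> 2 * norm c * norm (p :: 'a::real_normed_vector \<times> 'a)"
proof -
  have a: "norm (fst p) \<le> norm p" "norm (snd p) \<le> norm p"
    using norm_fst_le[of "fst p" "snd p"] norm_snd_le[of "snd p" "fst p"] by simp_all
  have cs: "\<bar>Re c\<bar> * u + \<bar>Im c\<bar> * v \<le> norm c * norm p" if "u\<^sup>2 + v\<^sup>2 = (norm p)\<^sup>2" for u v :: real
  proof -
    define a b where "a = \<bar>Re c\<bar>" and "b = \<bar>Im c\<bar>"
    have c2: "(norm c)\<^sup>2 = a\<^sup>2 + b\<^sup>2" by (simp add: cmod_power2 a_def b_def)
    \<comment> \<open>Lagrange's identity, here as a proof of Cauchy-Schwarz.\<close>
    have "(a * u + b * v)\<^sup>2 + (a * v - b * u)\<^sup>2 = (a\<^sup>2 + b\<^sup>2) * (u\<^sup>2 + v\<^sup>2)"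
      by (simp add: power2_eq_square algebra_simps)
    also have "\<dots> = (norm c * norm p)\<^sup>2"
      by (simp add: c2 that power_mult_distrib)
    finally have "(a * u + b * v)\<^sup>2 \<le> (norm c * norm p)\<^sup>2"
      using zero_le_power2[of "a * v - b * u"] by linarith
    then show ?thesis unfolding a_def b_def by (rule power2_le_imp_le) simp
  qed
  have np: "(norm (fst p))\<^sup>2 + (norm (snd p))\<^sup>2 = (norm p)\<^sup>2"
    by (simp add: norm_prod_def)
  have "norm (csc c p) \<le> norm (Re c *\<^sub>R fst p - Im c *\<^sub>R snd p) + norm (Re c *\<^sub>R snd p + Im c *\<^sub>R fst p)"
    unfolding csc_def by (rule norm_Pair_le)
  also have "\<dots> \<le> (\<bar>Re c\<bar> * norm (fst p) + \<bar>Im c\<bar> * norm (snd p)) + (\<bar>Re c\<bar> * norm (snd p) + \<bar>Im c\<bar> * norm (fst p))"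
    by (intro add_mono order_trans[OF norm_triangle_ineq4] order_trans[OF norm_triangle_ineq]) auto
  also have "\<dots> \<le> norm c * norm p + norm c * norm p"
    using np by (intro add_mono cs) (auto simp: add.commute)
  finally show ?thesis by simp
qed

interpretation csc: bounded_bilinear csc
proof
  show "\<exists>K. \<forall>a b. norm (csc a b) \<le> norm a * norm b * K"
    using norm_csc_le by (intro exI[of _ 2]) (auto simp: mult_ac)
qed (auto simp: csc_def algebra_simps)

text \<open>A product rule that asks only continuity of the second factor, since the first is O(|z -
  x|). It upgrades continuity of a resolvent to differentiability by way of the resolvent
  identity.\<close>

lemma (in bounded_bilinear) has_derivative_vanishing_factor:
  assumes f: "(f has_derivative f') (at x within S)" and f0: "f x = 0"
    and g: "continuous (at x within S) g"
  shows "((\<lambda>z. prod (f z) (g z)) has_derivative (\<lambda>h. prod (f' h) (g x))) (at x within S)"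
proof -
  have 1: "((\<lambda>z. prod (f z) (g x)) has_derivative (\<lambda>h. prod (f' h) (g x))) (at x within S)"
    by (rule bounded_linear.has_derivative[OF bounded_linear_left f])
  obtain K where K: "K > 0" "\<And>a b. norm (prod a b) \<le> norm a * norm b * K"
    using pos_bounded by auto
  have bl: "bounded_linear f'" using f by (rule has_derivative_bounded_linear)
  obtain B where B: "\<And>h. norm (f' h) \<le> norm h * B"
    using bounded_linear.bounded[OF bl] by auto
  define q where "q z = norm (f z - f' (z - x)) / norm (z - x)" for z
  have q: "(q \<longlongrightarrow> 0) (at x within S)"
    using f f0 unfolding has_derivative_iff_norm q_def by simp
  have gx: "((\<lambda>z. norm (g z - g x)) \<longlongrightarrow> 0) (at x within S)"
    using g unfolding continuous_within by (simp add: LIM_zero tendsto_norm_zero)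
  have "((\<lambda>z. prod (f z) (g z - g x)) has_derivative (\<lambda>h. 0)) (at x within S)"
    unfolding has_derivative_iff_norm
  proof (intro conjI bounded_linear_zero)
    show "((\<lambda>y. norm (prod (f y) (g y - g x) - prod (f x) (g x - g x) - 0) / norm (y - x)) \<longlongrightarrow> 0) (at x within S)"
    proof (rule Lim_null_comparison)
      show "\<forall>\<^sub>F y in at x within S. norm (norm (prod (f y) (g y - g x) - prod (f x) (g x - g x) - 0) / norm (y - x))
          \<le> (q y + B) * norm (g y - g x) * K"
        unfolding eventually_at_topological
      proof (intro exI[of _ UNIV] conjI ballI impI)
        fix y assume "y \<noteq> x"
        then have p: "norm (y - x) > 0" by simp
        have "norm (f y) \<le> norm (f y - f' (y - x)) + norm (f' (y - x))"
          by (metis norm_triangle_sub add.commute)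
        also have "\<dots> \<le> (q y + B) * norm (y - x)"
          using B[of "y - x"] p by (simp add: q_def algebra_simps)
        finally have fy: "norm (f y) / norm (y - x) \<le> q y + B"
          using p by (simp add: divide_le_eq)
        have "norm (prod (f y) (g y - g x)) / norm (y - x) \<le> norm (f y) * norm (g y - g x) * K / norm (y - x)"
          by (intro divide_right_mono K) auto
        also have "\<dots> = norm (f y) / norm (y - x) * (norm (g y - g x) * K)" by simp
        also have "\<dots> \<le> (q y + B) * (norm (g y - g x) * K)"
          using fy K(1) by (intro mult_right_mono) auto
        finally show "norm (norm (prod (f y) (g y - g x) - prod (f x) (g x - g x) - 0) / norm (y - x))
          \<le> (q y + B) * norm (g y - g x) * K"
          by (simp add: zero_right mult.assoc)
      qed auto
      have "((\<lambda>y. (q y + B) * norm (g y - g x) * K) \<longlongrightarrow> (0 + B) * 0 * K) (at x within S)"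
        by (intro tendsto_intros q gx)
      then show "((\<lambda>y. (q y + B) * norm (g y - g x) * K) \<longlongrightarrow> 0) (at x within S)" by simp
    qed
  qed
  from has_derivative_add[OF 1 this] show ?thesis
    by (simp add: diff_right)
qed

text \<open>The scalar counterpart of the class Psi in logarithmic coordinates, with the constants
  exposed because the double integrals use them.\<close>

definition strip_bounded :: "real \<Rightarrow> real \<Rightarrow> real \<Rightarrow> (complex \<Rightarrow> complex) \<Rightarrow> bool" where
  "strip_bounded m M \<alpha> G \<longleftrightarrow> G holomorphic_on {z. \<bar>Im z\<bar> < m} \<and> \<alpha> > 0 \<and> M \<ge> 0 \<and>
     (\<forall>z. \<bar>Im z\<bar> < m \<longrightarrow> norm (G z) \<le> M * kap \<alpha> (Re z))"

text \<open>In logarithmic coordinates \<open>z = exp \<zeta>\<close>, \<open>K \<zeta>\<close> stands for \<open>z (z - T)\<^sup>-\<^sup>1\<close>; \<open>K_resolvent\<close> is the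
resolvent identity and \<open>K_bound\<close> sectoriality.\<close>

locale strip_resolvent =
  fixes K :: "complex \<Rightarrow> 'a::banach \<times> 'a \<Rightarrow> 'a \<times> 'a" and w m C :: real
  assumes w: "0 \<le> w" "w < m" and m: "m \<le> pi"
    and K_add: "\<And>\<zeta> x y. w < \<bar>Im \<zeta>\<bar> \<Longrightarrow> \<bar>Im \<zeta>\<bar> < m \<Longrightarrow> K \<zeta> (x + y) = K \<zeta> x + K \<zeta> y"
    and K_csc: "\<And>\<zeta> c x. w < \<bar>Im \<zeta>\<bar> \<Longrightarrow> \<bar>Im \<zeta>\<bar> < m \<Longrightarrow> K \<zeta> (csc c x) = csc c (K \<zeta> x)"
    and K_bound: "\<And>\<zeta> x. w < \<bar>Im \<zeta>\<bar> \<Longrightarrow> \<bar>Im \<zeta>\<bar> < m \<Longrightarrow> norm (K \<zeta> x) \<le> C * norm x"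
    and K_resolvent: "\<And>\<zeta> \<eta> x. w < \<bar>Im \<zeta>\<bar> \<Longrightarrow> \<bar>Im \<zeta>\<bar> < m \<Longrightarrow> w < \<bar>Im \<eta>\<bar> \<Longrightarrow> \<bar>Im \<eta>\<bar> < m \<Longrightarrow>
        K \<zeta> x = csc (exp (\<zeta> - \<eta>)) (K \<eta> x) + csc (1 - exp (\<zeta> - \<eta>)) (K \<zeta> (K \<eta> x))"
begin

definition reg :: "complex set" where
  "reg = {\<zeta>. w < \<bar>Im \<zeta>\<bar> \<and> \<bar>Im \<zeta>\<bar> < m}"

text \<open>The factor \<open>norm x\<close> covers the trivial space, where \<open>K_bound\<close>
  does not force \<open>C\<close> itself to be nonnegative.\<close>

lemma C_nonneg: "C * norm (x::'a \<times> 'a) \<ge> 0"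
proof -
  have "norm (K (Complex 0 ((w + m) / 2)) x) \<le> C * norm x"
    using w by (intro K_bound) auto
  then show ?thesis using norm_ge_zero order_trans by blast
qed

lemma bounded_linear_K:
  assumes "\<zeta> \<in> reg" shows "bounded_linear (K \<zeta>)"
proof (rule bounded_linear_intro[of _ C])
  have r: "r *\<^sub>R x = csc (of_real r) x" for r and x :: "'a \<times> 'a"
    by (simp add: csc_def prod_eq_iff)
  show "K \<zeta> (r *\<^sub>R x) = r *\<^sub>R K \<zeta> x" for r x
    unfolding r using assms by (intro K_csc) (auto simp: reg_def)
qed (use assms K_add K_bound in \<open>auto simp: reg_def mult.commute\<close>)

lemma Complex_in_reg: "w < \<bar>y\<bar> \<Longrightarrow> \<bar>y\<bar> < m \<Longrightarrow> Complex s y \<in> reg"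
  by (simp add: reg_def)

lemma open_reg: "open reg"
proof -
  have "reg = ({\<zeta>. w < Im \<zeta>} \<union> {\<zeta>. Im \<zeta> < - w}) \<inter> ({\<zeta>. Im \<zeta> < m} \<inter> {\<zeta>. - m < Im \<zeta>})"
    using w by (auto simp: reg_def)
  then show ?thesis
    by (simp add: open_Int open_Un open_halfspace_Im_lt open_halfspace_Im_gt)
qed

text \<open>In the resolvent identity the first term tends to \<open>K \<eta> x\<close>, and the
  second is a vanishing scalar times a vector bounded through \<open>K_bound\<close>.\<close>

lemma continuous_K_at:
  assumes \<eta>: "\<eta> \<in> reg"
  shows "continuous (at \<eta>) (\<lambda>\<zeta>. K \<zeta> x)"
proof -
  have ev: "\<forall>\<^sub>F \<zeta> in at \<eta>. \<zeta> \<in> reg"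
    using eventually_at_in_open'[OF open_reg \<eta>] .
  have "((\<lambda>\<zeta>. csc (1 - exp (\<zeta> - \<eta>)) (K \<zeta> (K \<eta> x))) \<longlongrightarrow> 0) (at \<eta>)"
  proof (rule Lim_null_comparison)
    show "\<forall>\<^sub>F \<zeta> in at \<eta>. norm (csc (1 - exp (\<zeta> - \<eta>)) (K \<zeta> (K \<eta> x))) \<le> 2 * norm (1 - exp (\<zeta> - \<eta>)) * (C * norm (K \<eta> x))"
      using ev
    proof eventually_elim
      case (elim \<zeta>)
      then show ?case
        using K_bound[of \<zeta> "K \<eta> x"]
        by (intro order_trans[OF norm_csc_le] mult_left_mono) (auto simp: reg_def)
    qed
    have "((\<lambda>\<zeta>. 2 * norm (1 - exp (\<zeta> - \<eta>)) * (C * norm (K \<eta> x))) \<longlongrightarrow> 2 * norm (1 - exp (\<eta> - \<eta>)) * (C * norm (K \<eta> x))) (at \<eta>)"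
      by (intro tendsto_intros)
    then show "((\<lambda>\<zeta>. 2 * norm (1 - exp (\<zeta> - \<eta>)) * (C * norm (K \<eta> x))) \<longlongrightarrow> 0) (at \<eta>)"
      by simp
  qed
  moreover have "((\<lambda>\<zeta>. csc (exp (\<zeta> - \<eta>)) (K \<eta> x)) \<longlongrightarrow> csc (exp (\<eta> - \<eta>)) (K \<eta> x)) (at \<eta>)"
    by (intro csc.tendsto tendsto_intros)
  ultimately have "((\<lambda>\<zeta>. csc (exp (\<zeta> - \<eta>)) (K \<eta> x) + csc (1 - exp (\<zeta> - \<eta>)) (K \<zeta> (K \<eta> x))) \<longlongrightarrow> csc (exp (\<eta> - \<eta>)) (K \<eta> x) + 0) (at \<eta>)"
    by (rule tendsto_add[rotated])
  then have "((\<lambda>\<zeta>. csc (exp (\<zeta> - \<eta>)) (K \<eta> x) + csc (1 - exp (\<zeta> - \<eta>)) (K \<zeta> (K \<eta> x))) \<longlongrightarrow> K \<eta> x) (at \<eta>)"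
    by simp
  then have "((\<lambda>\<zeta>. K \<zeta> x) \<longlongrightarrow> K \<eta> x) (at \<eta>)"
  proof (rule Lim_transform_eventually)
    show "\<forall>\<^sub>F \<zeta> in at \<eta>. csc (exp (\<zeta> - \<eta>)) (K \<eta> x) + csc (1 - exp (\<zeta> - \<eta>)) (K \<zeta> (K \<eta> x)) = K \<zeta> x"
      using ev
    proof eventually_elim
      case (elim \<zeta>)
      then show ?case using K_resolvent[of \<zeta> \<eta> x] \<eta> by (auto simp: reg_def)
    qed
  qed
  then show ?thesis by (simp add: isCont_def)
qed

text \<open>Strong continuity and the uniform operator bound together give joint continuity.\<close>

lemma continuous_on_K:
  assumes f: "continuous_on S f" "f ` S \<subseteq> reg" and u: "continuous_on S u"
  shows "continuous_on S (\<lambda>s. K (f s) (u s))"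
  unfolding continuous_on_def
proof
  fix s assume s: "s \<in> S"
  have fs: "f s \<in> reg" using s f by auto
  have 1: "((\<lambda>t. K (f t) (u s)) \<longlongrightarrow> K (f s) (u s)) (at s within S)"
    using continuous_K_at[OF fs] f(1) s
    by (intro isCont_tendsto_compose[of "f s" "\<lambda>\<zeta>. K \<zeta> (u s)"]) (auto simp: continuous_on_def)
  have 2: "((\<lambda>t. K (f t) (u t - u s)) \<longlongrightarrow> 0) (at s within S)"
  proof (rule Lim_null_comparison)
    show "\<forall>\<^sub>F t in at s within S. norm (K (f t) (u t - u s)) \<le> C * norm (u t - u s)"
      unfolding eventually_at_topological using f(2)
      by (intro exI[of _ UNIV]) (auto intro!: K_bound simp: reg_def)
    have "((\<lambda>t. C * norm (u t - u s)) \<longlongrightarrow> C * norm (u s - u s)) (at s within S)"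
      using u s by (intro tendsto_intros) (auto simp: continuous_on_def)
    then show "((\<lambda>t. C * norm (u t - u s)) \<longlongrightarrow> 0) (at s within S)" by simp
  qed
  have "\<forall>\<^sub>F t in at s within S. K (f t) (u s) + K (f t) (u t - u s) = K (f t) (u t)"
    unfolding eventually_at_topological
  proof (intro exI[of _ UNIV] conjI ballI impI)
    fix t assume "t \<in> S"
    then have "f t \<in> reg" using f by auto
    then show "K (f t) (u s) + K (f t) (u t - u s) = K (f t) (u t)"
      using K_add[of "f t" "u s" "u t - u s"] by (simp add: reg_def)
  qed auto
  with tendsto_add[OF 1 2] show "((\<lambda>s. K (f s) (u s)) \<longlongrightarrow> K (f s) (u s)) (at s within S)"
    by (simp add: Lim_transform_eventually)
qed

text \<open>With K = z R and R the resolvent, d/d\<open>\<zeta>\<close> is z d/dz, and z (R - z R^2)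
  = K - K^2.\<close>

lemma has_derivative_K:
  assumes \<eta>: "\<eta> \<in> reg"
  shows "((\<lambda>\<zeta>. K \<zeta> x) has_derivative (\<lambda>h. csc h (K \<eta> x - K \<eta> (K \<eta> x)))) (at \<eta>)"
proof -
  have e: "((\<lambda>\<zeta>. exp (\<zeta> - \<eta>)) has_derivative (\<lambda>h. h)) (at \<eta>)"
    by (auto intro!: derivative_eq_intros)
  have e': "((\<lambda>\<zeta>. 1 - exp (\<zeta> - \<eta>)) has_derivative (\<lambda>h. - h)) (at \<eta>)"
    by (auto intro!: derivative_eq_intros)
  have 1: "((\<lambda>\<zeta>. csc (exp (\<zeta> - \<eta>)) (K \<eta> x)) has_derivative (\<lambda>h. csc h (K \<eta> x))) (at \<eta>)"
    by (rule bounded_linear.has_derivative[OF csc.bounded_linear_left e])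
  have 2: "((\<lambda>\<zeta>. csc (1 - exp (\<zeta> - \<eta>)) (K \<zeta> (K \<eta> x))) has_derivative (\<lambda>h. csc (- h) (K \<eta> (K \<eta> x)))) (at \<eta>)"
    by (rule csc.has_derivative_vanishing_factor[OF e' _ continuous_K_at[OF \<eta>]]) simp
  have "((\<lambda>\<zeta>. csc (exp (\<zeta> - \<eta>)) (K \<eta> x) + csc (1 - exp (\<zeta> - \<eta>)) (K \<zeta> (K \<eta> x))) has_derivative
      (\<lambda>h. csc h (K \<eta> x - K \<eta> (K \<eta> x)))) (at \<eta>)"
    using has_derivative_add[OF 1 2] by (simp add: csc.diff_right csc.minus_left)
  then show ?thesis
    by (rule has_derivative_transform_within_open[OF _ open_reg \<eta>])
       (use \<eta> in \<open>auto simp: reg_def intro!: K_resolvent[symmetric]\<close>)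
qed

text \<open>The resolvent identity solved for the product. The coefficients are w / (w - z) and z /
  (z - w), so an operator product turns into scalar Cauchy kernels.\<close>

lemma K_K:
  assumes "\<zeta> \<in> reg" "\<eta> \<in> reg" "exp (\<zeta> - \<eta>) \<noteq> 1"
  shows "K \<zeta> (K \<eta> x) = csc (kker (\<zeta> - \<eta>)) (K \<zeta> x) + csc (kker (\<eta> - \<zeta>)) (K \<eta> x)"
proof -
  let ?e = "exp (\<zeta> - \<eta>)"
  have "csc (kker (\<zeta> - \<eta>)) (K \<zeta> x) = csc (kker (\<zeta> - \<eta>)) (csc ?e (K \<eta> x) + csc (1 - ?e) (K \<zeta> (K \<eta> x)))"
    using K_resolvent[of \<zeta> \<eta> x] assms by (simp add: reg_def)
  also have "\<dots> = csc (kker (\<zeta> - \<eta>) * ?e) (K \<eta> x) + csc (kker (\<zeta> - \<eta>) * (1 - ?e)) (K \<zeta> (K \<eta> x))"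
    by (simp add: csc.add_right csc_csc)
  also have one: "kker (\<zeta> - \<eta>) * (1 - ?e) = 1"
    using assms(3) by (simp add: kker_def)
  also have "kker (\<zeta> - \<eta>) * ?e = kker (\<zeta> - \<eta>) - 1"
    using one by (simp add: algebra_simps)
  also have "kker (\<zeta> - \<eta>) - 1 = - kker (\<eta> - \<zeta>)"
    using kker_add[OF assms(3)] by (simp add: algebra_simps)
  finally show ?thesis by (simp add: csc.minus_left)
qed

section \<open>Line integrals of the resolvent\<close>

text \<open>The integral of F(z) (z - T)^(-1) dz over the ray of argument \<open>y\<close>, run
  outwards: dz = z d\<open>\<zeta>\<close>, and \<open>K\<close> already contains the factor
  z.\<close>

definition line_integral :: "real \<Rightarrow> (complex \<Rightarrow> complex) \<Rightarrow> 'a \<times> 'a \<Rightarrow> 'a \<times> 'a" where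
  "line_integral y G x = integral UNIV (\<lambda>s. csc (G (Complex s y)) (K (Complex s y) x))"

text \<open>The path comes in along the upper ray and leaves along the lower one. The factor 1 / (2
  pi i) times lower minus upper is i / (2 pi) times upper minus lower.\<close>

definition calc :: "real \<Rightarrow> (complex \<Rightarrow> complex) \<Rightarrow> 'a \<times> 'a \<Rightarrow> 'a \<times> 'a" where
  "calc \<theta> G x = csc (\<i> / (2 * pi)) (line_integral \<theta> G x - line_integral (-\<theta>) G x)"

context
  fixes G :: "complex \<Rightarrow> complex" and M \<alpha> :: real
  assumes G: "strip_bounded m M \<alpha> G"
begin

lemma continuous_on_G:
  assumes "continuous_on S f" "\<And>x. x \<in> S \<Longrightarrow> \<bar>Im (f x)\<bar> < m"
  shows "continuous_on S (\<lambda>x. G (f x))"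
  using G assms unfolding strip_bounded_def
  by (intro continuous_on_compose2[OF holomorphic_on_imp_continuous_on, of G]) auto

lemma norm_G_le:
  assumes "\<bar>y\<bar> < m" shows "norm (G (Complex s y)) \<le> M * kap \<alpha> s"
proof -
  have "norm (G (Complex s y)) \<le> M * kap \<alpha> (Re (Complex s y))"
    using G assms unfolding strip_bounded_def by (metis complex.sel(2))
  then show ?thesis by simp
qed

lemma line_integrand:
  assumes y: "w < \<bar>y\<bar>" "\<bar>y\<bar> < m"
  shows "continuous_on UNIV (\<lambda>s. csc (G (Complex s y)) (K (Complex s y) x))"
    "norm (csc (G (Complex s y)) (K (Complex s y) x)) \<le> 2 * M * (C * norm x) * kap \<alpha> s"
    "(\<lambda>s. csc (G (Complex s y)) (K (Complex s y) x)) integrable_on UNIV"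
proof -
  have cC: "continuous_on UNIV (\<lambda>s. Complex s y)" by (intro continuous_intros)
  show c: "continuous_on UNIV (\<lambda>s. csc (G (Complex s y)) (K (Complex s y) x))"
    using y by (intro csc.continuous_on continuous_on_G continuous_on_K cC continuous_on_const) (auto simp: reg_def)
  show b: "norm (csc (G (Complex s y)) (K (Complex s y) x)) \<le> 2 * M * (C * norm x) * kap \<alpha> s" for s
  proof -
    have "2 * norm (G (Complex s y)) * norm (K (Complex s y) x) \<le> 2 * (M * kap \<alpha> s) * (C * norm x)"
      using norm_G_le[OF y(2), of s] y C_nonneg
      by (intro mult_mono K_bound) (auto intro: order_trans[OF norm_ge_zero])
    then show ?thesis using norm_csc_le[of "G (Complex s y)" "K (Complex s y) x"] by (simp add: mult_ac)
  qed
  show "(\<lambda>s. csc (G (Complex s y)) (K (Complex s y) x)) integrable_on UNIV"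
    using G by (intro integrable_kap_dominated(1)[OF c b]) (simp add: strip_bounded_def)
qed

lemma bounded_linear_line_integral:
  assumes y: "w < \<bar>y\<bar>" "\<bar>y\<bar> < m"
  shows "bounded_linear (line_integral y G)"
proof (rule bounded_linear_intro)
  note [simp] = Complex_in_reg[OF y]
  have bl: "bounded_linear (K (Complex s y))" for s by (rule bounded_linear_K) simp
  show "line_integral y G (x + x') = line_integral y G x + line_integral y G x'" for x x'
    unfolding line_integral_def
    by (simp add: linear_add[OF bounded_linear.linear[OF bl]] csc.add_right
        Henstock_Kurzweil_Integration.integral_add line_integrand(3)[OF y])
  show "line_integral y G (r *\<^sub>R x) = r *\<^sub>R line_integral y G x" for r x
    unfolding line_integral_def
    by (simp add: linear_scale[OF bounded_linear.linear[OF bl]] csc.scaleR_right)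
  show "norm (line_integral y G x) \<le> norm x * (2 * M * C * (pi / 2 / \<alpha>))" for x
    using integrable_kap_dominated(2)[OF line_integrand(1,2)[OF y], of x] G
    by (simp add: line_integral_def strip_bounded_def mult_ac)
qed

lemma bounded_linear_calc:
  assumes \<theta>: "w < \<theta>" "\<theta> < m"
  shows "bounded_linear (calc \<theta> G)"
  unfolding calc_def[abs_def]
  by (intro bounded_linear_compose[OF csc.bounded_linear_right] bounded_linear_sub bounded_linear_line_integral)
     (use \<theta> w in auto)

text \<open>The condition on all intermediate heights keeps the moving line within one of the two
  components of \<open>reg\<close>, where the integrand is holomorphic.\<close>

lemma line_integral_shift:
  assumes ab: "a \<le> b" and y: "\<And>y. y \<in> {a..b} \<Longrightarrow> w < \<bar>y\<bar> \<and> \<bar>y\<bar> < m"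
  shows "line_integral a G x = line_integral b G x"
proof -
  \<comment> \<open>The complex derivative of the integrand by the product rule and
    \<open>has_derivative_K\<close>. Horizontal and vertical derivatives are \<open>D\<close> and
    \<open>csc \<i>\<close> of \<open>D\<close>.\<close>
  define D where "D \<zeta> = csc (deriv G \<zeta>) (K \<zeta> x) + csc (G \<zeta>) (K \<zeta> x - K \<zeta> (K \<zeta> x))" for \<zeta>
  have hol: "G holomorphic_on {z. \<bar>Im z\<bar> < m}" using G by (simp add: strip_bounded_def)
  have der: "((\<lambda>\<zeta>. csc (G \<zeta>) (K \<zeta> x)) has_derivative (\<lambda>h. csc h (D \<zeta>))) (at \<zeta>)" if "\<zeta> \<in> reg" for \<zeta>
  proof -
    have "(G has_field_derivative deriv G \<zeta>) (at \<zeta>)"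
      using that by (intro holomorphic_derivI[OF hol open_strip]) (auto simp: reg_def)
    then have 1: "(G has_derivative (\<lambda>h. deriv G \<zeta> * h)) (at \<zeta>)"
      by (simp add: has_field_derivative_def)
    have "((\<lambda>\<zeta>. csc (G \<zeta>) (K \<zeta> x)) has_derivative
        (\<lambda>h. csc (G \<zeta>) (csc h (K \<zeta> x - K \<zeta> (K \<zeta> x))) + csc (deriv G \<zeta> * h) (K \<zeta> x))) (at \<zeta>)"
      by (rule csc.FDERIV[OF 1 has_derivative_K[OF that]])
    then show ?thesis
      by (simp add: D_def csc.add_right csc_csc mult.commute add.commute)
  qed
  have cD: "continuous_on reg D"
  proof -
    have "continuous_on reg (\<lambda>\<zeta>. deriv G \<zeta>)"
      by (intro continuous_on_subset[OF holomorphic_on_imp_continuous_on[OF holomorphic_deriv[OF hol open_strip]]])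
         (auto simp: reg_def)
    moreover have "continuous_on reg G"
      by (intro continuous_on_subset[OF holomorphic_on_imp_continuous_on[OF hol]]) (auto simp: reg_def)
    ultimately show ?thesis
      unfolding D_def
      by (intro continuous_on_add continuous_on_diff csc.continuous_on continuous_on_K continuous_on_id continuous_on_const) auto
  qed
  show ?thesis
    unfolding line_integral_def
  proof (rule integral_line_shift[OF ab, where J = "csc \<i>" and F' = "\<lambda>y s. D (Complex s y)"
        and M = "2 * M * (C * norm x)" and \<alpha> = \<alpha>])
    show "bounded_linear (csc \<i> :: 'a \<times> 'a \<Rightarrow> _)" by (rule csc.bounded_linear_right)
    show "\<alpha> > 0" using G by (simp add: strip_bounded_def)
    fix y' s assume "y' \<in> {a..b}"
    then have r: "w < \<bar>y'\<bar>" "\<bar>y'\<bar> < m" "Complex s y' \<in> reg" using y by (auto intro: Complex_in_reg)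
    show "norm (csc (G (Complex s y')) (K (Complex s y') x)) \<le> 2 * M * (C * norm x) * kap \<alpha> s"
      by (rule line_integrand(2)[OF r(1,2)])
    have c1: "((\<lambda>y. Complex s y) has_derivative (\<lambda>h. h *\<^sub>R \<i>)) (at y' within {a..b})"
      unfolding Complex_eq by (auto intro!: derivative_eq_intros simp: scaleR_conv_of_real)
    show "((\<lambda>y. csc (G (Complex s y)) (K (Complex s y) x)) has_vector_derivative csc \<i> (D (Complex s y'))) (at y' within {a..b})"
      using has_derivative_compose[OF c1 der[OF r(3)]]
      by (simp add: has_vector_derivative_def csc.scaleR_left)
    have c2: "((\<lambda>s. Complex s y') has_derivative (\<lambda>h. h *\<^sub>R 1)) (at s)"
      unfolding Complex_eq by (auto intro!: derivative_eq_intros simp: scaleR_conv_of_real)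
    show "((\<lambda>s. csc (G (Complex s y')) (K (Complex s y') x)) has_vector_derivative D (Complex s y')) (at s)"
      using has_derivative_compose[OF c2 der[OF r(3)]]
      by (simp add: has_vector_derivative_def csc.scaleR_left)
  next
    have "continuous_on ({a..b} \<times> UNIV) (\<lambda>p. D (Complex (snd p) (fst p)))"
      using y by (intro continuous_on_compose2[OF cD] continuous_intros) (auto intro: Complex_in_reg)
    then show "continuous_on ({a..b} \<times> UNIV) (\<lambda>(y, s). D (Complex s y))"
      by (simp add: case_prod_unfold)
  qed
qed

lemma calc_angle_independent:
  assumes "w < \<theta>" "\<theta> \<le> \<theta>'" "\<theta>' < m"
  shows "calc \<theta> G x = calc \<theta>' G x"
  using line_integral_shift[of \<theta> \<theta>' x] line_integral_shift[of "-\<theta>'" "-\<theta>" x] assms w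
  by (simp add: calc_def)

text \<open>Under the integral \<open>K_K\<close> splits the product in two. The part carrying
  \<open>K \<zeta> x\<close> has a scalar coefficient, a Cauchy integral with its point outside the
  strip, and cancels between the two lines. Only resolvents on the integration lines
  survive.\<close>

lemma K_calc:
  assumes \<theta>: "w < \<theta>" "\<theta> < \<bar>Im \<zeta>\<bar>" "\<bar>Im \<zeta>\<bar> < m"
  shows "K \<zeta> (calc \<theta> G x) = csc (\<i> / (2 * pi))
     (integral UNIV (\<lambda>t. csc (G (Complex t \<theta>) * kker (Complex t \<theta> - \<zeta>)) (K (Complex t \<theta>) x))
    - integral UNIV (\<lambda>t. csc (G (Complex t (-\<theta>)) * kker (Complex t (-\<theta>) - \<zeta>)) (K (Complex t (-\<theta>)) x)))"
proof -
  have \<zeta>: "\<zeta> \<in> reg" using \<theta> by (auto simp: reg_def)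
  have hol: "G holomorphic_on {z. \<bar>Im z\<bar> < m}" and \<alpha>: "\<alpha> > 0" and
    bd: "\<And>z. \<bar>Im z\<bar> \<le> \<theta> \<Longrightarrow> norm (G z) \<le> M * kap \<alpha> (Re z)"
    using G \<theta> by (auto simp: strip_bounded_def)
  have split: "K \<zeta> (line_integral y G x) =
      csc (integral UNIV (\<lambda>t. G (Complex t y) * kker (\<zeta> - Complex t y))) (K \<zeta> x)
      + integral UNIV (\<lambda>t. csc (G (Complex t y) * kker (Complex t y - \<zeta>)) (K (Complex t y) x))"
    if y: "\<bar>y\<bar> = \<theta>" for y
  proof -
    have r: "Complex t y \<in> reg" for t using y \<theta> by (auto simp: reg_def)
    have a: "0 < \<bar>Im \<zeta> - y\<bar>" "\<bar>Im \<zeta> - y\<bar> < 2 * pi" using y \<theta> m by auto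
    have i: "(\<lambda>t. csc (G (Complex t y)) (K (Complex t y) x)) integrable_on UNIV"
      using y \<theta> by (intro line_integrand) auto
    have 1: "K \<zeta> (line_integral y G x) = integral UNIV (\<lambda>t. K \<zeta> (csc (G (Complex t y)) (K (Complex t y) x)))"
      unfolding line_integral_def using integral_linear[OF i bounded_linear_K[OF \<zeta>]] by (simp add: o_def)
    have i1: "(\<lambda>t. G (Complex t y) * kker (\<zeta> - Complex t y)) integrable_on UNIV"
      using y \<theta> a by (intro kker_line_integrable(2)[where \<theta> = \<theta>, OF hol \<alpha> bd]) auto
    have eq: "K \<zeta> (csc (G (Complex t y)) (K (Complex t y) x)) = csc (G (Complex t y) * kker (\<zeta> - Complex t y)) (K \<zeta> x)
         + csc (G (Complex t y) * kker (Complex t y - \<zeta>)) (K (Complex t y) x)" for t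
    proof -
      have "exp (\<zeta> - Complex t y) \<noteq> 1" using a by (intro exp_neq_1) auto
      then show ?thesis
        using K_K[OF \<zeta> r[of t], of x] \<zeta> by (simp add: K_csc reg_def csc.add_right csc_csc)
    qed
    have i2: "(\<lambda>t. csc (G (Complex t y) * kker (\<zeta> - Complex t y)) (K \<zeta> x)) integrable_on UNIV"
      using integrable_linear[OF i1 csc.bounded_linear_left, of "K \<zeta> x"] by (simp add: o_def)
    have "(\<lambda>t. K \<zeta> (csc (G (Complex t y)) (K (Complex t y) x))) integrable_on UNIV"
      using integrable_linear[OF i bounded_linear_K[OF \<zeta>]] by (simp add: o_def)
    then have "(\<lambda>t. K \<zeta> (csc (G (Complex t y)) (K (Complex t y) x)) - csc (G (Complex t y) * kker (\<zeta> - Complex t y)) (K \<zeta> x)) integrable_on UNIV"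
      by (rule integrable_diff[OF _ i2])
    then have i3: "(\<lambda>t. csc (G (Complex t y) * kker (Complex t y - \<zeta>)) (K (Complex t y) x)) integrable_on UNIV"
      by (simp add: eq)
    have i4: "integral UNIV (\<lambda>t. csc (G (Complex t y) * kker (\<zeta> - Complex t y)) (K \<zeta> x))
        = csc (integral UNIV (\<lambda>t. G (Complex t y) * kker (\<zeta> - Complex t y))) (K \<zeta> x)"
      using integral_linear[OF i1 csc.bounded_linear_left, of "K \<zeta> x"] by (simp add: o_def)
    show ?thesis
      unfolding 1 eq by (simp add: Henstock_Kurzweil_Integration.integral_add[OF i2 i3] i4)
  qed
  \<comment> \<open>The scalar coefficients of \<open>K \<zeta> x\<close> on the two lines agree, as
    \<open>\<zeta>\<close> is outside the strip of half-width \<open>\<theta>\<close>.\<close>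
  have z: "integral UNIV (\<lambda>t. G (Complex t \<theta>) * kker (\<zeta> - Complex t \<theta>))
      = integral UNIV (\<lambda>t. G (Complex t (-\<theta>)) * kker (\<zeta> - Complex t (-\<theta>)))"
    using Cauchy_strip_outside[where \<theta> = \<theta> and \<eta> = \<zeta>, OF hol \<alpha> _ _ bd] \<theta> w m by auto
  have "K \<zeta> (calc \<theta> G x) = csc (\<i> / (2 * pi)) (K \<zeta> (line_integral \<theta> G x) - K \<zeta> (line_integral (-\<theta>) G x))"
    using \<zeta> unfolding calc_def
    by (simp add: K_csc reg_def linear_diff[OF bounded_linear.linear[OF bounded_linear_K[OF \<zeta>]]])
  also have "\<dots> = csc (\<i> / (2 * pi))
     (integral UNIV (\<lambda>t. csc (G (Complex t \<theta>) * kker (Complex t \<theta> - \<zeta>)) (K (Complex t \<theta>) x))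
    - integral UNIV (\<lambda>t. csc (G (Complex t (-\<theta>)) * kker (Complex t (-\<theta>) - \<zeta>)) (K (Complex t (-\<theta>)) x)))"
    using \<theta> w by (subst (1 2) split) (auto simp: z)
  finally show ?thesis .
qed

end

section \<open>Multiplicativity of the calculus\<close>

text \<open>The function \<open>G\<close> is integrated over the outer lines, \<open>H\<close> over
  the inner ones. \<open>K_calc\<close> removes the outer resolvents. After the interchange the
  integral of \<open>G\<close> over the outer lines is a Cauchy integral with its point inside,
  which returns the value of \<open>G\<close> on the inner line.\<close>

lemma calc_calc_distinct_angles:
  assumes G: "strip_bounded m M \<alpha> G" and H: "strip_bounded m N \<beta> H"
    and \<theta>: "w < \<theta>" "\<theta> < \<theta>'" "\<theta>' < m"
  shows "calc \<theta>' G (calc \<theta> H x) = calc \<theta> (\<lambda>z. G z * H z) x"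
proof -
  \<comment> \<open>The heights of the two variables differ by either
    \<open>\<theta>' - \<theta>\<close> or \<open>\<theta>' + \<theta>\<close> in absolute value.
    Both keep the distance \<open>d\<close> from 0 and 2 pi.\<close>
  define d where "d = min (\<theta>' - \<theta>) (2 * pi - \<theta>' - \<theta>)"
  have d: "d > 0" using \<theta> m w by (auto simp: d_def)
  define B where "B = sqrt (2 / (1 - cos d))"
  have B: "B \<ge> 0" unfolding B_def by simp
  have \<alpha>: "\<alpha> > 0" "M \<ge> 0" and \<beta>: "\<beta> > 0" "N \<ge> 0" using G H by (auto simp: strip_bounded_def)
  \<comment> \<open>The four sign choices for \<open>y'\<close> and \<open>y\<close> give the four
    double integrals that make up the composition.\<close>
  define F where "F y' y s t = csc (G (Complex s y') * (H (Complex t y) * kker (Complex t y - Complex s y'))) (K (Complex t y) x)" for y' y s t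
  note cp = continuous_on_fst continuous_on_snd continuous_on_id
  have Fc: "continuous_on UNIV (\<lambda>(s, t). F y' y s t)" if "\<bar>y'\<bar> = \<theta>'" "\<bar>y\<bar> = \<theta>" for y' y
  proof -
    have ne: "exp (Complex (snd p) y - Complex (fst p) y') \<noteq> 1" for p
      using that \<theta> m by (intro exp_neq_1) auto
    have "continuous_on UNIV (\<lambda>p. F y' y (fst p) (snd p))"
      unfolding F_def using that \<theta> ne
      by (intro csc.continuous_on continuous_on_mult continuous_on_G[OF G] continuous_on_G[OF H] continuous_on_kker
          continuous_on_K continuous_on_const continuous_intros) (auto simp: reg_def)
    then show ?thesis by (simp add: case_prod_unfold)
  qed
  have Fb: "norm (F y' y s t) \<le> (2 * M * N * B * (C * norm x)) * kap \<alpha> s * kap \<beta> t" if "\<bar>y'\<bar> = \<theta>'" "\<bar>y\<bar> = \<theta>" for y' y s t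
  proof -
    have 1: "norm (kker (Complex t y - Complex s y')) \<le> B"
      unfolding B_def using that \<theta> w by (intro norm_kker_le d) (auto simp: d_def)
    have 2: "norm (G (Complex s y')) \<le> M * kap \<alpha> s" "norm (H (Complex t y)) \<le> N * kap \<beta> t"
      using norm_G_le[OF G, of y' s] norm_G_le[OF H, of y t] that \<theta> by auto
    have 3: "norm (K (Complex t y) x) \<le> C * norm x"
      using that \<theta> by (intro K_bound) auto
    have k: "kap \<alpha> s \<ge> 0" "kap \<beta> t \<ge> 0" using kap_pos less_imp_le by blast+
    have "norm (F y' y s t) \<le> 2 * (norm (G (Complex s y')) * (norm (H (Complex t y)) * norm (kker (Complex t y - Complex s y')))) * norm (K (Complex t y) x)"
      unfolding F_def using norm_csc_le[of "G (Complex s y') * (H (Complex t y) * kker (Complex t y - Complex s y'))" "K (Complex t y) x"]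
      by (simp add: norm_mult)
    also have "\<dots> \<le> 2 * ((M * kap \<alpha> s) * ((N * kap \<beta> t) * B)) * (C * norm x)"
      using 1 2 3 k B \<alpha> \<beta> C_nonneg by (intro mult_mono mult_nonneg_nonneg) auto
    finally show ?thesis by (simp add: mult_ac)
  qed
  have nn: "2 * M * N * B * (C * norm x) \<ge> 0"
    using \<alpha> \<beta> B by (intro mult_nonneg_nonneg[OF _ C_nonneg]) auto
  have sw: "(\<lambda>s. integral UNIV (F y' y s)) integrable_on UNIV"
    "(\<lambda>t. integral UNIV (\<lambda>s. F y' y s t)) integrable_on UNIV"
    "integral UNIV (\<lambda>s. integral UNIV (F y' y s)) = integral UNIV (\<lambda>t. integral UNIV (\<lambda>s. F y' y s t))"
    if "\<bar>y'\<bar> = \<theta>'" "\<bar>y\<bar> = \<theta>" for y' y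
    by (rule integral_UNIV_swap[OF Fc[OF that] nn \<alpha>(1) \<beta>(1) Fb[OF that]])+
  let ?N = "\<lambda>y' s y. integral UNIV (\<lambda>t. csc (H (Complex t y) * kker (Complex t y - Complex s y')) (K (Complex t y) x))"
  have Fi: "F y' y s integrable_on UNIV" if "\<bar>y'\<bar> = \<theta>'" "\<bar>y\<bar> = \<theta>" for y' y s
  proof (rule integrable_kap_dominated(1)[OF _ _ \<beta>(1)])
    show "continuous_on UNIV (F y' y s)"
      using continuous_on_compose2[OF Fc[OF that], of UNIV "\<lambda>t. (s, t)"] by (simp add: continuous_on_Pair)
  qed (rule Fb[OF that])
  have gN: "csc (G (Complex s y')) (?N y' s y) = integral UNIV (F y' y s)" if "\<bar>y'\<bar> = \<theta>'" "\<bar>y\<bar> = \<theta>" for y' y s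
  \<comment> \<open>Integrability of the integrand without \<open>G\<close> is recovered from that
    of \<open>F\<close> by dividing by the value of \<open>G\<close>, so a zero of \<open>G\<close>
    is treated apart.\<close>
  proof (cases "G (Complex s y') = 0")
    case True
    then have "F y' y s = (\<lambda>t. 0)" by (simp add: F_def csc.zero_left fun_eq_iff)
    then show ?thesis using True by (simp add: csc.zero_left)
  next
    case False
    have F: "F y' y s = (\<lambda>t. csc (G (Complex s y')) (csc (H (Complex t y) * kker (Complex t y - Complex s y')) (K (Complex t y) x)))"
      by (simp add: F_def csc_csc fun_eq_iff)
    have "(\<lambda>t. csc (inverse (G (Complex s y'))) (F y' y s t)) integrable_on UNIV"
      using integrable_linear[OF Fi[OF that] csc.bounded_linear_right[of "inverse (G (Complex s y'))"]] by (simp add: o_def)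
    then have "(\<lambda>t. csc (H (Complex t y) * kker (Complex t y - Complex s y')) (K (Complex t y) x)) integrable_on UNIV"
      using False by (simp add: F csc_csc mult.assoc[symmetric])
    from integral_linear[OF this csc.bounded_linear_right[of "G (Complex s y')"]] show ?thesis
      by (simp add: F o_def)
  qed
  have line: "line_integral y' G (calc \<theta> H x) = csc (\<i> / (2 * pi))
      (integral UNIV (\<lambda>t. integral UNIV (\<lambda>s. F y' \<theta> s t)) - integral UNIV (\<lambda>t. integral UNIV (\<lambda>s. F y' (-\<theta>) s t)))"
    if y': "\<bar>y'\<bar> = \<theta>'" for y'
  proof -
    have p: "\<bar>\<theta>\<bar> = \<theta>" "\<bar>- \<theta>\<bar> = \<theta>" using \<theta> w by auto
    have "csc (G (Complex s y')) (K (Complex s y') (calc \<theta> H x))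
       = csc (\<i> / (2 * pi)) (integral UNIV (F y' \<theta> s) - integral UNIV (F y' (-\<theta>) s))" for s
    proof -
      have "csc (G (Complex s y')) (K (Complex s y') (calc \<theta> H x)) =
          csc (\<i> / (2 * pi)) (csc (G (Complex s y')) (?N y' s \<theta>) - csc (G (Complex s y')) (?N y' s (-\<theta>)))"
        using y' \<theta> by (subst K_calc[OF H]) (auto simp: csc_csc csc.diff_right mult.commute)
      then show ?thesis using gN[OF y' p(1)] gN[OF y' p(2)] by simp
    qed
    then have "line_integral y' G (calc \<theta> H x) = integral UNIV (\<lambda>s. csc (\<i> / (2 * pi)) (integral UNIV (F y' \<theta> s) - integral UNIV (F y' (-\<theta>) s)))"
      by (simp add: line_integral_def)
    also have "\<dots> = csc (\<i> / (2 * pi)) (integral UNIV (\<lambda>s. integral UNIV (F y' \<theta> s) - integral UNIV (F y' (-\<theta>) s)))"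
      using integral_linear[OF integrable_diff[OF sw(1)[OF y' p(1)] sw(1)[OF y' p(2)]] csc.bounded_linear_right[of "\<i> / (2 * pi)"]]
      by (simp add: o_def)
    also have "integral UNIV (\<lambda>s. integral UNIV (F y' \<theta> s) - integral UNIV (F y' (-\<theta>) s))
       = integral UNIV (\<lambda>t. integral UNIV (\<lambda>s. F y' \<theta> s t)) - integral UNIV (\<lambda>t. integral UNIV (\<lambda>s. F y' (-\<theta>) s t))"
      by (simp add: Henstock_Kurzweil_Integration.integral_diff[OF sw(1)[OF y' p(1)] sw(1)[OF y' p(2)]] sw(3)[OF y' p(1)] sw(3)[OF y' p(2)])
    finally show ?thesis .
  qed
  have inner: "integral UNIV (\<lambda>t. integral UNIV (\<lambda>s. F \<theta>' y s t)) - integral UNIV (\<lambda>t. integral UNIV (\<lambda>s. F (-\<theta>') y s t))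
      = csc (- (2 * pi * \<i>)) (line_integral y (\<lambda>z. G z * H z) x)" if y: "\<bar>y\<bar> = \<theta>" for y
  proof -
    have p: "\<bar>\<theta>'\<bar> = \<theta>'" "\<bar>- \<theta>'\<bar> = \<theta>'" using \<theta> w by auto
    have hol: "G holomorphic_on {z. \<bar>Im z\<bar> < m}" and
      bd: "\<And>z. \<bar>Im z\<bar> \<le> \<theta>' \<Longrightarrow> norm (G z) \<le> M * kap \<alpha> (Re z)"
      using G \<theta> by (auto simp: strip_bounded_def)
    have one: "integral UNIV (\<lambda>s. F y' y s t) =
        csc (H (Complex t y) * integral UNIV (\<lambda>s. G (Complex s y') * kker (Complex t y - Complex s y'))) (K (Complex t y) x)"
      if "\<bar>y'\<bar> = \<theta>'" for y' t
    proof -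
      have i: "(\<lambda>s. G (Complex s y') * kker (Complex t y - Complex s y')) integrable_on UNIV"
        using that y \<theta> m by (intro kker_line_integrable(2)[OF hol \<alpha>(1) bd]) auto
      have bl: "bounded_linear (\<lambda>c. csc (H (Complex t y) * c) (K (Complex t y) x))"
        by (rule bounded_linear_compose[OF csc.bounded_linear_left bounded_linear_mult_right])
      show ?thesis
        using integral_linear[OF i bl] by (simp add: o_def F_def mult_ac)
    qed
    have diff: "integral UNIV (\<lambda>s. F \<theta>' y s t) - integral UNIV (\<lambda>s. F (-\<theta>') y s t)
        = csc (- (2 * pi * \<i>)) (csc (G (Complex t y) * H (Complex t y)) (K (Complex t y) x))" for t
    proof -
      let ?I = "\<lambda>y'. integral UNIV (\<lambda>s. G (Complex s y') * kker (Complex t y - Complex s y'))"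
      have "?I (-\<theta>') - ?I \<theta>' = 2 * pi * \<i> * G (Complex t y)"
        using y \<theta> w by (intro Cauchy_strip_inside[OF hol m \<alpha>(1) _ _ bd]) auto
      then have "H (Complex t y) * ?I \<theta>' - H (Complex t y) * ?I (-\<theta>') = - (2 * pi * \<i>) * (G (Complex t y) * H (Complex t y))"
        by (simp add: algebra_simps)
      then show ?thesis
        unfolding one[OF p(1)] one[OF p(2)] csc.diff_left[symmetric] csc_csc by simp
    qed
    have i: "(\<lambda>t. csc (G (Complex t y) * H (Complex t y)) (K (Complex t y) x)) integrable_on UNIV"
    proof -
      have "(\<lambda>t. csc (inverse (- (2 * pi * \<i>))) (integral UNIV (\<lambda>s. F \<theta>' y s t) - integral UNIV (\<lambda>s. F (-\<theta>') y s t))) integrable_on UNIV"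
        using integrable_linear[OF integrable_diff[OF sw(2)[OF p(1) y] sw(2)[OF p(2) y]] csc.bounded_linear_right[of "inverse (- (2 * pi * \<i>))"]]
        by (simp add: o_def)
      then have int: "(\<lambda>t. csc (inverse (- (2 * pi * \<i>)) * (- (2 * pi * \<i>) * (G (Complex t y) * H (Complex t y)))) (K (Complex t y) x)) integrable_on UNIV"
        unfolding diff csc_csc .
      have inv: "inverse a * (a * c) = c" if "a \<noteq> 0" for a c :: complex
        using that by simp
      have nz: "- (2 * pi * \<i>) \<noteq> 0" by simp
      from int show ?thesis unfolding inv[OF nz] .
    qed
    have "integral UNIV (\<lambda>t. integral UNIV (\<lambda>s. F \<theta>' y s t)) - integral UNIV (\<lambda>t. integral UNIV (\<lambda>s. F (-\<theta>') y s t))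
       = integral UNIV (\<lambda>t. integral UNIV (\<lambda>s. F \<theta>' y s t) - integral UNIV (\<lambda>s. F (-\<theta>') y s t))"
      by (simp add: Henstock_Kurzweil_Integration.integral_diff[OF sw(2)[OF p(1) y] sw(2)[OF p(2) y]])
    also have "\<dots> = csc (- (2 * pi * \<i>)) (line_integral y (\<lambda>z. G z * H z) x)"
      unfolding diff line_integral_def using integral_linear[OF i csc.bounded_linear_right] by (simp add: o_def)
    finally show ?thesis .
  qed
  have p: "\<bar>\<theta>'\<bar> = \<theta>'" "\<bar>- \<theta>'\<bar> = \<theta>'" "\<bar>\<theta>\<bar> = \<theta>" "\<bar>- \<theta>\<bar> = \<theta>" using \<theta> w by auto
  have "calc \<theta>' G (calc \<theta> H x) = csc (\<i> / (2 * pi)) (csc (\<i> / (2 * pi))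
     (csc (- (2 * pi * \<i>)) (line_integral \<theta> (\<lambda>z. G z * H z) x) - csc (- (2 * pi * \<i>)) (line_integral (-\<theta>) (\<lambda>z. G z * H z) x)))"
    unfolding calc_def[of \<theta>'] line[OF p(1)] line[OF p(2)] csc.diff_right[symmetric] inner[OF p(3), symmetric] inner[OF p(4), symmetric]
    by (simp add: csc.diff_right algebra_simps)
  \<comment> \<open>One of the factors i / (2 pi) cancels against the -2 pi i from Cauchy's
    formula.\<close>
  also have "\<dots> = csc (\<i> / (2 * pi)) (line_integral \<theta> (\<lambda>z. G z * H z) x - line_integral (-\<theta>) (\<lambda>z. G z * H z) x)"
    unfolding csc.diff_right[symmetric] csc_csc by (simp add: field_simps)
  finally show ?thesis by (simp add: calc_def)
qed

lemma calc_mult: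
  assumes G: "strip_bounded m M \<alpha> G" and H: "strip_bounded m N \<beta> H" and \<theta>: "w < \<theta>" "\<theta> < m"
  shows "calc \<theta> (\<lambda>z. G z * H z) x = calc \<theta> G (calc \<theta> H x)"
  \<comment> \<open>The outer angle is any angle strictly between \<open>\<theta>\<close> and
    \<open>m\<close>, here the midpoint. Angle independence brings it back to
    \<open>\<theta>\<close>.\<close>
  using calc_calc_distinct_angles[OF G H, of \<theta> "(\<theta> + m) / 2" x]
    calc_angle_independent[OF G, of \<theta> "(\<theta> + m) / 2" "calc \<theta> H x"] \<theta> by simp

text \<open>The source of module linearity: \<open>L\<close> will be a Clifford multiplication
  acting on both components of a pair.\<close>

lemma calc_commute:
  assumes G: "strip_bounded m M \<alpha> G" and \<theta>: "w < \<theta>" "\<theta> < m" and L: "bounded_linear L"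
    and L_csc: "\<And>c x. L (csc c x) = csc c (L x)" and L_K: "\<And>\<zeta> x. \<zeta> \<in> reg \<Longrightarrow> L (K \<zeta> x) = K \<zeta> (L x)"
  shows "L (calc \<theta> G x) = calc \<theta> G (L x)"
proof -
  have "L (line_integral y G x) = line_integral y G (L x)" if y: "w < \<bar>y\<bar>" "\<bar>y\<bar> < m" for y
    unfolding line_integral_def using integral_linear[OF line_integrand(3)[OF G y] L, of x] y
    by (simp add: o_def L_csc L_K[OF Complex_in_reg])
  then show ?thesis
    using \<theta> w by (simp add: calc_def L_csc linear_diff[OF bounded_linear.linear[OF L]])
qed

end

section \<open>Closed operators and their complexified resolvents\<close>

text \<open>Baire category makes some sublevel set of norm (S x) dense in a ball. Every small vector
  is then a series of vectors with geometrically decreasing images, and closedness identifies the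
  image of the sum.\<close>

lemma closed_graph_bounded_linear:
  fixes S :: "'a::banach \<Rightarrow> 'b::banach"
  assumes lin: "linear S" and closed: "closed (range (\<lambda>x. (x, S x)))"
  shows "bounded_linear S"
proof -
  define E where "E n = {x. norm (S x) \<le> n}" for n :: real
  have "\<exists>n::nat. interior (closure (E n)) \<noteq> {}"
  proof (rule ccontr)
    assume neg: "\<nexists>n::nat. interior (closure (E n)) \<noteq> {}"
    have "euclidean interior_of \<Union>(range (\<lambda>n::nat. closure (E n))) = ({} :: 'a set)"
    proof (rule Baire_category_alt)
      show "completely_metrizable_space (euclidean :: 'a topology) \<or>
          locally_compact_space (euclidean :: 'a topology) \<and> regular_space (euclidean :: 'a topology)"
        using completely_metrizable_space_euclidean by blast
      fix U :: "'a set" assume "U \<in> range (\<lambda>n::nat. closure (E n))"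
      then show "closedin euclidean U \<and> euclidean interior_of U = {}"
        using neg by auto
    qed simp
    moreover have "\<Union>(range (\<lambda>n::nat. closure (E n))) = UNIV"
    proof (intro equalityI subset_UNIV subsetI)
      fix x
      obtain n :: nat where "norm (S x) \<le> n" using real_arch_simple by blast
      then have "x \<in> closure (E n)" using closure_subset[of "E n"] by (auto simp: E_def)
      then show "x \<in> \<Union>(range (\<lambda>n::nat. closure (E n)))" by auto
    qed
    ultimately show False by simp
  qed
  then obtain n :: nat and x0 where "x0 \<in> interior (closure (E n))" by blast
  then obtain r where r: "r > 0" "ball x0 r \<subseteq> closure (E n)"
    unfolding mem_interior by blast
  \<comment> \<open>Differences of points of \<open>E n\<close> near x0 + y' and near x0 approximate
    y', which doubles the bound on the image. Scaling by \<open>t\<close> gives the general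
    case.\<close>
  have approx: "\<exists>z. norm (S z) \<le> 2 * real n * t \<and> norm (y - z) < e"
    if t: "t > 0" "norm y \<le> r / 2 * t" and e: "e > 0" for y and t e :: real
  proof -
    define y' where "y' = y /\<^sub>R t"
    have "norm y' \<le> r / 2"
      using t by (simp add: y'_def pos_divide_le_eq divide_inverse_commute[symmetric])
    then have ny: "norm y' < r" using r(1) by linarith
    have e': "e / t / 2 > 0" using e t by simp
    have "x0 + y' \<in> closure (E n)" "x0 \<in> closure (E n)"
      using r ny by (auto simp: dist_norm subset_iff)
    then obtain a b where a: "a \<in> E n" "dist a (x0 + y') < e / t / 2" and b: "b \<in> E n" "dist b x0 < e / t / 2"
      using e' unfolding closure_approachable by metis
    have "norm (S (a - b)) \<le> 2 * real n"
      using a(1) b(1) norm_triangle_ineq4[of "S a" "S b"] by (simp add: E_def linear_diff[OF lin])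
    then have 1: "norm (S (t *\<^sub>R (a - b))) \<le> 2 * real n * t"
      using t by (simp add: linear_scale[OF lin] mult.commute)
    have "norm (y' - (a - b)) \<le> norm (a - (x0 + y')) + norm (b - x0)"
      using norm_triangle_ineq4[of "b - x0" "a - (x0 + y')"] by (simp add: algebra_simps)
    also have "\<dots> < e / t"
      using a(2) b(2) by (simp add: dist_norm)
    finally have "norm (t *\<^sub>R (y' - (a - b))) < e"
      using t by (simp add: pos_less_divide_eq mult.commute)
    moreover have "t *\<^sub>R (y' - (a - b)) = y - t *\<^sub>R (a - b)"
      using t by (simp add: y'_def algebra_simps)
    ultimately show ?thesis using 1 by (intro exI[of _ "t *\<^sub>R (a - b)"]) simp
  qed
  have bound: "norm (S y0) \<le> 4 * n" if y0: "norm y0 \<le> r / 2" for y0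
  proof -
    define f where "f k y = (SOME z. norm (S z) \<le> 2 * real n * (1/2)^k \<and> norm (y - z) < r / 2 * (1/2)^(Suc k))" for k :: nat and y
    have f: "norm (S (f k y)) \<le> 2 * real n * (1/2)^k" "norm (y - f k y) < r / 2 * (1/2)^(Suc k)"
      if "norm y \<le> r / 2 * (1/2)^k" for k y
      using someI_ex[OF approx[where t = "(1/2)^k" and y = y and e = "r / 2 * (1/2)^(Suc k)"]] that r(1)
      unfolding f_def by auto
    \<comment> \<open>The residuals of the successive approximations. Their norms are bounded by r/2
      times powers of 1/2, and the images removed sum to at most 2n(1 + 1/2 + 1/4 + ...) =
      4n.\<close>
    define yy where "yy = rec_nat y0 (\<lambda>k y. y - f k y)"
    have yy0: "yy 0 = y0" and yyS: "yy (Suc k) = yy k - f k (yy k)" for k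
      by (simp_all add: yy_def)
    have nyy: "norm (yy k) \<le> r / 2 * (1/2)^k" for k
    proof (induction k)
      case 0
      then show ?case using y0 by (simp add: yy0)
    next
      case (Suc k)
      then show ?case using f(2)[OF Suc] by (simp add: yyS)
    qed
    have lim: "(\<lambda>k. y0 - yy k) \<longlonglongrightarrow> y0 - 0"
    proof (intro tendsto_diff tendsto_const Lim_null_comparison[of yy])
      show "\<forall>\<^sub>F k in sequentially. norm (yy k) \<le> r / 2 * (1/2)^k" using nyy by simp
      show "(\<lambda>k. r / 2 * (1/2)^k) \<longlonglongrightarrow> 0"
        by (intro tendsto_mult_right_zero LIMSEQ_power_zero) simp
    qed
    define g where "g k = S (f k (yy k))" for k
    have gb: "norm (g k) \<le> 2 * real n * (1/2)^k" for k
      unfolding g_def by (rule f(1)[OF nyy])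
    have geo: "(\<lambda>k. 2 * real n * (1/2)^k) sums (2 * real n * (1 / (1 - 1/2)))"
      by (intro sums_mult geometric_sums) simp
    have sn: "summable (\<lambda>k. norm (g k))"
      by (rule summable_comparison_test'[OF sums_summable[OF geo], of 0]) (use gb in simp)
    have Sy: "S (y0 - yy k) = (\<Sum>j<k. g j)" for k
    proof (induction k)
      case (Suc k)
      have "S (y0 - yy (Suc k)) = S ((y0 - yy k) + f k (yy k))" by (simp add: yyS algebra_simps)
      also have "\<dots> = S (y0 - yy k) + g k" by (simp add: g_def linear_add[OF lin])
      finally show ?case using Suc by simp
    qed (simp add: yy0 linear_0[OF lin])
    have "(\<lambda>k. \<Sum>j<k. g j) \<longlonglongrightarrow> suminf g"
      by (rule summable_LIMSEQ[OF summable_norm_cancel[OF sn]])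
    then have "(\<lambda>k. (y0 - yy k, S (y0 - yy k))) \<longlonglongrightarrow> (y0, suminf g)"
      using lim unfolding Sy by (intro tendsto_Pair) auto
    \<comment> \<open>Here the closed graph enters: the partial sums and their images both
      converge.\<close>
    then have "(y0, suminf g) \<in> range (\<lambda>x. (x, S x))"
      by (rule closed_sequentially[OF closed, rotated]) auto
    then have "S y0 = suminf g" by auto
    moreover have "norm (suminf g) \<le> (\<Sum>k. norm (g k))" by (rule summable_norm[OF sn])
    moreover have "(\<Sum>k. norm (g k)) \<le> (\<Sum>k. 2 * real n * (1/2)^k)"
      by (rule suminf_le[OF gb sn sums_summable[OF geo]])
    ultimately show ?thesis using sums_unique[OF geo] by simp
  qed
  show ?thesis
  proof (rule bounded_linear_intro)
    fix x
    show "norm (S x) \<le> norm x * (8 * n / r)"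
    proof (cases "x = 0")
      case False
      define c where "c = r / 2 / norm x"
      have c: "c > 0" using False r by (simp add: c_def)
      have "norm (S (c *\<^sub>R x)) \<le> 4 * n"
        using False r by (intro bound) (simp add: c_def)
      then have "c * norm (S x) \<le> 4 * n" using c by (simp add: linear_scale[OF lin])
      then have "norm (S x) \<le> 4 * n / c" using c by (simp add: pos_le_divide_eq mult.commute)
      then show ?thesis by (simp add: c_def field_simps)
    qed (simp add: linear_0[OF lin])
  qed (simp_all add: linear_add[OF lin] linear_scale[OF lin])
qed

section \<open>Resolvents of a closed operator on the complexification\<close>

locale closed_operator =
  fixes T :: "'a::banach \<Rightarrow> 'a" and dom :: "'a set"
  assumes dom: "subspace dom"
    and T_add: "x \<in> dom \<Longrightarrow> y \<in> dom \<Longrightarrow> T (x + y) = T x + T y"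
    and T_scale: "x \<in> dom \<Longrightarrow> T (c *\<^sub>R x) = c *\<^sub>R T x"
    and closed_T: "closed {(v, T v) |v. v \<in> dom}"
begin

lemma T_minus: "x \<in> dom \<Longrightarrow> T (- x) = - T x"
  using T_scale[of x "-1"] by simp

lemma T_diff: "x \<in> dom \<Longrightarrow> y \<in> dom \<Longrightarrow> T (x - y) = T x - T y"
  using T_add[of x "-y"] T_minus[of y] dom by (simp add: subspace_neg)

lemma dom_simps [simp]:
  "x \<in> dom \<Longrightarrow> y \<in> dom \<Longrightarrow> x + y \<in> dom" "x \<in> dom \<Longrightarrow> y \<in> dom \<Longrightarrow> x - y \<in> dom"
  "x \<in> dom \<Longrightarrow> c *\<^sub>R x \<in> dom" "x \<in> dom \<Longrightarrow> - x \<in> dom"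
  using dom by (auto simp: subspace_add subspace_diff subspace_scale subspace_neg)

definition quad :: "complex \<Rightarrow> 'a \<Rightarrow> 'a" where
  "quad z v = T (T v) - (2 * Re z) *\<^sub>R T v + (norm z)\<^sup>2 *\<^sub>R v"

text \<open>The predicate \<open>is_Qs\<close> without right module linearity. It sees
  \<open>z\<close> only through Re z and |z|, so a number and its conjugate share one Q.\<close>

definition pseudo_resolvent :: "complex \<Rightarrow> ('a \<Rightarrow> 'a) \<Rightarrow> bool" where
  "pseudo_resolvent z Q \<longleftrightarrow> bounded_linear Q \<and> (\<forall>w. Q w \<in> dom \<and> T (Q w) \<in> dom \<and> quad z (Q w) = w)
     \<and> (\<forall>v. v \<in> dom \<and> T v \<in> dom \<longrightarrow> Q (quad z v) = v)"

text \<open>The choice rests on the factorization (z - T)(cnj z - T) = \<open>quad z\<close>, with T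
  acting on both components of a pair.\<close>

definition resolv :: "('a \<Rightarrow> 'a) \<Rightarrow> complex \<Rightarrow> 'a \<times> 'a \<Rightarrow> 'a \<times> 'a" where
  "resolv Q z p = csc (Complex.cnj z) (Q (fst p), Q (snd p)) - (T (Q (fst p)), T (Q (snd p)))"

context
  fixes z Q assumes Q: "pseudo_resolvent z Q"
begin

lemma bounded_linear_Q: "bounded_linear Q"
  using Q by (simp add: pseudo_resolvent_def)

lemma Q_add: "Q (x + y) = Q x + Q y" and Q_diff: "Q (x - y) = Q x - Q y" and Q_scale: "Q (c *\<^sub>R x) = c *\<^sub>R Q x"
  using bounded_linear_Q by (simp_all add: bounded_linear.linear linear_add linear_diff linear_scale)

lemma Q_dom [simp]: "Q w \<in> dom" "T (Q w) \<in> dom"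
  using Q by (auto simp: pseudo_resolvent_def)

lemma TTQ: "T (T (Q w)) = w + (2 * Re z) *\<^sub>R T (Q w) - (norm z)\<^sup>2 *\<^sub>R Q w"
proof -
  have "quad z (Q w) = w" using Q by (auto simp: pseudo_resolvent_def)
  then show ?thesis by (simp add: quad_def algebra_simps)
qed

text \<open>By \<open>TTQ\<close>, \<open>T (T (Q v))\<close> stays in the domain when
  \<open>v\<close> does, so \<open>T\<close> can be moved through \<open>quad z\<close> at
  \<open>Q v\<close>. Applying Q to both sides removes \<open>quad z\<close>.\<close>

lemma T_Q_commute:
  assumes v: "v \<in> dom" shows "T (Q v) = Q (T v)"
proof -
  have d: "T (T (Q v)) \<in> dom" unfolding TTQ using v by simp
  have "T v = T (quad z (Q v))" using TTQ[of v] by (simp add: quad_def)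
  also have "\<dots> = quad z (T (Q v))"
    unfolding quad_def using d by (simp add: T_add T_diff T_scale)
  finally have "Q (T v) = Q (quad z (T (Q v)))" by simp
  also have "\<dots> = T (Q v)"
    using Q d by (auto simp: pseudo_resolvent_def)
  finally show ?thesis by simp
qed

text \<open>The operator is everywhere defined, and its graph is the preimage of the closed graph of
  \<open>T\<close> under the continuous map (x, y) to (Q x, y).\<close>

lemma bounded_linear_TQ: "bounded_linear (\<lambda>v. T (Q v))"
proof (rule closed_graph_bounded_linear)
  show "linear (\<lambda>v. T (Q v))"
    by (rule linearI) (simp_all add: Q_add Q_scale T_add T_scale)
  have "closed ((\<lambda>p. (Q (fst p), snd p)) -` {(v, T v) |v. v \<in> dom})"
    by (intro closed_vimage closed_T continuous_intros linear_continuous_on[OF bounded_linear_compose[OF bounded_linear_Q bounded_linear_fst]])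
  moreover have "(\<lambda>p. (Q (fst p), snd p)) -` {(v, T v) |v. v \<in> dom} = range (\<lambda>x. (x, T (Q x)))"
    by (auto simp: image_iff)
  ultimately show "closed (range (\<lambda>x. (x, T (Q x))))" by simp
qed

lemma resolv_add: "resolv Q z (p + q) = resolv Q z p + resolv Q z q"
proof -
  have "(a + b, c + d) = (a, c) + (b, d)" for a b c d :: 'a by simp
  then show ?thesis
    unfolding resolv_def by (simp only: fst_add snd_add Q_add T_add Q_dom csc.add_right) simp
qed

lemma resolv_csc: "resolv Q z (csc c p) = csc c (resolv Q z p)"
  by (simp add: resolv_def csc_def Q_add Q_diff Q_scale T_add T_diff T_scale algebra_simps)

text \<open>The resolvent identity comes from \<open>R\<^sub>z - R\<^sub>w = R\<^sub>z (w - T) R\<^sub>w - R\<^sub>z (z - T) R\<^sub>w\<close>.\<close>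

lemma resolv_left_inverse:
  assumes "fst p \<in> dom" "snd p \<in> dom"
  shows "resolv Q z (csc z p - (T (fst p), T (snd p))) = p"
proof -
  have c: "Q (T (fst p)) = T (Q (fst p))" "Q (T (snd p)) = T (Q (snd p))"
    using assms by (simp_all add: T_Q_commute)
  have n: "(norm z)\<^sup>2 = Re z * Re z + Im z * Im z" unfolding cmod_power2 by (simp add: power2_eq_square)
  show ?thesis
    by (simp add: resolv_def csc_def Q_add Q_diff Q_scale c T_add T_diff T_scale TTQ n prod_eq_iff algebra_simps
        scaleR_add_left[symmetric] del: scaleR_add_left)
qed

lemma resolv_right_inverse:
  "fst (resolv Q z p) \<in> dom \<and> snd (resolv Q z p) \<in> dom \<and>
   csc z (resolv Q z p) - (T (fst (resolv Q z p)), T (snd (resolv Q z p))) = p"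
proof -
  have n: "(norm z)\<^sup>2 = Re z * Re z + Im z * Im z" unfolding cmod_power2 by (simp add: power2_eq_square)
  show ?thesis
    by (simp add: resolv_def csc_def T_add T_diff T_scale TTQ n prod_eq_iff algebra_simps
        scaleR_add_left[symmetric] del: scaleR_add_left)
qed

end

lemma resolv_identity:
  assumes z: "pseudo_resolvent z Q" and w: "pseudo_resolvent w Q'"
  shows "resolv Q z p = resolv Q' w p + csc (w - z) (resolv Q z (resolv Q' w p))"
proof -
  let ?p = "resolv Q' w p"
  have d: "fst ?p \<in> dom" "snd ?p \<in> dom" and e: "csc w ?p - (T (fst ?p), T (snd ?p)) = p"
    using resolv_right_inverse[OF w, of p] by auto
  have l: "linear (resolv Q z)"
  proof (rule linearI[OF resolv_add[OF z]])
    have r: "r *\<^sub>R x = csc (of_real r) x" for r and x :: "'a \<times> 'a"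
      by (simp add: csc_def prod_eq_iff)
    show "resolv Q z (r *\<^sub>R x) = r *\<^sub>R resolv Q z x" for r x
      unfolding r by (rule resolv_csc[OF z])
  qed
  \<comment> \<open>Splits multiplication by w as z + (w - z). \<open>X\<close> will be the pair of
    values of \<open>T\<close>.\<close>
  have X: "p = csc z ?p - X + csc (w - z) ?p" if "csc w ?p - X = p" for X
    using that by (simp add: csc.diff_left)
  have "p = (csc z ?p - (T (fst ?p), T (snd ?p))) + csc (w - z) ?p"
    by (rule X[OF e])
  then have "resolv Q z p = resolv Q z (csc z ?p - (T (fst ?p), T (snd ?p))) + resolv Q z (csc (w - z) ?p)"
    using resolv_add[OF z] by metis
  then show ?thesis
    by (simp add: resolv_left_inverse[OF z d] resolv_csc[OF z])
qed

text \<open>The hypotheses are bounds for the real operators in (cnj z - T) Q, because these are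
  what estimates of the S-resolvents control. Each of the two components contributes two terms,
  which gives the factor 4.\<close>

lemma norm_resolv_le:
  assumes z: "pseudo_resolvent z Q" and c: "c \<ge> 0"
    and A: "\<And>v. norm (Re z *\<^sub>R Q v - T (Q v)) \<le> c * norm v"
    and B: "\<And>v. norm (Im z *\<^sub>R Q v) \<le> c * norm v"
  shows "norm (resolv Q z p) \<le> 4 * c * norm p"
proof -
  define a b where "a = fst p" and "b = snd p"
  have n: "norm a \<le> norm p" "norm b \<le> norm p"
    using norm_fst_le[of a b] norm_snd_le[of b a] by (simp_all add: a_def b_def)
  have cn: "c * norm a \<le> c * norm p" "c * norm b \<le> c * norm p"
    using n c by (simp_all add: mult_left_mono)
  have e: "resolv Q z p = ((Re z *\<^sub>R Q a - T (Q a)) + Im z *\<^sub>R Q b, (Re z *\<^sub>R Q b - T (Q b)) - Im z *\<^sub>R Q a)"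
    by (simp add: resolv_def csc_def a_def b_def algebra_simps)
  have "norm (resolv Q z p) \<le> norm ((Re z *\<^sub>R Q a - T (Q a)) + Im z *\<^sub>R Q b) + norm ((Re z *\<^sub>R Q b - T (Q b)) - Im z *\<^sub>R Q a)"
    unfolding e by (rule norm_Pair_le)
  also have "\<dots> \<le> (c * norm a + c * norm b) + (c * norm b + c * norm a)"
    by (intro add_mono order_trans[OF norm_triangle_ineq4] order_trans[OF norm_triangle_ineq] A B)
  also have "\<dots> \<le> 4 * c * norm p" using cn by simp
  finally show ?thesis .
qed

end

section \<open>The Clifford algebra\<close>

lemma symd_assoc: "symd (symd A B) C = symd A (symd B C)"
  and symd_commute: "symd A B = symd B A"
  and symd_cancel [simp]: "symd A (symd A B) = B"
  and symd_empty [simp]: "symd {} A = A" "symd A {} = A"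
  and symd_self [simp]: "symd A A = {}"
  by (auto simp: symd_def)

text \<open>Factors over the common part occur twice on the right and cancel, since their squares
  are 1.\<close>

lemma prod_symd:
  fixes f :: "'a \<Rightarrow> real"
  assumes "finite A" "finite B" and f: "\<And>a. f a * f a = 1"
  shows "prod f (symd A B) = prod f A * prod f B"
proof -
  have A: "prod f A = prod f (A - B) * prod f (A \<inter> B)"
    using assms(1) by (metis Diff_Int_distrib2 Int_Diff_Un Int_Diff_disjoint finite_Diff finite_Int mult.commute prod.union_disjoint)
  have B: "prod f B = prod f (B - A) * prod f (A \<inter> B)"
    using assms(2) by (metis Int_Diff_Un Int_Diff_disjoint Int_commute finite_Diff finite_Int mult.commute prod.union_disjoint)
  have "prod f (A \<inter> B) * prod f (A \<inter> B) = 1"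
    by (simp add: prod.distrib[symmetric] f)
  then have "prod f A * prod f B = prod f (A - B) * prod f (B - A)"
    unfolding A B by (metis (no_types, opaque_lifting) mult.assoc mult.commute mult_1_right)
  also have "\<dots> = prod f (symd A B)"
    unfolding symd_def using assms by (intro prod.union_disjoint[symmetric]) auto
  finally show ?thesis by simp
qed

text \<open>Each transposition of a pair with b < a costs a sign, and each common generator costs
  e_a^2 = -1. Together these are exactly the pairs with b at most a.\<close>

lemma clsign_prod:
  fixes A B :: "'n::{finite,linorder} set"
  shows "clsign A B = (\<Prod>a\<in>A. \<Prod>b\<in>B. if b \<le> a then -1 else 1)"
proof -
  let ?L = "{(a, b). a \<in> A \<and> b \<in> B \<and> b < a}" and ?D = "(\<lambda>a. (a, a)) ` (A \<inter> B)"
  have "card {p \<in> A \<times> B. snd p \<le> fst p} = card (?L \<union> ?D)"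
    by (rule arg_cong[of _ _ card]) auto
  also have "\<dots> = card ?L + card ?D"
    by (rule card_Un_disjoint) auto
  also have "card ?D = card (A \<inter> B)"
    by (rule card_image) (auto simp: inj_on_def)
  finally have c: "card {p \<in> A \<times> B. snd p \<le> fst p} = card ?L + card (A \<inter> B)" .
  have "(\<Prod>a\<in>A. \<Prod>b\<in>B. if b \<le> a then -1 else 1) = (\<Prod>p\<in>A \<times> B. if snd p \<le> fst p then -1 else (1::real))"
    by (simp add: prod.cartesian_product case_prod_unfold)
  also have "\<dots> = (-1) ^ card {p \<in> A \<times> B. snd p \<le> fst p}"
  proof -
    have "{p \<in> A \<times> B. snd p \<le> fst p} = (A \<times> B) \<inter> {p. snd p \<le> fst p}" by auto
    then show ?thesis by (simp add: prod.If_cases)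
  qed
  finally show ?thesis by (simp add: clsign_def c)
qed

text \<open>Bimultiplicativity of the sign is what makes the product associative.\<close>

lemma clsign_symd_left: "clsign (symd A B) C = clsign A C * clsign B C"
  and clsign_symd_right: "clsign A (symd B C) = clsign A B * clsign A C"
  for A B C :: "'n::{finite,linorder} set"
proof -
  have sq: "(\<Prod>b\<in>S. f b) * (\<Prod>b\<in>S. f b) = 1" if "\<And>b. f b = -1 \<or> f b = 1" for f :: "'n \<Rightarrow> real" and S
  proof -
    have "f b * f b = 1" for b using that[of b] by auto
    then show ?thesis unfolding prod.distrib[symmetric] by simp
  qed
  show "clsign (symd A B) C = clsign A C * clsign B C"
    unfolding clsign_prod by (rule prod_symd) (simp_all add: sq)
  have "(\<Prod>b\<in>symd B C. if b \<le> a then -1 else (1::real)) = (\<Prod>b\<in>B. if b \<le> a then -1 else 1) * (\<Prod>b\<in>C. if b \<le> a then -1 else 1)" for a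
    by (rule prod_symd) auto
  then show "clsign A (symd B C) = clsign A B * clsign A C"
    unfolding clsign_prod by (simp add: prod.distrib)
qed

lemma clsign_empty [simp]: "clsign {} A = 1" "clsign A {} = 1"
  by (simp_all add: clsign_def)

lemma clmul_eq_lmul: "clmul a b = lmul a b"
  by (simp add: clmul_def lmul_def)

lemma lmul_nth: "lmul a v $ C = (\<Sum>A\<in>UNIV. (clsign A (symd A C) * a $ A) *\<^sub>R v $ (symd A C))"
  by (simp add: lmul_def)

lemma rmul_nth: "rmul v a $ C = (\<Sum>A\<in>UNIV. (clsign A (symd A C) * a $ (symd A C)) *\<^sub>R v $ A)"
  by (simp add: rmul_def)

lemma sum_symd_shift:
  fixes f :: "'n::finite set \<Rightarrow> 'b::comm_monoid_add"
  shows "(\<Sum>A\<in>UNIV. f A) = (\<Sum>B\<in>UNIV. f (symd E B))"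
  by (rule sum.reindex_bij_witness[of _ "symd E" "symd E"]) auto

text \<open>Reindexing by symmetric differences turns both sides into sums over the same pairs of
  index sets. Expressed through E, B and the surviving index D, the signs agree by
  bimultiplicativity.\<close>

lemma lmul_lmul: "lmul (clmul a b) v = lmul a (lmul b v)"
proof (rule vec_eq_iff[THEN iffD2], rule allI)
  fix C
  have "lmul (clmul a b) v $ C = (\<Sum>A\<in>UNIV. \<Sum>E\<in>UNIV. (clsign A (symd A C) * (clsign E (symd E A) * a $ E * b $ symd E A)) *\<^sub>R v $ symd A C)"
    by (simp add: lmul_nth clmul_def sum_distrib_left scaleR_sum_left)
  also have "\<dots> = (\<Sum>E\<in>UNIV. \<Sum>A\<in>UNIV. (clsign A (symd A C) * (clsign E (symd E A) * a $ E * b $ symd E A)) *\<^sub>R v $ symd A C)"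
    by (rule sum.swap)
  also have "\<dots> = (\<Sum>E\<in>UNIV. \<Sum>B\<in>UNIV. (clsign (symd E B) (symd (symd E B) C) * (clsign E B * a $ E * b $ B)) *\<^sub>R v $ symd (symd E B) C)"
  proof (rule sum.cong[OF refl])
    fix E
    show "(\<Sum>A\<in>UNIV. (clsign A (symd A C) * (clsign E (symd E A) * a $ E * b $ symd E A)) *\<^sub>R v $ symd A C)
       = (\<Sum>B\<in>UNIV. (clsign (symd E B) (symd (symd E B) C) * (clsign E B * a $ E * b $ B)) *\<^sub>R v $ symd (symd E B) C)"
      by (subst sum_symd_shift[of _ E]) simp
  qed
  also have "\<dots> = (\<Sum>E\<in>UNIV. \<Sum>B\<in>UNIV. (clsign E (symd E C) * a $ E) *\<^sub>R (clsign B (symd B (symd E C)) * b $ B) *\<^sub>R v $ symd B (symd E C))"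
  proof (intro sum.cong refl)
    fix E B
    define D where "D = symd E (symd B C)"
    have 1: "symd (symd E B) C = D" by (simp add: D_def symd_assoc)
    have 2: "symd E C = symd B D" unfolding D_def by (metis symd_assoc symd_cancel symd_commute)
    have 3: "symd B (symd E C) = D" unfolding 2 by simp
    show "(clsign (symd E B) (symd (symd E B) C) * (clsign E B * a $ E * b $ B)) *\<^sub>R v $ symd (symd E B) C
       = (clsign E (symd E C) * a $ E) *\<^sub>R (clsign B (symd B (symd E C)) * b $ B) *\<^sub>R v $ symd B (symd E C)"
      unfolding 1 3 unfolding 2 by (simp add: clsign_symd_left clsign_symd_right mult_ac)
  qed
  also have "\<dots> = lmul a (lmul b v) $ C"
    by (simp add: lmul_nth scaleR_sum_right)
  finally show "lmul (clmul a b) v $ C = lmul a (lmul b v) $ C" .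
qed

lemma clmul_assoc: "clmul (clmul a b) c = clmul a (clmul b c)"
  using lmul_lmul[of a b c] by (simp add: clmul_eq_lmul)

lemma lmul_rmul: "lmul a (rmul v c) = rmul (lmul a v) c"
proof (rule vec_eq_iff[THEN iffD2], rule allI)
  fix C
  have "lmul a (rmul v c) $ C = (\<Sum>A\<in>UNIV. \<Sum>B\<in>UNIV. (clsign A (symd A C) * a $ A) *\<^sub>R (clsign B (symd B (symd A C)) * c $ symd B (symd A C)) *\<^sub>R v $ B)"
    by (simp add: lmul_nth rmul_nth scaleR_sum_right)
  also have "\<dots> = (\<Sum>A\<in>UNIV. \<Sum>B\<in>UNIV. (clsign (symd A B) (symd (symd A B) C) * c $ symd (symd A B) C) *\<^sub>R (clsign A B * a $ A) *\<^sub>R v $ B)"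
  proof (intro sum.cong refl)
    fix A B
    define D where "D = symd A (symd B C)"
    have 1: "symd (symd A B) C = D" by (simp add: D_def symd_assoc)
    have 2: "symd A C = symd B D" unfolding D_def by (metis symd_assoc symd_cancel symd_commute)
    have 3: "symd B (symd A C) = D" unfolding 2 by simp
    show "(clsign A (symd A C) * a $ A) *\<^sub>R (clsign B (symd B (symd A C)) * c $ symd B (symd A C)) *\<^sub>R v $ B
       = (clsign (symd A B) (symd (symd A B) C) * c $ symd (symd A B) C) *\<^sub>R (clsign A B * a $ A) *\<^sub>R v $ B"
      unfolding 1 3 unfolding 2 by (simp add: clsign_symd_left clsign_symd_right mult_ac)
  qed
  also have "\<dots> = (\<Sum>A\<in>UNIV. \<Sum>B\<in>UNIV. (clsign B (symd B C) * c $ symd B C) *\<^sub>R (clsign A (symd A B) * a $ A) *\<^sub>R v $ symd A B)"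
  proof (rule sum.cong[OF refl])
    fix A
    show "(\<Sum>B\<in>UNIV. (clsign (symd A B) (symd (symd A B) C) * c $ symd (symd A B) C) *\<^sub>R (clsign A B * a $ A) *\<^sub>R v $ B)
       = (\<Sum>B\<in>UNIV. (clsign B (symd B C) * c $ symd B C) *\<^sub>R (clsign A (symd A B) * a $ A) *\<^sub>R v $ symd A B)"
      by (subst sum_symd_shift[of _ A]) simp
  qed
  also have "\<dots> = (\<Sum>B\<in>UNIV. \<Sum>A\<in>UNIV. (clsign B (symd B C) * c $ symd B C) *\<^sub>R (clsign A (symd A B) * a $ A) *\<^sub>R v $ symd A B)"
    by (rule sum.swap)
  also have "\<dots> = rmul (lmul a v) c $ C"
    by (simp add: lmul_nth rmul_nth scaleR_sum_right)
  finally show "lmul a (rmul v c) $ C = rmul (lmul a v) c $ C" .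
qed


interpretation lmul: bounded_bilinear "lmul :: ('n::{finite,linorder}) cliff \<Rightarrow> ('v::real_normed_vector, 'n) modn \<Rightarrow> _"
proof
  show "lmul (a + a') v = lmul a v + lmul a' v" for a a' :: "'n cliff" and v :: "('v, 'n) modn"
    by (simp add: vec_eq_iff lmul_nth algebra_simps sum.distrib)
  show "lmul a (v + v') = lmul a v + lmul a v'" for a :: "'n cliff" and v v' :: "('v, 'n) modn"
    by (simp add: vec_eq_iff lmul_nth algebra_simps sum.distrib)
  show "lmul (r *\<^sub>R a) v = r *\<^sub>R lmul a v" for r and a :: "'n cliff" and v :: "('v, 'n) modn"
    by (simp add: vec_eq_iff lmul_nth scaleR_sum_right mult_ac)
  show "lmul a (r *\<^sub>R v) = r *\<^sub>R lmul a v" for r and a :: "'n cliff" and v :: "('v, 'n) modn"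
    by (simp add: vec_eq_iff lmul_nth scaleR_sum_right mult_ac)
  have abs1: "\<bar>clsign A B\<bar> = 1" for A B :: "'n set" by (simp add: clsign_def power_abs)
  have "norm (lmul a v) \<le> norm a * norm v * (real (CARD('n set)) * real (CARD('n set)))" for a :: "'n cliff" and v :: "('v, 'n) modn"
  proof -
    have "norm (lmul a v $ C) \<le> (\<Sum>A\<in>(UNIV :: 'n set set). norm a * norm v)" for C
      unfolding lmul_nth
    proof (rule order_trans[OF norm_sum sum_mono])
      fix A
      have "norm ((clsign A (symd A C) * a $ A) *\<^sub>R v $ symd A C) = \<bar>a $ A\<bar> * norm (v $ symd A C)"
        by (simp add: abs_mult abs1)
      also have "\<dots> \<le> norm a * norm v"
        using Finite_Cartesian_Product.norm_nth_le[of a A] Finite_Cartesian_Product.norm_nth_le[of v "symd A C"]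
        by (intro mult_mono) auto
      finally show "norm ((clsign A (symd A C) * a $ A) *\<^sub>R v $ symd A C) \<le> norm a * norm v" .
    qed
    then have C: "norm (lmul a v $ C) \<le> norm a * norm v * real (CARD('n set))" for C
      by (simp add: mult_ac)
    have "norm (lmul a v) \<le> (\<Sum>C\<in>UNIV. norm (lmul a v $ C))"
      unfolding norm_vec_def by (rule L2_set_le_sum) simp
    also have "\<dots> \<le> (\<Sum>C\<in>(UNIV :: 'n set set). norm a * norm v * real (CARD('n set)))"
      by (rule sum_mono[OF C])
    finally show ?thesis by (simp add: mult_ac)
  qed
  then show "\<exists>K. \<forall>a v. norm (lmul (a :: 'n cliff) (v :: ('v, 'n) modn)) \<le> norm a * norm v * K"
    by blast
qed

lemma bounded_linear_vec_componentwise: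
  fixes f :: "'a::real_normed_vector \<Rightarrow> 'b::real_normed_vector ^ 'k"
  assumes f: "\<And>i. bounded_linear (\<lambda>x. f x $ i)"
  shows "bounded_linear f"
proof -
  have "\<exists>K. \<forall>x. norm (f x $ i) \<le> norm x * K" for i
    using bounded_linear.bounded[OF f] .
  then obtain K where K: "\<And>i x. norm (f x $ i) \<le> norm x * K i" by metis
  show ?thesis
  proof (rule bounded_linear_intro)
    fix x
    have "norm (f x) \<le> (\<Sum>i\<in>UNIV. norm (f x $ i))"
      unfolding norm_vec_def by (rule L2_set_le_sum) simp
    also have "\<dots> \<le> (\<Sum>i\<in>UNIV. norm x * K i)" by (rule sum_mono[OF K])
    finally show "norm (f x) \<le> norm x * (\<Sum>i\<in>UNIV. K i)" by (simp add: sum_distrib_left)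
  qed (simp_all add: vec_eq_iff linear_add[OF bounded_linear.linear[OF f]] linear_scale[OF bounded_linear.linear[OF f]])
qed

lemma bounded_linear_rmul: "bounded_linear (\<lambda>v :: ('v::real_normed_vector, 'n::{finite,linorder}) modn. rmul v a)"
proof -
  have "bounded_linear (\<lambda>v :: ('v, 'n) modn. rmul v a $ C)" for C
    unfolding rmul_nth by (intro bounded_linear_sum bounded_linear_compose[OF bounded_linear_scaleR_right] bounded_linear_vec_nth)
  then show ?thesis by (rule bounded_linear_vec_componentwise)
qed

abbreviation cle :: "'n::{finite,linorder} set \<Rightarrow> 'n cliff" where
  "cle A \<equiv> axis A 1"

lemma lmul_cle_nth: "lmul (cle E) v $ C = clsign E (symd E C) *\<^sub>R v $ (symd E C)"
proof -
  have "lmul (cle E) v $ C = (\<Sum>A\<in>UNIV. if A = E then clsign A (symd A C) *\<^sub>R v $ (symd A C) else 0)"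
    unfolding lmul_nth by (rule sum.cong) (auto simp: axis_def)
  then show ?thesis by simp
qed

lemma lmul_one [simp]: "lmul (cle {}) v = v"
  by (simp add: vec_eq_iff lmul_cle_nth)

lemma clmul_one [simp]: "clmul (cle {}) a = a"
  by (simp add: clmul_eq_lmul)

lemma clmul_cle_cle: "clmul (cle A) (cle B) = clsign A B *\<^sub>R cle (symd A B)"
proof (rule vec_eq_iff[THEN iffD2], rule allI)
  fix C
  show "clmul (cle A) (cle B) $ C = (clsign A B *\<^sub>R cle (symd A B)) $ C"
  proof (cases "C = symd A B")
    case True
    then show ?thesis unfolding clmul_eq_lmul lmul_cle_nth by (simp add: axis_def)
  next
    case False
    then have "symd A C \<noteq> B" by auto
    then show ?thesis using False unfolding clmul_eq_lmul lmul_cle_nth by (simp add: axis_def)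
  qed
qed

lemma cliff_expand: "a = (\<Sum>B\<in>UNIV. a $ B *\<^sub>R cle B)" for a :: "('n::{finite,linorder}) cliff"
  by (simp add: vec_eq_iff axis_def if_distrib[of "\<lambda>x. _ * x"] cong: if_cong)

lemma clmul_one_right [simp]: "clmul a (cle {}) = a"
proof -
  have "clmul a (cle {}) = (\<Sum>B\<in>UNIV. a $ B *\<^sub>R clmul (cle B) (cle {}))"
    unfolding clmul_eq_lmul by (subst cliff_expand[of a]) (simp add: lmul.sum_left lmul.scaleR_left)
  then show ?thesis using cliff_expand[of a] by (simp add: clmul_cle_cle)
qed

lemma pv_add: "pv (x + y) = pv x + pv y" and pv_scaleR: "pv (c *\<^sub>R x) = c *\<^sub>R pv x"
  by (simp_all add: pv_def vec_eq_iff)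

lemma pv_minus: "pv (- x) = - pv x"
  using pv_scaleR[of "-1" x] by simp

lemma pv_pone [simp]: "pv pone = cle {}"
  by (simp add: pv_def pone_def vec_eq_iff axis_def)

lemma sum_option_UNIV: "(\<Sum>\<mu>\<in>UNIV. f \<mu>) = f None + (\<Sum>j\<in>UNIV. f (Some j))"
  for f :: "'n::finite option \<Rightarrow> 'b::comm_monoid_add"
  by (simp add: UNIV_option_conv sum.reindex)

lemma sph_sum_squares:
  assumes "i \<in> sph" shows "i $ None = 0" "(\<Sum>j\<in>UNIV. (i $ Some j)\<^sup>2) = 1"
proof -
  show n: "i $ None = 0" using assms by (simp add: sph_def)
  have "(norm i)\<^sup>2 = (\<Sum>\<mu>\<in>UNIV. (i $ \<mu>)\<^sup>2)"
    unfolding power2_norm_eq_inner by (simp add: inner_vec_def power2_eq_square)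
  then show "(\<Sum>j\<in>UNIV. (i $ Some j)\<^sup>2) = 1"
    using assms n by (simp add: sph_def sum_option_UNIV)
qed

lemma pv_sph:
  fixes i :: "('n::{finite,linorder}) para"
  assumes "i \<in> sph" shows "pv i = (\<Sum>j\<in>UNIV. i $ Some j *\<^sub>R cle {j})"
proof (rule vec_eq_iff[THEN iffD2], rule allI)
  fix A :: "'n set"
  show "pv i $ A = (\<Sum>j\<in>UNIV. i $ Some j *\<^sub>R cle {j}) $ A"
  proof (cases "card A = 1")
    case True
    then obtain k where k: "A = {k}" by (auto simp: card_1_singleton_iff)
    have "(\<Sum>j\<in>UNIV. i $ Some j * (cle {j} $ {k})) = (\<Sum>j\<in>UNIV. if j = k then i $ Some j else 0)"
      by (rule sum.cong) (auto simp: axis_def)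
    then show ?thesis by (simp add: k pv_def)
  next
    case False
    then have "cle {j} $ A = 0" for j by (auto simp: axis_def)
    then show ?thesis using False sph_sum_squares(1)[OF assms] by (simp add: pv_def)
  qed
qed

lemma clsign_singleton: "clsign {j} {k} = (if k \<le> j then -1 else 1)" for j k :: "'n::{finite,linorder}"
  by (simp add: clsign_prod)

text \<open>The double sum is added to its transpose: the generators anticommute off the diagonal,
  and the diagonal gives -2 times the sum of the squared coordinates, which is 1.\<close>

lemma pv_sph_square:
  assumes i: "i \<in> sph" shows "clmul (pv i) (pv i) = - cle {}"
proof -
  define x where "x j = i $ Some j" for j
  have S: "clmul (pv i) (pv i) = (\<Sum>j\<in>UNIV. \<Sum>k\<in>UNIV. (x j * x k) *\<^sub>R clmul (cle {j}) (cle {k}))"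
    unfolding pv_sph[OF i] clmul_eq_lmul x_def
    by (simp add: lmul.sum_left lmul.sum_right lmul.scaleR_left lmul.scaleR_right scaleR_sum_right)
       (subst sum.swap, simp add: mult.commute)
  also have "\<dots> = (\<Sum>j\<in>UNIV. \<Sum>k\<in>UNIV. (x j * x k) *\<^sub>R clmul (cle {k}) (cle {j}))"
    by (subst sum.swap) (simp add: mult.commute)
  finally have S': "clmul (pv i) (pv i) = (\<Sum>j\<in>UNIV. \<Sum>k\<in>UNIV. (x j * x k) *\<^sub>R clmul (cle {k}) (cle {j}))" .
  have "clmul (pv i) (pv i) + clmul (pv i) (pv i)
      = (\<Sum>j\<in>UNIV. \<Sum>k\<in>UNIV. (x j * x k) *\<^sub>R (clmul (cle {j}) (cle {k}) + clmul (cle {k}) (cle {j})))"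
    by (subst S, subst S') (simp add: sum.distrib scaleR_add_right)
  also have "\<dots> = (\<Sum>j\<in>UNIV. \<Sum>k\<in>UNIV. if k = j then (- 2 * (x j)\<^sup>2) *\<^sub>R cle {} else 0)"
  proof (intro sum.cong refl)
    fix j k
    show "(x j * x k) *\<^sub>R (clmul (cle {j}) (cle {k}) + clmul (cle {k}) (cle {j})) = (if k = j then (- 2 * (x j)\<^sup>2) *\<^sub>R cle {} else 0)"
      by (cases "k = j") (auto simp: clmul_cle_cle clsign_singleton symd_commute[of "{k}"] power2_eq_square scaleR_2[symmetric] simp flip: scaleR_minus_left)
  qed
  also have "\<dots> = (\<Sum>j\<in>UNIV. (- 2 * (x j)\<^sup>2) *\<^sub>R cle {})" by simp
  also have "\<dots> = (- 2 * (\<Sum>j\<in>UNIV. (x j)\<^sup>2)) *\<^sub>R cle {}"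
    by (simp add: scaleR_sum_left[symmetric] sum_distrib_left sum_negf)
  also have "(\<Sum>j\<in>UNIV. (x j)\<^sup>2) = 1" unfolding x_def by (rule sph_sum_squares(2)[OF i])
  finally have "2 *\<^sub>R clmul (pv i) (pv i) = 2 *\<^sub>R (- cle {})" by (simp add: scaleR_2)
  then show ?thesis by (simp only: scaleR_cancel_left) simp
qed

lemma lmul_pv_sph_twice: "i \<in> sph \<Longrightarrow> lmul (pv i) (lmul (pv i) v) = - v"
  for v :: "('v::real_normed_vector, 'n::{finite,linorder}) modn"
  by (simp add: lmul_lmul[symmetric] pv_sph_square lmul.minus_left)

text \<open>With a single generator any two indices coincide, so the pairwise sign is
  symmetric.\<close>

lemma clmul_commute:
  fixes a b :: "('n::{finite,linorder}) cliff"
  assumes "CARD('n) = 1" shows "clmul a b = clmul b a"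
proof -
  have eq: "j = k" for j k :: 'n using assms by (metis card_1_singletonE UNIV_I singletonD)
  have c: "clsign A B = clsign B A" for A B :: "'n set"
    unfolding clsign_prod by (subst prod.swap) (intro prod.cong refl, metis eq)
  show ?thesis
  proof (rule vec_eq_iff[THEN iffD2], rule allI)
    fix C :: "'n set"
    have "clmul a b $ C = (\<Sum>A\<in>UNIV. clsign A (symd A C) * a $ A * b $ symd A C)" by (simp add: clmul_def)
    also have "\<dots> = (\<Sum>B\<in>UNIV. clsign (symd C B) (symd (symd C B) C) * a $ (symd C B) * b $ symd (symd C B) C)"
      by (rule sum_symd_shift)
    also have "\<dots> = clmul b a $ C"
    proof -
      have B: "symd (symd C B) C = B" "symd C B = symd B C" for B by (metis symd_cancel symd_commute)+
      have "clsign (symd C B) (symd (symd C B) C) * a $ (symd C B) * b $ symd (symd C B) C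
          = clsign B (symd B C) * b $ B * a $ symd B C" for B
        unfolding B(1) unfolding B(2) by (simp add: c[of B] mult_ac)
      then show ?thesis by (simp add: clmul_def)
    qed
    finally show "clmul a b $ C = clmul b a $ C" .
  qed
qed

section \<open>Paravector operators\<close>

definition componentwise :: "('v \<Rightarrow> 'w) \<Rightarrow> ('v, 'n::finite) modn \<Rightarrow> ('w, 'n) modn" where
  "componentwise f v = (\<chi> B. f (v $ B))"

text \<open>Separates the unit e_\<open>\<mu>\<close> from the real operator T_\<open>\<mu>\<close>:
  a Clifford multiplication always commutes with the second and has to be compared with the first
  only.\<close>

lemma opT_eq: "opT Top v = (\<Sum>\<mu>\<in>UNIV. lmul (cle (set_option \<mu>)) (componentwise (Top \<mu>) v))"
  for v :: "('v::real_vector, 'n::{finite,linorder}) modn"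
  by (simp add: vec_eq_iff opT_def lmul_cle_nth componentwise_def)

lemma lin_op_sum:
  assumes "lin_op D T" "finite S" "\<And>i. i \<in> S \<Longrightarrow> x i \<in> D"
  shows "(\<Sum>i\<in>S. r i *\<^sub>R x i) \<in> D \<and> T (\<Sum>i\<in>S. r i *\<^sub>R x i) = (\<Sum>i\<in>S. r i *\<^sub>R T (x i))"
  using assms(2,3)
proof (induction S rule: finite_induct)
  case empty
  have "0 \<in> D" "T (0 *\<^sub>R 0) = 0 *\<^sub>R T 0"
    using assms(1) unfolding lin_op_def by (metis subspace_0)+
  then show ?case by simp
next
  case (insert i S)
  then have "r i *\<^sub>R x i \<in> D" "T (r i *\<^sub>R x i) = r i *\<^sub>R T (x i)"
    using assms(1) unfolding lin_op_def by (auto intro: subspace_scale)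
  then show ?case
    using insert assms(1) unfolding lin_op_def by (auto intro: subspace_add)
qed

locale paravector_operator =
  fixes D :: "'n::{finite,linorder} option \<Rightarrow> 'v::real_normed_vector set" and Top :: "'n option \<Rightarrow> 'v \<Rightarrow> 'v"
  assumes lin: "\<And>m. lin_op (D m) (Top m)"
begin

lemma subspace_opdom: "subspace (opdom D :: ('v, 'n) modn set)"
  using lin unfolding lin_op_def opdom_def
  by (intro subspaceI) (auto intro: subspace_add subspace_scale subspace_0)

lemma lmul_opdom: "v \<in> opdom D \<Longrightarrow> lmul a v \<in> opdom D"
  and componentwise_lmul: "v \<in> opdom D \<Longrightarrow> componentwise (Top \<mu>) (lmul a v) = lmul a (componentwise (Top \<mu>) v)"
proof -
  assume v: "v \<in> opdom D"
  have s: "lmul a v $ C \<in> D \<mu> \<and> Top \<mu> (lmul a v $ C) = lmul a (componentwise (Top \<mu>) v) $ C" for C \<mu>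
    using lin_op_sum[OF lin[of \<mu>], of UNIV "\<lambda>A. v $ symd A C" "\<lambda>A. clsign A (symd A C) * a $ A"] v
    by (simp add: lmul_nth componentwise_def opdom_def)
  show "lmul a v \<in> opdom D" using s by (simp add: opdom_def)
  show "componentwise (Top \<mu>) (lmul a v) = lmul a (componentwise (Top \<mu>) v)"
    unfolding vec_eq_iff using s by (simp add: componentwise_def[of "Top \<mu>" "lmul a v"])
qed

lemma rmul_opdom: "v \<in> opdom D \<Longrightarrow> rmul v a \<in> opdom D"
  and componentwise_rmul: "v \<in> opdom D \<Longrightarrow> componentwise (Top \<mu>) (rmul v a) = rmul (componentwise (Top \<mu>) v) a"
proof -
  assume v: "v \<in> opdom D"
  have s: "rmul v a $ C \<in> D \<mu> \<and> Top \<mu> (rmul v a $ C) = rmul (componentwise (Top \<mu>) v) a $ C" for C \<mu>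
    using lin_op_sum[OF lin[of \<mu>], of UNIV "\<lambda>A. v $ A" "\<lambda>A. clsign A (symd A C) * a $ symd A C"] v
    by (simp add: rmul_nth componentwise_def opdom_def)
  show "rmul v a \<in> opdom D" using s by (simp add: opdom_def)
  show "componentwise (Top \<mu>) (rmul v a) = rmul (componentwise (Top \<mu>) v) a"
    unfolding vec_eq_iff using s by (simp add: componentwise_def[of "Top \<mu>" "rmul v a"])
qed

lemma opT_add: "v \<in> opdom D \<Longrightarrow> w \<in> opdom D \<Longrightarrow> opT Top (v + w) = opT Top v + opT Top w"
  and opT_scaleR: "v \<in> opdom D \<Longrightarrow> opT Top (c *\<^sub>R v) = c *\<^sub>R opT Top v"
  for v w :: "('v, 'n) modn"
  using lin unfolding opdom_def lin_op_def
  by (simp_all add: vec_eq_iff opT_def sum.distrib scaleR_add_right scaleR_sum_right mult.commute)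

lemma opT_rmul: "v \<in> opdom D \<Longrightarrow> opT Top (rmul v a) = rmul (opT Top v) a"
  unfolding opT_eq by (simp add: componentwise_rmul lmul_rmul linear_sum[OF bounded_linear.linear[OF bounded_linear_rmul]])

text \<open>With several generators \<open>a\<close> and the units e_j in T need not commute. This
  is why products are restricted to intrinsic functions on one side.\<close>

lemma opT_lmul:
  assumes "CARD('n) = 1" "v \<in> opdom D" shows "opT Top (lmul a v) = lmul a (opT Top v)"
  unfolding opT_eq
  by (simp add: componentwise_lmul assms(2) lmul.sum_right lmul_lmul[symmetric] clmul_commute[OF assms(1), of a])

end

section \<open>Slice hyperholomorphic functions on a slice\<close>

definition slice :: "('n::finite) para \<Rightarrow> complex \<Rightarrow> 'n para" where
  "slice i z = Re z *\<^sub>R pone + Im z *\<^sub>R i"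

definition iota :: "('n::{finite,linorder}) para \<Rightarrow> complex \<Rightarrow> 'n cliff" where
  "iota i z = Re z *\<^sub>R cle {} + Im z *\<^sub>R pv i"

lemma pv_slice: "pv (slice i z) = iota i z"
  by (simp add: slice_def iota_def pv_add pv_scaleR)

lemma lmul_iota: "lmul (iota i c) y = Re c *\<^sub>R y + Im c *\<^sub>R lmul (pv i) y"
  for y :: "('v::real_normed_vector, 'n::{finite,linorder}) modn"
  by (simp add: iota_def lmul.add_left lmul.scaleR_left)

lemma iota_mult:
  assumes "i \<in> sph" shows "clmul (iota i a) (iota i b) = iota i (a * b)"
proof -
  have p: "lmul (pv i) (cle {}) = pv i" "lmul (pv i) (pv i) = - cle {}"
    using clmul_one_right[of "pv i"] pv_sph_square[OF assms] by (simp_all add: clmul_eq_lmul)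
  have L: "lmul (pv i) (iota i b) = Re b *\<^sub>R pv i - Im b *\<^sub>R cle {}"
    unfolding iota_def lmul.add_right lmul.scaleR_right p by simp
  show ?thesis
    unfolding clmul_eq_lmul lmul_iota L by (simp add: iota_def algebra_simps)
qed

lemma slice_None: "i \<in> sph \<Longrightarrow> slice i z $ None = Re z"
  by (simp add: slice_def sph_def pone_def)

lemma norm_slice:
  assumes "i \<in> sph" shows "norm (slice i z) = norm z"
proof -
  have "(norm (slice i z))\<^sup>2 = (\<Sum>\<mu>\<in>UNIV. (slice i z $ \<mu>)\<^sup>2)"
    unfolding power2_norm_eq_inner by (simp add: inner_vec_def power2_eq_square)
  also have "\<dots> = (Re z)\<^sup>2 + (\<Sum>j\<in>UNIV. (Im z * i $ Some j)\<^sup>2)"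
    using assms by (simp add: sum_option_UNIV slice_None) (simp add: slice_def pone_def)
  also have "\<dots> = (norm z)\<^sup>2"
    using sph_sum_squares(2)[OF assms] by (simp add: power_mult_distrib sum_distrib_left[symmetric] cmod_power2)
  finally show ?thesis by (simp add: power2_eq_iff_nonneg)
qed

lemma cnj_slice: "i \<in> sph \<Longrightarrow> Defs.cnj (slice i z) = slice i (Complex.cnj z)"
  by (auto simp: vec_eq_iff Defs.cnj_def slice_def pone_def sph_def)

text \<open>The cosine is even and \<open>arccos\<close> inverts it on [0, pi], so sectors become
  symmetric strips of the same half-width.\<close>

lemma parg_slice_exp:
  assumes "i \<in> sph" "\<bar>Im \<zeta>\<bar> \<le> pi"
  shows "parg (slice i (exp \<zeta>)) = \<bar>Im \<zeta>\<bar>"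
proof -
  have "Re (exp \<zeta>) / norm (exp \<zeta>) = cos \<bar>Im \<zeta>\<bar>"
    by (simp add: Re_exp abs_if)
  then have "parg (slice i (exp \<zeta>)) = arccos (cos \<bar>Im \<zeta>\<bar>)"
    using assms(1) by (simp only: parg_def slice_None norm_slice)
  also have "\<dots> = \<bar>Im \<zeta>\<bar>"
    using assms(2) by (intro arccos_cos) auto
  finally show ?thesis .
qed

lemma slice_exp_neq_0: "i \<in> sph \<Longrightarrow> slice i (exp \<zeta>) \<noteq> 0"
  using norm_slice[of i "exp \<zeta>"] by auto

lemma slice_in_Ci: "slice i z \<in> Ci i"
  by (auto simp: Ci_def slice_def)

lemma slice_exp_in_Sect0:
  "i \<in> sph \<Longrightarrow> \<mu> \<le> pi \<Longrightarrow> \<bar>Im \<zeta>\<bar> < \<mu> \<Longrightarrow> slice i (exp \<zeta>) \<in> Sect0 \<mu>"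
  by (simp add: Sect0_def slice_exp_neq_0 parg_slice_exp)

section \<open>Symmetric holomorphic functions on a strip and slice representations\<close>

definition strip_symmetric :: "real \<Rightarrow> (complex \<Rightarrow> complex) \<Rightarrow> bool" where
  "strip_symmetric m F \<longleftrightarrow> (\<exists>M \<alpha>. strip_bounded m M \<alpha> F) \<and> (\<forall>\<zeta>. \<bar>Im \<zeta>\<bar> < m \<longrightarrow> F (Complex.cnj \<zeta>) = Complex.cnj (F \<zeta>))"

text \<open>One factor supplies the decay, the other is merely bounded since \<open>kap\<close> is
  at most 1.\<close>

lemma strip_bounded_mult:
  assumes "strip_bounded m M \<alpha> F" "strip_bounded m N \<beta> G"
  shows "strip_bounded m (M * N) \<alpha> (\<lambda>z. F z * G z)"
proof -
  have "norm (F z * G z) \<le> M * N * kap \<alpha> (Re z)" if "\<bar>Im z\<bar> < m" for z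
  proof -
    have 1: "norm (F z) \<le> M * kap \<alpha> (Re z)" "norm (G z) \<le> N * kap \<beta> (Re z)"
      using assms that by (auto simp: strip_bounded_def)
    have "N * kap \<beta> (Re z) \<le> N * 1"
      using assms kap_le_1 by (intro mult_left_mono) (auto simp: strip_bounded_def)
    then have "norm (F z) * norm (G z) \<le> M * kap \<alpha> (Re z) * N"
      using 1 by (intro mult_mono) (auto intro: order_trans[OF norm_ge_zero])
    then show ?thesis by (simp add: norm_mult mult_ac)
  qed
  then show ?thesis
    using assms by (auto simp: strip_bounded_def intro!: holomorphic_intros)
qed

lemma strip_symmetric_mult:
  assumes "strip_symmetric m F" "strip_symmetric m G"
  shows "strip_symmetric m (\<lambda>z. F z * G z)"
  using assms strip_bounded_mult unfolding strip_symmetric_def by fastforce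

text \<open>A function that is holomorphic with respect to the complex structure \<open>J\<close> on a real vector space
is a combination \<open>\<Sum>B. F\<^sub>B e\<^sub>B\<close> of complex functions satisfying \<open>F\<^sub>B (cnj \<zeta>) = cnj (F\<^sub>B \<zeta>)\<close>: take the real
coordinates of the even and odd parts \<open>a\<close>, \<open>b\<close> in \<open>u = a + J b\<close>.\<close>

lemma symmetric_decomposition:
  fixes u :: "complex \<Rightarrow> real ^ 'k::finite" and J :: "real ^ 'k \<Rightarrow> real ^ 'k"
  assumes J: "bounded_linear J" "\<And>x. J (J x) = - x"
    and der: "\<And>\<zeta>. \<bar>Im \<zeta>\<bar> < m \<Longrightarrow> \<exists>p. (u has_derivative (\<lambda>h. Re h *\<^sub>R p + Im h *\<^sub>R J p)) (at \<zeta>)"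
    and bd: "\<And>\<zeta>. \<bar>Im \<zeta>\<bar> < m \<Longrightarrow> norm (u \<zeta>) \<le> M * kap \<alpha> (Re \<zeta>)" and \<alpha>: "\<alpha> > 0" and M: "M \<ge> 0"
  obtains F where "\<And>B. strip_symmetric m (F B)"
    "\<And>\<zeta>. \<bar>Im \<zeta>\<bar> < m \<Longrightarrow> u \<zeta> = (\<Sum>B\<in>UNIV. Re (F B \<zeta>) *\<^sub>R axis B 1 + Im (F B \<zeta>) *\<^sub>R J (axis B 1))"
    "\<And>B x. F B (of_real x) = of_real (u (of_real x) $ B)"
proof -
  have lJ: "linear J" using J(1) by (rule bounded_linear.linear)
  note Jl = linear_add[OF lJ] linear_diff[OF lJ] linear_scale[OF lJ] linear_neg[OF lJ] linear_0[OF lJ] linear_sum[OF lJ]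
  define a where "a \<zeta> = (1/2) *\<^sub>R (u \<zeta> + u (Complex.cnj \<zeta>))" for \<zeta>
  \<comment> \<open>Chosen so that u = a + J b, because J composed with itself is minus the
    identity.\<close>
  define b where "b \<zeta> = - (1/2) *\<^sub>R J (u \<zeta> - u (Complex.cnj \<zeta>))" for \<zeta>
  define F where "F B \<zeta> = Complex (a \<zeta> $ B) (b \<zeta> $ B)" for B \<zeta>
  obtain K where K: "K > 0" "\<And>x. norm (J x) \<le> norm x * K"
    using bounded_linear.pos_bounded[OF J(1)] by auto
  have ab: "norm (a \<zeta>) \<le> M * kap \<alpha> (Re \<zeta>)" "norm (b \<zeta>) \<le> M * K * kap \<alpha> (Re \<zeta>)" if "\<bar>Im \<zeta>\<bar> < m" for \<zeta>
  proof -
    have n: "norm (u \<zeta>) \<le> M * kap \<alpha> (Re \<zeta>)" "norm (u (Complex.cnj \<zeta>)) \<le> M * kap \<alpha> (Re \<zeta>)"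
      using bd[of \<zeta>] bd[of "Complex.cnj \<zeta>"] that by auto
    then show "norm (a \<zeta>) \<le> M * kap \<alpha> (Re \<zeta>)"
      using norm_triangle_ineq[of "u \<zeta>" "u (Complex.cnj \<zeta>)"] by (simp add: a_def)
    have "norm (u \<zeta> - u (Complex.cnj \<zeta>)) \<le> 2 * M * kap \<alpha> (Re \<zeta>)"
      using n norm_triangle_ineq4[of "u \<zeta>" "u (Complex.cnj \<zeta>)"] by simp
    then have "norm (J (u \<zeta> - u (Complex.cnj \<zeta>))) \<le> 2 * M * kap \<alpha> (Re \<zeta>) * K"
      using K(1) by (intro order_trans[OF K(2)] mult_right_mono) auto
    then show "norm (b \<zeta>) \<le> M * K * kap \<alpha> (Re \<zeta>)" by (simp add: b_def mult_ac)
  qed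
  have hol: "F B holomorphic_on {z. \<bar>Im z\<bar> < m}" for B
    unfolding holomorphic_on_open[OF open_strip]
  proof (intro ballI)
    fix \<zeta> assume "\<zeta> \<in> {z. \<bar>Im z\<bar> < m}"
    then have \<zeta>: "\<bar>Im \<zeta>\<bar> < m" "\<bar>Im (Complex.cnj \<zeta>)\<bar> < m" by auto
    obtain p where p: "(u has_derivative (\<lambda>h. Re h *\<^sub>R p + Im h *\<^sub>R J p)) (at \<zeta>)"
      using der[OF \<zeta>(1)] by blast
    obtain q where q: "(u has_derivative (\<lambda>h. Re h *\<^sub>R q + Im h *\<^sub>R J q)) (at (Complex.cnj \<zeta>))"
      using der[OF \<zeta>(2)] by blast
    have "(Complex.cnj has_derivative Complex.cnj) (at \<zeta>)"
      by (rule bounded_linear_imp_has_derivative[OF bounded_linear_cnj])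
    from has_derivative_compose[OF this q]
    have q': "((\<lambda>z. u (Complex.cnj z)) has_derivative (\<lambda>h. Re h *\<^sub>R q - Im h *\<^sub>R J q)) (at \<zeta>)" by simp
    \<comment> \<open>Derivatives of the even and the odd part in the real direction. The pair (a,
      b) then satisfies the Cauchy-Riemann system, so P + iS is the complex derivative in each
      coordinate.\<close>
    define P S where "P = (1/2) *\<^sub>R (p + q)" and "S = - (1/2) *\<^sub>R J (p - q)"
    have "(a has_derivative (\<lambda>h. (1/2) *\<^sub>R ((Re h *\<^sub>R p + Im h *\<^sub>R J p) + (Re h *\<^sub>R q - Im h *\<^sub>R J q)))) (at \<zeta>)"
      unfolding a_def[abs_def] by (intro derivative_intros p q')
    then have a': "(a has_derivative (\<lambda>h. Re h *\<^sub>R P - Im h *\<^sub>R S)) (at \<zeta>)"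
      by (rule has_derivative_eq_rhs) (simp add: P_def S_def Jl algebra_simps fun_eq_iff)
    have "(b has_derivative (\<lambda>h. - (1/2) *\<^sub>R J ((Re h *\<^sub>R p + Im h *\<^sub>R J p) - (Re h *\<^sub>R q - Im h *\<^sub>R J q)))) (at \<zeta>)"
      unfolding b_def[abs_def] by (intro derivative_intros bounded_linear.has_derivative[OF J(1)] p q')
    then have b': "(b has_derivative (\<lambda>h. Re h *\<^sub>R S + Im h *\<^sub>R P)) (at \<zeta>)"
      by (rule has_derivative_eq_rhs) (simp add: P_def S_def Jl J(2) algebra_simps fun_eq_iff)
    have "F B = (\<lambda>\<zeta>. of_real (a \<zeta> $ B) + \<i> * of_real (b \<zeta> $ B))"
      by (simp add: F_def fun_eq_iff complex_eq_iff)
    moreover have "((\<lambda>\<zeta>. of_real (a \<zeta> $ B) + \<i> * of_real (b \<zeta> $ B)) has_derivative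
        (\<lambda>h. of_real ((Re h *\<^sub>R P - Im h *\<^sub>R S) $ B) + \<i> * of_real ((Re h *\<^sub>R S + Im h *\<^sub>R P) $ B))) (at \<zeta>)"
      by (intro derivative_intros bounded_linear.has_derivative[OF bounded_linear_vec_nth] a' b')
    moreover have "(\<lambda>h. of_real ((Re h *\<^sub>R P - Im h *\<^sub>R S) $ B) + \<i> * of_real ((Re h *\<^sub>R S + Im h *\<^sub>R P) $ B)) = (\<lambda>h. Complex (P $ B) (S $ B) * h)"
      by (simp add: fun_eq_iff complex_eq_iff algebra_simps)
    ultimately have "(F B has_derivative (\<lambda>h. Complex (P $ B) (S $ B) * h)) (at \<zeta>)"
      by (simp only:)
    then show "\<exists>f'. (F B has_field_derivative f') (at \<zeta>)"
      unfolding has_field_derivative_def by blast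
  qed
  have "strip_bounded m (M + M * K) \<alpha> (F B)" for B
  proof -
    have "norm (F B \<zeta>) \<le> (M + M * K) * kap \<alpha> (Re \<zeta>)" if "\<bar>Im \<zeta>\<bar> < m" for \<zeta>
    proof -
      have "norm (F B \<zeta>) \<le> \<bar>a \<zeta> $ B\<bar> + \<bar>b \<zeta> $ B\<bar>"
        unfolding F_def using cmod_le[of "Complex (a \<zeta> $ B) (b \<zeta> $ B)"] by simp
      also have "\<dots> \<le> norm (a \<zeta>) + norm (b \<zeta>)"
        using Finite_Cartesian_Product.norm_nth_le[of "a \<zeta>" B] Finite_Cartesian_Product.norm_nth_le[of "b \<zeta>" B] by simp
      finally show ?thesis using ab[OF that] by (simp add: algebra_simps)
    qed
    then show ?thesis using hol \<alpha> M K by (simp add: strip_bounded_def)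
  qed
  moreover have "F B (Complex.cnj \<zeta>) = Complex.cnj (F B \<zeta>)" for B \<zeta>
    by (simp add: F_def a_def b_def complex_eq_iff Jl algebra_simps)
  ultimately have 1: "strip_symmetric m (F B)" for B
    unfolding strip_symmetric_def by blast
  have e: "x = (\<Sum>B\<in>UNIV. x $ B *\<^sub>R axis B 1)" for x :: "real ^ 'k"
    by (simp add: vec_eq_iff axis_def if_distrib[of "\<lambda>x. _ * x"] cong: if_cong)
  have 2: "u \<zeta> = (\<Sum>B\<in>UNIV. Re (F B \<zeta>) *\<^sub>R axis B 1 + Im (F B \<zeta>) *\<^sub>R J (axis B 1))" for \<zeta>
  proof -
    have "J (b \<zeta>) = J (\<Sum>B\<in>UNIV. b \<zeta> $ B *\<^sub>R axis B 1)" using e by metis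
    then have "(\<Sum>B\<in>UNIV. Re (F B \<zeta>) *\<^sub>R axis B 1 + Im (F B \<zeta>) *\<^sub>R J (axis B 1)) = a \<zeta> + J (b \<zeta>)"
      using e[of "a \<zeta>"] by (simp add: F_def sum.distrib Jl)
    also have "\<dots> = u \<zeta>"
      unfolding a_def b_def Jl J(2) by (simp add: algebra_simps flip: scaleR_add_left)
    finally show ?thesis by simp
  qed
  \<comment> \<open>At real points \<open>b\<close> vanishes and F is the plain coordinate of
    \<open>u\<close>. This feeds the identity theorem for intrinsic functions.\<close>
  have 3: "F B (of_real x) = of_real (u (of_real x) $ B)" for B x
    by (simp add: F_def a_def b_def complex_eq_iff Jl)
  show ?thesis by (rule that[OF 1 2 3])
qed

text \<open>The slice variable stands on the left of the coefficients, which matches left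
  hyperholomorphy. Index set and coefficients are arbitrary, since a product of two representations
  is indexed by pairs.\<close>

definition left_rep :: "real \<Rightarrow> ('n::{finite,linorder}) para \<Rightarrow> ('n para \<Rightarrow> 'n cliff) \<Rightarrow> 'b set \<Rightarrow> ('b \<Rightarrow> complex \<Rightarrow> complex) \<Rightarrow> ('b \<Rightarrow> 'n cliff) \<Rightarrow> bool" where
  "left_rep m i f I F c \<longleftrightarrow> finite I \<and> (\<forall>k\<in>I. strip_symmetric m (F k)) \<and>
     (\<forall>\<zeta>. \<bar>Im \<zeta>\<bar> < m \<longrightarrow> f (slice i (exp \<zeta>)) = (\<Sum>k\<in>I. clmul (iota i (F k \<zeta>)) (c k)))"

definition right_rep :: "real \<Rightarrow> ('n::{finite,linorder}) para \<Rightarrow> ('n para \<Rightarrow> 'n cliff) \<Rightarrow> 'b set \<Rightarrow> ('b \<Rightarrow> complex \<Rightarrow> complex) \<Rightarrow> ('b \<Rightarrow> 'n cliff) \<Rightarrow> bool" where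
  "right_rep m i f I F c \<longleftrightarrow> finite I \<and> (\<forall>k\<in>I. strip_symmetric m (F k)) \<and>
     (\<forall>\<zeta>. \<bar>Im \<zeta>\<bar> < m \<longrightarrow> f (slice i (exp \<zeta>)) = (\<Sum>k\<in>I. clmul (c k) (iota i (F k \<zeta>))))"

text \<open>The map \<open>J\<close> is left or right multiplication by the slice unit, so both
  kinds of hyperholomorphy are treated at once.\<close>

lemma slice_exp_derivative:
  fixes f :: "('n::{finite,linorder}) para \<Rightarrow> 'n cliff"
  assumes J: "bounded_linear J" "\<And>x. J (J x) = - x"
    and f: "open U" "f differentiable_on U" "slice i (exp \<zeta>) \<in> U"
    and CR: "frechet_derivative f (at (slice i (exp \<zeta>))) pone + J (frechet_derivative f (at (slice i (exp \<zeta>))) i) = 0"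
  shows "\<exists>p. ((\<lambda>\<zeta>. f (slice i (exp \<zeta>))) has_derivative (\<lambda>h. Re h *\<^sub>R p + Im h *\<^sub>R J p)) (at \<zeta>)"
proof -
  define z where "z = exp \<zeta>"
  define A where "A = frechet_derivative f (at (slice i z))"
  have lJ: "linear J" using J(1) by (rule bounded_linear.linear)
  note Jl = linear_add[OF lJ] linear_diff[OF lJ] linear_scale[OF lJ] linear_neg[OF lJ]
  have "f differentiable (at (slice i z))"
    using f by (simp add: z_def differentiable_on_eq_differentiable_at)
  then have A: "(f has_derivative A) (at (slice i z))"
    unfolding A_def by (simp add: frechet_derivative_works)
  then have lA: "linear A" by (rule has_derivative_linear)
  have "J (A pone + J (A i)) = J 0" using CR by (simp add: A_def z_def)
  \<comment> \<open>Applying \<open>J\<close> to the Cauchy-Riemann equation solves it for the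
    derivative in direction i.\<close>
  then have Ai: "A i = J (A pone)"
    by (simp add: Jl J(2) linear_0[OF lJ])
  have "((\<lambda>\<zeta>. exp \<zeta>) has_derivative (\<lambda>h. z * h)) (at \<zeta>)"
    using DERIV_exp[of \<zeta>] by (simp add: has_field_derivative_def z_def)
  then have "((\<lambda>\<zeta>. slice i (exp \<zeta>)) has_derivative (\<lambda>h. slice i (z * h))) (at \<zeta>)"
    unfolding slice_def by (intro derivative_intros)
  from has_derivative_compose[OF this A[unfolded z_def]]
  have "((\<lambda>\<zeta>. f (slice i (exp \<zeta>))) has_derivative (\<lambda>h. A (slice i (z * h)))) (at \<zeta>)" .
  then have "((\<lambda>\<zeta>. f (slice i (exp \<zeta>))) has_derivative
     (\<lambda>h. Re h *\<^sub>R (Re z *\<^sub>R A pone + Im z *\<^sub>R J (A pone)) + Im h *\<^sub>R J (Re z *\<^sub>R A pone + Im z *\<^sub>R J (A pone)))) (at \<zeta>)"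
  proof (rule has_derivative_eq_rhs)
    have "A (slice i w) = Re w *\<^sub>R A pone + Im w *\<^sub>R J (A pone)" for w
      by (simp add: slice_def linear_add[OF lA] linear_scale[OF lA] Ai)
    then show "(\<lambda>h. A (slice i (z * h))) = (\<lambda>h. Re h *\<^sub>R (Re z *\<^sub>R A pone + Im z *\<^sub>R J (A pone)) + Im h *\<^sub>R J (Re z *\<^sub>R A pone + Im z *\<^sub>R J (A pone)))"
      by (simp add: Jl J(2) algebra_simps fun_eq_iff)
  qed
  then show ?thesis by blast
qed

lemma decay_strip:
  assumes "decay m f" "i \<in> sph" "m \<le> pi"
  obtains M \<alpha> where "M \<ge> 0" "\<alpha> > 0" "\<And>\<zeta>. \<bar>Im \<zeta>\<bar> < m \<Longrightarrow> norm (f (slice i (exp \<zeta>))) \<le> M * kap \<alpha> (Re \<zeta>)"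
proof -
  obtain \<alpha> c where \<alpha>: "\<alpha> > 0" "c > 0" and
    b: "\<And>s. s \<in> Sect0 m \<Longrightarrow> norm (f s) \<le> c * norm s powr \<alpha> / (1 + norm s powr (2 * \<alpha>))"
    using assms(1) unfolding decay_def by blast
  have "norm (f (slice i (exp \<zeta>))) \<le> c * kap \<alpha> (Re \<zeta>)" if "\<bar>Im \<zeta>\<bar> < m" for \<zeta>
    using b[OF slice_exp_in_Sect0[OF assms(2,3) that]] assms(2)
    by (simp add: norm_slice kap_def powr_def mult.assoc)
  with \<alpha> show ?thesis by (intro that[of c \<alpha>]) auto
qed

lemma right_mult_sph:
  fixes i :: "('n::{finite,linorder}) para"
  assumes "i \<in> sph"
  shows "bounded_linear (\<lambda>x. clmul x (pv i))" "clmul (clmul x (pv i)) (pv i) = - x"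
proof -
  show "bounded_linear (\<lambda>x. clmul x (pv i))"
    unfolding clmul_eq_lmul by (rule lmul.bounded_linear_left)
  have "clmul x (- cle {}) = - clmul x (cle {})" unfolding clmul_eq_lmul by (rule lmul.minus_right)
  then show "clmul (clmul x (pv i)) (pv i) = - x"
    by (simp add: clmul_assoc pv_sph_square[OF assms])
qed

lemma left_mult_sph:
  fixes i :: "('n::{finite,linorder}) para"
  assumes "i \<in> sph"
  shows "bounded_linear (\<lambda>x. clmul (pv i) x)" "clmul (pv i) (clmul (pv i) x) = - x"
  using lmul_pv_sph_twice[OF assms, of x] unfolding clmul_eq_lmul by (auto intro: lmul.bounded_linear_right)

lemma slice_sh_decomposition:
  fixes f :: "('n::{finite,linorder}) para \<Rightarrow> 'n cliff"
  assumes i: "i \<in> sph" and m: "m \<le> pi" and dec: "decay m f"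
    and J: "bounded_linear J" "\<And>x. J (J x) = - x"
    and f: "open (Sect0 m :: 'n para set)" "f differentiable_on Sect0 m"
    and CR: "\<And>x. x \<in> Sect0 m \<Longrightarrow> x \<in> Ci i \<Longrightarrow> (1/2) *\<^sub>R (frechet_derivative f (at x) pone + J (frechet_derivative f (at x) i)) = 0"
  obtains F where "\<And>B. strip_symmetric m (F B)"
    "\<And>\<zeta>. \<bar>Im \<zeta>\<bar> < m \<Longrightarrow> f (slice i (exp \<zeta>)) = (\<Sum>B\<in>UNIV. Re (F B \<zeta>) *\<^sub>R cle B + Im (F B \<zeta>) *\<^sub>R J (cle B))"
    "\<And>B x. F B (of_real x) = of_real (f (slice i (exp (of_real x))) $ B)"
proof -
  obtain M \<alpha> where "M \<ge> 0" "\<alpha> > 0" and bd: "\<And>\<zeta>. \<bar>Im \<zeta>\<bar> < m \<Longrightarrow> norm (f (slice i (exp \<zeta>))) \<le> M * kap \<alpha> (Re \<zeta>)"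
    using decay_strip[OF dec i m] by blast
  have der: "\<exists>p. ((\<lambda>\<zeta>. f (slice i (exp \<zeta>))) has_derivative (\<lambda>h. Re h *\<^sub>R p + Im h *\<^sub>R J p)) (at \<zeta>)" if "\<bar>Im \<zeta>\<bar> < m" for \<zeta>
    using slice_exp_in_Sect0[OF i m that] CR slice_in_Ci[of i]
    by (intro slice_exp_derivative[OF J f]) auto
  show ?thesis
    using symmetric_decomposition[OF J der bd \<open>\<alpha> > 0\<close> \<open>M \<ge> 0\<close>] that by blast
qed

lemma PsiL_left_rep:
  assumes "PsiL m f" "i \<in> sph" "m \<le> pi"
  obtains F where "left_rep m i f UNIV F cle"
proof -
  have f: "open (Sect0 m :: 'a para set)" "f differentiable_on Sect0 m" "decay m f"
    using assms(1) by (auto simp: PsiL_def left_sh_def)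
  obtain F where F: "\<And>B. strip_symmetric m (F B)"
    "\<And>\<zeta>. \<bar>Im \<zeta>\<bar> < m \<Longrightarrow> f (slice i (exp \<zeta>)) = (\<Sum>B\<in>UNIV. Re (F B \<zeta>) *\<^sub>R cle B + Im (F B \<zeta>) *\<^sub>R clmul (pv i) (cle B))"
  proof (rule slice_sh_decomposition[OF assms(2,3) f(3) left_mult_sph[OF assms(2)] f(1,2)])
    show "(1/2) *\<^sub>R (frechet_derivative f (at x) pone + clmul (pv i) (frechet_derivative f (at x) i)) = 0"
      if "x \<in> Sect0 m" "x \<in> Ci i" for x
      using assms(1,2) that by (simp add: PsiL_def left_sh_def)
  qed (rule that)
  have "left_rep m i f UNIV F cle"
    unfolding left_rep_def using F by (simp add: clmul_eq_lmul lmul_iota)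
  then show ?thesis by (rule that)
qed

lemma PsiR_right_rep:
  assumes "PsiR m f" "i \<in> sph" "m \<le> pi"
  obtains F where "right_rep m i f UNIV F cle"
proof -
  have f: "open (Sect0 m :: 'a para set)" "f differentiable_on Sect0 m" "decay m f"
    using assms(1) by (auto simp: PsiR_def right_sh_def)
  obtain F where F: "\<And>B. strip_symmetric m (F B)"
    "\<And>\<zeta>. \<bar>Im \<zeta>\<bar> < m \<Longrightarrow> f (slice i (exp \<zeta>)) = (\<Sum>B\<in>UNIV. Re (F B \<zeta>) *\<^sub>R cle B + Im (F B \<zeta>) *\<^sub>R clmul (cle B) (pv i))"
  proof (rule slice_sh_decomposition[OF assms(2,3) f(3) right_mult_sph[OF assms(2)] f(1,2)])
    show "(1/2) *\<^sub>R (frechet_derivative f (at x) pone + clmul (frechet_derivative f (at x) i) (pv i)) = 0"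
      if "x \<in> Sect0 m" "x \<in> Ci i" for x
      using assms(1,2) that by (simp add: PsiR_def right_sh_def)
  qed (rule that)
  have "clmul a (iota i z) = Re z *\<^sub>R a + Im z *\<^sub>R clmul a (pv i)" for a z
    using clmul_one_right[of a] by (simp add: iota_def clmul_eq_lmul lmul.add_right lmul.scaleR_right)
  then have "right_rep m i f UNIV F cle"
    unfolding right_rep_def using F by simp
  then show ?thesis by (rule that)
qed

text \<open>For \<open>n = 1\<close> the algebra is commutative and intrinsic functions need not be real on the real line.
For \<open>n > 1\<close> the values on the real axis lie in the intersection of all the planes \<open>\<complex>\<^sub>j\<close>, hence are real, and the
identity theorem leaves only the component of index \<open>{}\<close>.\<close>

lemma Psi_rep:
  fixes f :: "('n::{finite,linorder}) para \<Rightarrow> 'n cliff"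
  assumes f: "Psi m f" and i: "i \<in> sph" and m: "0 < m" "m \<le> pi"
  obtains I F where "left_rep m i f I F cle" "right_rep m i f I F cle" "\<And>B. B \<in> I \<Longrightarrow> CARD('n) = 1 \<or> B = {}"
proof (cases "CARD('n) = 1")
  case True
  have lr: "left_rep m i f I F c \<longleftrightarrow> right_rep m i f I F c" for I :: "'n set set" and F c
    by (simp add: left_rep_def right_rep_def clmul_commute[OF True])
  \<comment> \<open>Whichever side holds, commutativity makes the left and the right representation
    the same.\<close>
  from f have "PsiL m f \<or> PsiR m f" by (auto simp: Psi_def intrinsic_def PsiL_def PsiR_def)
  then obtain F where "left_rep m i f UNIV F cle"
    using PsiL_left_rep[OF _ i m(2)] PsiR_right_rep[OF _ i m(2)] lr by metis
  then show ?thesis using lr True by (intro that) auto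
next
  case False
  have in_C: "f ` (Sect0 m \<inter> Ci j) \<subseteq> pv ` Ci j" if "j \<in> sph" for j
    using f that by (auto simp: Psi_def intrinsic_def)
  have real: "f (slice i (exp (of_real x))) $ B = 0" if "B \<noteq> {}" for x B
  proof -
    \<comment> \<open>With at least two generators some k has B different from {k}. Elements of the
      plane of e_k then have no component at the nonempty index B.\<close>
    have ex: "\<exists>k. B \<noteq> {k}" 
    proof (rule ccontr)
      assume "\<nexists>k. B \<noteq> {k}"
      then have "\<And>j k :: 'n. j = k" by auto
      then have "\<exists>k. (UNIV :: 'n set) = {k}" by blast
      then show False using False by (simp add: card_1_singleton_iff)
    qed
    then obtain k where k: "B \<noteq> {k}" by blast
    define j :: "'n para" where "j = axis (Some k) 1"
    have j: "j \<in> sph" by (simp add: sph_def j_def axis_def[of _ _] norm_axis_1 flip: axis_def) (simp add: axis_def)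
    \<comment> \<open>Real points belong to every slice, so the value condition may be used for the
      unit e_k in place of i.\<close>
    have "slice i (exp (of_real x)) = slice j (exp (of_real x))"
      by (simp add: slice_def Im_exp)
    then have "f (slice i (exp (of_real x))) \<in> pv ` Ci j"
      using in_C[OF j] slice_exp_in_Sect0[OF j m(2), of "of_real x"] slice_in_Ci[of j] m(1) by auto
    then obtain a b where "f (slice i (exp (of_real x))) = pv (a *\<^sub>R pone + b *\<^sub>R j)"
      by (auto simp: Ci_def)
    moreover have "pv (a *\<^sub>R pone + b *\<^sub>R j) $ B = 0"
      using that k by (auto simp: pv_def pone_def j_def axis_def card_1_singleton_iff)
    ultimately show ?thesis by simp
  qed
  have dec: "decay m f" using f by (simp add: Psi_def)
  have "left_sh (Sect0 m) f \<or> right_sh (Sect0 m) f" using f by (simp add: Psi_def intrinsic_def)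
  \<comment> \<open>Left and right multiplication by i agree on 1, and only this value of J matters
    once all components of nonempty index are gone.\<close>
  then obtain J F where J1: "J (cle {}) = pv i" and F: "\<And>B. strip_symmetric m (F B)"
    "\<And>\<zeta>. \<bar>Im \<zeta>\<bar> < m \<Longrightarrow> f (slice i (exp \<zeta>)) = (\<Sum>B\<in>UNIV. Re (F B \<zeta>) *\<^sub>R cle B + Im (F B \<zeta>) *\<^sub>R J (cle B))"
    "\<And>B x. F B (of_real x) = of_real (f (slice i (exp (of_real x))) $ B)"
  proof
    assume l: "left_sh (Sect0 m) f"
    have U: "open (Sect0 m :: 'n para set)" "f differentiable_on Sect0 m" using l by (simp_all add: left_sh_def)
    obtain F where "\<And>B. strip_symmetric m (F B)"
      "\<And>\<zeta>. \<bar>Im \<zeta>\<bar> < m \<Longrightarrow> f (slice i (exp \<zeta>)) = (\<Sum>B\<in>UNIV. Re (F B \<zeta>) *\<^sub>R cle B + Im (F B \<zeta>) *\<^sub>R clmul (pv i) (cle B))"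
      "\<And>B x. F B (of_real x) = of_real (f (slice i (exp (of_real x))) $ B)"
    proof (rule slice_sh_decomposition[OF i m(2) dec left_mult_sph[OF i] U])
      show "(1/2) *\<^sub>R (frechet_derivative f (at x) pone + clmul (pv i) (frechet_derivative f (at x) i)) = 0"
        if "x \<in> Sect0 m" "x \<in> Ci i" for x
        using l i that by (simp add: left_sh_def)
    qed (rule that)
    then show thesis by (intro that[of "clmul (pv i)" F]) simp_all
  next
    assume r: "right_sh (Sect0 m) f"
    have U: "open (Sect0 m :: 'n para set)" "f differentiable_on Sect0 m" using r by (simp_all add: right_sh_def)
    obtain F where "\<And>B. strip_symmetric m (F B)"
      "\<And>\<zeta>. \<bar>Im \<zeta>\<bar> < m \<Longrightarrow> f (slice i (exp \<zeta>)) = (\<Sum>B\<in>UNIV. Re (F B \<zeta>) *\<^sub>R cle B + Im (F B \<zeta>) *\<^sub>R clmul (cle B) (pv i))"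
      "\<And>B x. F B (of_real x) = of_real (f (slice i (exp (of_real x))) $ B)"
    proof (rule slice_sh_decomposition[OF i m(2) dec right_mult_sph[OF i] U])
      show "(1/2) *\<^sub>R (frechet_derivative f (at x) pone + clmul (frechet_derivative f (at x) i) (pv i)) = 0"
        if "x \<in> Sect0 m" "x \<in> Ci i" for x
        using r i that by (simp add: right_sh_def)
    qed (rule that)
    then show thesis by (intro that[of "\<lambda>x. clmul x (pv i)" F]) simp_all
  qed
  have z: "F B \<zeta> = 0" if "B \<noteq> {}" "\<bar>Im \<zeta>\<bar> < m" for B \<zeta>
  proof (rule analytic_continuation[of "F B" "{z. \<bar>Im z\<bar> < m}" "range of_real" 0])
    show "F B holomorphic_on {z. \<bar>Im z\<bar> < m}" using F(1) by (auto simp: strip_symmetric_def strip_bounded_def)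
    show "connected {z. \<bar>Im z\<bar> < m}" by (rule convex_connected[OF convex_strip])
    show "F B z = 0" if "z \<in> range of_real" for z
      using that F(3)[of B] real[OF \<open>B \<noteq> {}\<close>] by auto
    show "(0::complex) islimpt range of_real"
      unfolding islimpt_approachable
    proof (intro allI impI)
      fix e :: real assume "e > 0"
      then show "\<exists>x'\<in>range of_real. x' \<noteq> (0::complex) \<and> dist x' 0 < e"
        by (intro bexI[of _ "of_real (e/2)"] conjI rangeI) auto
    qed
  qed (use that m open_strip in auto)
  have e: "f (slice i (exp \<zeta>)) = iota i (F {} \<zeta>)" if "\<bar>Im \<zeta>\<bar> < m" for \<zeta>
  proof -
    have "f (slice i (exp \<zeta>)) = (\<Sum>B\<in>(UNIV :: 'n set set). if B = {} then iota i (F {} \<zeta>) else 0)"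
      unfolding F(2)[OF that] by (rule sum.cong) (use z[OF _ that] in \<open>auto simp: iota_def J1\<close>)
    then show ?thesis by simp
  qed
  show ?thesis
  proof (rule that)
    show "left_rep m i f {{}} F cle" "right_rep m i f {{}} F cle"
      using F(1) e by (simp_all add: left_rep_def right_rep_def)
  qed auto
qed

section \<open>The S-functional calculus\<close>

locale sectorial_operator = paravector_operator D Top
  for D :: "'n::{finite,linorder} option \<Rightarrow> 'v::banach set" and Top :: "'n option \<Rightarrow> 'v \<Rightarrow> 'v" +
  fixes \<omega> \<mu> :: real
  assumes \<omega>: "0 \<le> \<omega>" "\<omega> < \<mu>" and \<mu>: "\<mu> \<le> pi" and type: "type_op \<omega> D Top"
begin

sublocale T: closed_operator "opT Top" "opdom D :: ('v, 'n) modn set"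
  using type by unfold_locales (simp_all add: subspace_opdom opT_add opT_scaleR type_op_def op_closed_def)

text \<open>The inverse depends on s only through its real part and its norm. Equality of the
  predicates makes the operator selected by \<open>Qs\<close> literally the same at conjugate
  points.\<close>

lemma is_Qs_cong:
  assumes "s $ None = s' $ None" "norm s = norm s'"
  shows "is_Qs D Top s = is_Qs D Top s'"
proof -
  have "Pop Top s = Pop Top s'"
    unfolding Pop_def assms ..
  from arg_cong[where f = "\<lambda>p Q. bounded_linear Q \<and> rmod_hom Q \<and>
      (\<forall>w. Q w \<in> opdom2 D Top \<and> p (Q w) = w) \<and> (\<forall>v\<in>opdom2 D Top. Q (p v) = v)", OF this]
  show ?thesis
    unfolding is_Qs_def[abs_def] .
qed

lemma is_Qs_pseudo_resolvent:
  assumes "is_Qs D Top s Q" "s $ None = Re z" "norm s = norm z"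
  shows "T.pseudo_resolvent z Q"
proof -
  have "Pop Top s v = T.quad z v" for v
    using assms(2,3) by (simp add: Pop_def T.quad_def)
  moreover have "v \<in> opdom2 D Top \<longleftrightarrow> v \<in> opdom D \<and> opT Top v \<in> opdom D" for v
    by (simp add: opdom2_def)
  ultimately show ?thesis
    using assms(1) unfolding is_Qs_def T.pseudo_resolvent_def by metis
qed

end

locale sectorial_operator_slice = sectorial_operator D Top \<omega> \<mu>
  for D :: "'n::{finite,linorder} option \<Rightarrow> 'v::banach set" and Top :: "'n option \<Rightarrow> 'v \<Rightarrow> 'v" and \<omega> \<mu> :: real +
  fixes i :: "'n para"
  assumes i: "i \<in> sph"
begin

abbreviation Qz :: "complex \<Rightarrow> ('v, 'n) modn \<Rightarrow> ('v, 'n) modn" where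
  "Qz z \<equiv> Qs D Top (slice i z)"

text \<open>With \<open>Bres\<close>, the real operators in (cnj z - T) Q = A - iB. Here i is the
  scalar unit of the complexification, not a Clifford unit.\<close>

definition Ares :: "complex \<Rightarrow> ('v, 'n) modn \<Rightarrow> ('v, 'n) modn" where
  "Ares z v = Re z *\<^sub>R Qz z v - opT Top (Qz z v)"

definition Bres :: "complex \<Rightarrow> ('v, 'n) modn \<Rightarrow> ('v, 'n) modn" where
  "Bres z v = Im z *\<^sub>R Qz z v"

lemma Qz_cnj: "Qz (Complex.cnj z) = Qz z"
proof -
  have "is_Qs D Top (slice i (Complex.cnj z)) = is_Qs D Top (slice i z)"
    using i by (intro is_Qs_cong) (simp_all add: slice_None norm_slice)
  then show ?thesis by (simp add: Qs_def)
qed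

lemma is_Qs_Qz:
  assumes "\<omega> < \<bar>Im \<zeta>\<bar>" "\<bar>Im \<zeta>\<bar> \<le> pi"
  shows "is_Qs D Top (slice i (exp \<zeta>)) (Qz (exp \<zeta>))"
proof -
  have "slice i (exp \<zeta>) \<notin> Sect \<omega>"
    using assms i by (simp add: Sect_def slice_exp_neq_0 parg_slice_exp)
  then have "slice i (exp \<zeta>) \<in> rhoS D Top"
    using type by (auto simp: type_op_def sigmaS_def)
  then obtain Q where "is_Qs D Top (slice i (exp \<zeta>)) Q"
    by (auto simp: rhoS_def)
  then show ?thesis
    unfolding Qs_def by (rule someI[of "is_Qs D Top (slice i (exp \<zeta>))"])
qed

lemma pseudo_resolvent_Qz:
  "\<omega> < \<bar>Im \<zeta>\<bar> \<Longrightarrow> \<bar>Im \<zeta>\<bar> \<le> pi \<Longrightarrow> T.pseudo_resolvent (exp \<zeta>) (Qz (exp \<zeta>))"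
  using i by (intro is_Qs_pseudo_resolvent[OF is_Qs_Qz]) (simp_all add: slice_None norm_slice)

lemma resolv_eq: "T.resolv (Qz z) z p = (Ares z (fst p) + Bres z (snd p), Ares z (snd p) - Bres z (fst p))"
  by (simp add: T.resolv_def csc_def Ares_def Bres_def algebra_simps)

text \<open>With J left multiplication by the unit i, the two S-resolvents are A - BJ and A - JB.
  They replace the scalar unit in A - iB by J, placed before or after B, which need not commute with
  J.\<close>

lemma
  assumes z: "T.pseudo_resolvent z (Qz z)"
  shows SLinv_slice: "\<And>v. SLinv D Top (slice i z) v = Ares z v - Bres z (lmul (pv i) v)"
    and SRinv_slice: "\<And>v. SRinv D Top (slice i z) v = Ares z v - lmul (pv i) (Bres z v)"
    and SLinv_cnj: "\<And>v. SLinv D Top (slice i (Complex.cnj z)) v = Ares z v + Bres z (lmul (pv i) v)"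
    and bounded_linear_Ares: "bounded_linear (Ares z)"
    and bounded_linear_Bres: "bounded_linear (Bres z)"
    and bounded_linear_SLinv: "bounded_linear (SLinv D Top (slice i z))"
    and bounded_linear_SLinv_cnj: "bounded_linear (SLinv D Top (slice i (Complex.cnj z)))"
proof -
  note Q = T.Q_add[OF z] T.Q_diff[OF z] T.Q_scale[OF z]
  show S: "SLinv D Top (slice i z) v = Ares z v - Bres z (lmul (pv i) v)" for v
  proof -
    have "lmul (pv (Defs.cnj (slice i z))) v = Re z *\<^sub>R v - Im z *\<^sub>R lmul (pv i) v"
      by (simp add: cnj_slice[OF i] pv_slice lmul_iota)
    then show ?thesis by (simp add: SLinv_def Q Ares_def Bres_def)
  qed
  show S': "SLinv D Top (slice i (Complex.cnj z)) v = Ares z v + Bres z (lmul (pv i) v)" for v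
  proof -
    have "lmul (pv (Defs.cnj (slice i (Complex.cnj z)))) v = Re z *\<^sub>R v + Im z *\<^sub>R lmul (pv i) v"
      by (simp add: cnj_slice[OF i] pv_slice lmul_iota)
    then show ?thesis by (simp add: SLinv_def Qz_cnj Q Ares_def Bres_def)
  qed
  show "SRinv D Top (slice i z) v = Ares z v - lmul (pv i) (Bres z v)" for v
    by (simp add: SRinv_def cnj_slice[OF i] pv_slice lmul_iota Ares_def Bres_def lmul.scaleR_right)
  show A: "bounded_linear (Ares z)"
    unfolding Ares_def[abs_def]
    by (intro bounded_linear_sub bounded_linear_compose[OF bounded_linear_scaleR_right] T.bounded_linear_Q[OF z] T.bounded_linear_TQ[OF z])
  show B: "bounded_linear (Bres z)"
    unfolding Bres_def[abs_def]
    by (intro bounded_linear_compose[OF bounded_linear_scaleR_right] T.bounded_linear_Q[OF z])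
  have BJ: "bounded_linear (\<lambda>v. Bres z (lmul (pv i) v))"
    by (rule bounded_linear_compose[OF B lmul.bounded_linear_right])
  show "bounded_linear (SLinv D Top (slice i z))" "bounded_linear (SLinv D Top (slice i (Complex.cnj z)))"
    unfolding S[abs_def] S'[abs_def] by (intro bounded_linear_sub bounded_linear_add A BJ)+
qed

definition Kres :: "complex \<Rightarrow> ('v, 'n) modn \<times> ('v, 'n) modn \<Rightarrow> ('v, 'n) modn \<times> ('v, 'n) modn" where
  "Kres \<zeta> p = csc (exp \<zeta>) (T.resolv (Qz (exp \<zeta>)) (exp \<zeta>) p)"

text \<open>The real and imaginary parts of the resolvent are half the sum and difference of
\<open>S\<^sub>L\<^sup>-\<^sup>1\<close> at \<open>s\<close> and at its conjugate, up to multiplication by \<open>i\<close>.\<close>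

lemma resolvent_bounds:
  assumes w: "\<omega> < w" "w \<le> pi"
  obtains c where "c \<ge> 0"
    "\<And>\<zeta> v. w < \<bar>Im \<zeta>\<bar> \<Longrightarrow> \<bar>Im \<zeta>\<bar> \<le> pi \<Longrightarrow> norm (Ares (exp \<zeta>) v) \<le> c / norm (exp \<zeta>) * norm v"
    "\<And>\<zeta> v. w < \<bar>Im \<zeta>\<bar> \<Longrightarrow> \<bar>Im \<zeta>\<bar> \<le> pi \<Longrightarrow> norm (Bres (exp \<zeta>) v) \<le> c / norm (exp \<zeta>) * norm v"
proof -
  from type w obtain C where C: "\<And>s. s \<noteq> 0 \<Longrightarrow> s \<notin> Sect w \<Longrightarrow> onorm (SLinv D Top s) \<le> C / norm s"
    unfolding type_op_def by blast
  obtain L where L: "L > 0" "\<And>v :: ('v, 'n) modn. norm (lmul (pv i) v) \<le> norm v * L"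
    using bounded_linear.pos_bounded[OF lmul.bounded_linear_right, of "pv i"] by blast
  define C' where "C' = max C 0"
  have b: "norm (Ares (exp \<zeta>) v) \<le> C' / norm (exp \<zeta>) * norm v" "norm (Bres (exp \<zeta>) v) \<le> C' * L / norm (exp \<zeta>) * norm v"
    if \<zeta>: "w < \<bar>Im \<zeta>\<bar>" "\<bar>Im \<zeta>\<bar> \<le> pi" for \<zeta> v
  proof -
    define z where "z = exp \<zeta>"
    have z: "T.pseudo_resolvent z (Qz z)"
      unfolding z_def using \<zeta> w by (intro pseudo_resolvent_Qz) auto
    have n: "slice i (exp \<zeta>') \<noteq> 0" "slice i (exp \<zeta>') \<notin> Sect w" if "\<bar>Im \<zeta>'\<bar> = \<bar>Im \<zeta>\<bar>" for \<zeta>'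
      using \<zeta> that i by (simp_all add: Sect_def slice_exp_neq_0 parg_slice_exp)
    have o: "onorm (SLinv D Top (slice i z)) \<le> C' / norm z" "onorm (SLinv D Top (slice i (Complex.cnj z))) \<le> C' / norm z"
    proof -
      have "C / norm z \<le> C' / norm z" by (intro divide_right_mono) (auto simp: C'_def)
      moreover have "onorm (SLinv D Top (slice i z)) \<le> C / norm z"
        using C[OF n[of \<zeta>]] i by (simp add: norm_slice z_def)
      moreover have "onorm (SLinv D Top (slice i (Complex.cnj z))) \<le> C / norm z"
        using C[OF n[of "Complex.cnj \<zeta>"]] i by (simp add: norm_slice z_def exp_cnj[symmetric])
      ultimately show "onorm (SLinv D Top (slice i z)) \<le> C' / norm z" "onorm (SLinv D Top (slice i (Complex.cnj z))) \<le> C' / norm z"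
        by linarith+
    qed
    have S: "norm (SLinv D Top (slice i z) u) \<le> C' / norm z * norm u" "norm (SLinv D Top (slice i (Complex.cnj z)) u) \<le> C' / norm z * norm u" for u
      using order_trans[OF onorm[OF bounded_linear_SLinv[OF z], of u] mult_right_mono[OF o(1) norm_ge_zero]]
        order_trans[OF onorm[OF bounded_linear_SLinv_cnj[OF z], of u] mult_right_mono[OF o(2) norm_ge_zero]] by auto
    have "2 *\<^sub>R Ares z v = SLinv D Top (slice i z) v + SLinv D Top (slice i (Complex.cnj z)) v"
      by (simp add: SLinv_slice[OF z] SLinv_cnj[OF z] scaleR_2)
    then have "2 * norm (Ares z v) = norm (SLinv D Top (slice i z) v + SLinv D Top (slice i (Complex.cnj z)) v)"
      by (metis norm_scaleR abs_numeral)
    also have "\<dots> \<le> C' / norm z * norm v + C' / norm z * norm v"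
      by (intro order_trans[OF norm_triangle_ineq] add_mono S)
    finally show "norm (Ares (exp \<zeta>) v) \<le> C' / norm (exp \<zeta>) * norm v" by (simp add: z_def)
    \<comment> \<open>With u = J v one gets B J u = -B v, so the difference of the S-resolvents at
      conjugate points, applied to u, isolates 2 B v.\<close>
    define u where "u = lmul (pv i) v"
    have "Bres z (lmul (pv i) u) = - Bres z v"
      using bounded_linear_Bres[OF z] i by (simp add: u_def lmul_pv_sph_twice linear_neg[OF bounded_linear.linear])
    then have "2 *\<^sub>R Bres z v = SLinv D Top (slice i z) u - SLinv D Top (slice i (Complex.cnj z)) u"
      by (simp add: SLinv_slice[OF z] SLinv_cnj[OF z] scaleR_2)
    then have "2 * norm (Bres z v) = norm (SLinv D Top (slice i z) u - SLinv D Top (slice i (Complex.cnj z)) u)"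
      by (metis norm_scaleR abs_numeral)
    also have "\<dots> \<le> C' / norm z * norm u + C' / norm z * norm u"
      by (intro order_trans[OF norm_triangle_ineq4] add_mono S)
    also have "\<dots> = 2 * (C' / norm z * norm u)" by simp
    also have "\<dots> \<le> 2 * (C' / norm z * (norm v * L))"
      unfolding u_def by (intro mult_left_mono L) (auto simp: C'_def)
    finally have "norm (Bres z v) \<le> C' / norm z * (norm v * L)" by linarith
    then show "norm (Bres (exp \<zeta>) v) \<le> C' * L / norm (exp \<zeta>) * norm v" by (simp add: z_def mult_ac)
  qed
  have C0: "0 \<le> C'" "0 \<le> C' * L" using L(1) by (auto simp: C'_def)
  have m: "C' / norm (exp \<zeta>) * norm v \<le> (C' + C' * L) / norm (exp \<zeta>) * norm v"
    "C' * L / norm (exp \<zeta>) * norm v \<le> (C' + C' * L) / norm (exp \<zeta>) * norm v" for \<zeta> :: complex and v :: "('v, 'n) modn"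
    using C0 by (auto intro!: mult_right_mono divide_right_mono)
  show ?thesis
    using C0 by (intro that[of "C' + C' * L"] order_trans[OF b(1) m(1)] order_trans[OF b(2) m(2)]) auto
qed

text \<open>The type condition gives a uniform constant only off a sector strictly larger than that
  of angle \<open>\<omega>\<close>, hence the intermediate \<open>w\<close>.\<close>

lemma strip_resolvent_Kres:
  assumes w: "\<omega> < w" "w < \<mu>"
  shows "\<exists>C. strip_resolvent Kres w \<mu> C"
proof -
  have "w \<le> pi" using w \<mu> by simp
  then obtain c where c: "c \<ge> 0"
    "\<And>\<zeta> v. w < \<bar>Im \<zeta>\<bar> \<Longrightarrow> \<bar>Im \<zeta>\<bar> \<le> pi \<Longrightarrow> norm (Ares (exp \<zeta>) v) \<le> c / norm (exp \<zeta>) * norm v"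
    "\<And>\<zeta> v. w < \<bar>Im \<zeta>\<bar> \<Longrightarrow> \<bar>Im \<zeta>\<bar> \<le> pi \<Longrightarrow> norm (Bres (exp \<zeta>) v) \<le> c / norm (exp \<zeta>) * norm v"
    using resolvent_bounds[OF w(1)] by metis
  \<comment> \<open>The 8 is 4 from \<open>T.norm_resolv_le\<close> times 2 from
    \<open>norm_csc_le\<close>.\<close>
  have "strip_resolvent Kres w \<mu> (8 * c)"
  proof
    show "0 \<le> w" "w < \<mu>" "\<mu> \<le> pi" using w \<omega> \<mu> by auto
    fix \<zeta> :: complex assume \<zeta>: "w < \<bar>Im \<zeta>\<bar>" "\<bar>Im \<zeta>\<bar> < \<mu>"
    have z: "T.pseudo_resolvent (exp \<zeta>) (Qz (exp \<zeta>))"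
      using \<zeta> w \<mu> by (intro pseudo_resolvent_Qz) auto
    show "Kres \<zeta> (x + y) = Kres \<zeta> x + Kres \<zeta> y" for x y
      by (simp add: Kres_def T.resolv_add[OF z] csc.add_right)
    show "Kres \<zeta> (csc a x) = csc a (Kres \<zeta> x)" for a x
      by (simp add: Kres_def T.resolv_csc[OF z] csc_csc mult.commute)
    show "norm (Kres \<zeta> x) \<le> 8 * c * norm x" for x
    proof -
      have "norm (T.resolv (Qz (exp \<zeta>)) (exp \<zeta>) x) \<le> 4 * (c / norm (exp \<zeta>)) * norm x"
      proof (rule T.norm_resolv_le[OF z])
        show "0 \<le> c / norm (exp \<zeta>)" using c by simp
      qed (unfold Ares_def[symmetric] Bres_def[symmetric], use c \<zeta> \<mu> in auto)
      then have "2 * norm (exp \<zeta>) * norm (T.resolv (Qz (exp \<zeta>)) (exp \<zeta>) x) \<le> 2 * norm (exp \<zeta>) * (4 * (c / norm (exp \<zeta>)) * norm x)"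
        by (intro mult_left_mono) auto
      then show ?thesis
        unfolding Kres_def by (intro order_trans[OF norm_csc_le]) simp
    qed
    fix \<eta> :: complex and x assume \<eta>: "w < \<bar>Im \<eta>\<bar>" "\<bar>Im \<eta>\<bar> < \<mu>"
    have z': "T.pseudo_resolvent (exp \<eta>) (Qz (exp \<eta>))"
      using \<eta> w \<mu> by (intro pseudo_resolvent_Qz) auto
    let ?z = "exp \<zeta>" and ?w = "exp \<eta>"
    let ?Rz = "T.resolv (Qz ?z) ?z" and ?Rw = "T.resolv (Qz ?w) ?w"
    have "Kres \<zeta> x = csc ?z (?Rw x) + csc (?z * (?w - ?z)) (?Rz (?Rw x))"
      unfolding Kres_def by (subst T.resolv_identity[OF z z']) (simp add: csc.add_right csc_csc)
    also have "csc ?z (?Rw x) = csc (exp (\<zeta> - \<eta>)) (Kres \<eta> x)"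
      by (simp add: Kres_def csc_csc flip: exp_add)
    also have "csc (?z * (?w - ?z)) (?Rz (?Rw x)) = csc (1 - exp (\<zeta> - \<eta>)) (Kres \<zeta> (Kres \<eta> x))"
    proof -
      \<comment> \<open>The resolvent identity multiplied by z: the factor z (w - z) is (1 - z/w) z
        w, and z, w are absorbed into the two operators.\<close>
      have "(1 - exp (\<zeta> - \<eta>)) * (?z * ?w) = ?z * (?w - ?z)"
        by (simp add: exp_diff field_simps)
      then show ?thesis
        by (simp only: Kres_def T.resolv_csc[OF z] csc_csc mult.assoc)
    qed
    finally show "Kres \<zeta> x = csc (exp (\<zeta> - \<eta>)) (Kres \<eta> x) + csc (1 - exp (\<zeta> - \<eta>)) (Kres \<zeta> (Kres \<eta> x))" .
  qed
  then show ?thesis by blast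
qed

text \<open>Expanding (A - BJ)(a + bJ) y and collecting the terms without and with J. The unit ends
  up inside the argument, and the factor \<open>exp \<zeta>\<close> of the line element is absorbed
  into \<open>Kres\<close>.\<close>

lemma SLinv_iota:
  assumes \<zeta>: "\<omega> < \<bar>Im \<zeta>\<bar>" "\<bar>Im \<zeta>\<bar> \<le> pi"
  shows "SLinv D Top (slice i (exp \<zeta>)) (lmul (iota i (exp \<zeta> * c)) y)
     = fst (csc c (Kres \<zeta> (y, 0))) + snd (csc c (Kres \<zeta> (lmul (pv i) y, 0)))"
proof -
  define z where "z = exp \<zeta>"
  have z: "T.pseudo_resolvent z (Qz z)" unfolding z_def by (rule pseudo_resolvent_Qz[OF \<zeta>])
  have A: "linear (Ares z)" and B: "linear (Bres z)"
    using bounded_linear_Ares[OF z] bounded_linear_Bres[OF z] by (simp_all add: bounded_linear.linear)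
  note l = linear_add[OF A] linear_scale[OF A] linear_0[OF A] linear_add[OF B] linear_scale[OF B] linear_0[OF B] linear_neg[OF B]
    linear_diff[OF A] linear_diff[OF B]
  have J: "lmul (pv i) (lmul (pv i) y) = - y" by (rule lmul_pv_sph_twice[OF i])
  have "SLinv D Top (slice i z) (lmul (iota i d) y)
    = fst (csc d (T.resolv (Qz z) z (y, 0))) + snd (csc d (T.resolv (Qz z) z (lmul (pv i) y, 0)))" for d
    unfolding SLinv_slice[OF z] lmul_iota resolv_eq
    by (simp add: l J lmul.add_right lmul.scaleR_right csc_def)
  then show ?thesis by (simp add: z_def Kres_def csc_csc mult.commute)
qed

text \<open>Mirror image of the left case: in (a + bJ)(A - JB) y the unit ends up outside the
  operator.\<close>

lemma SRinv_iota:
  assumes \<zeta>: "\<omega> < \<bar>Im \<zeta>\<bar>" "\<bar>Im \<zeta>\<bar> \<le> pi"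
  shows "lmul (iota i (exp \<zeta> * c)) (SRinv D Top (slice i (exp \<zeta>)) y)
     = fst (csc c (Kres \<zeta> (y, 0))) + lmul (pv i) (snd (csc c (Kres \<zeta> (y, 0))))"
proof -
  define z where "z = exp \<zeta>"
  have z: "T.pseudo_resolvent z (Qz z)" unfolding z_def by (rule pseudo_resolvent_Qz[OF \<zeta>])
  have A: "linear (Ares z)" and B: "linear (Bres z)"
    using bounded_linear_Ares[OF z] bounded_linear_Bres[OF z] by (simp_all add: bounded_linear.linear)
  note l = linear_0[OF A] linear_0[OF B]
  have J: "lmul (pv i) (lmul (pv i) u) = - u" for u :: "('v, 'n) modn" by (rule lmul_pv_sph_twice[OF i])
  have "lmul (iota i d) (SRinv D Top (slice i z) y)
    = fst (csc d (T.resolv (Qz z) z (y, 0))) + lmul (pv i) (snd (csc d (T.resolv (Qz z) z (y, 0))))" for d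
    unfolding SRinv_slice[OF z] lmul_iota resolv_eq
    by (simp add: l J lmul.add_right lmul.diff_right lmul.scaleR_right csc_def algebra_simps lmul.minus_right)
  then show ?thesis by (simp add: z_def Kres_def csc_csc mult.commute)
qed

text \<open>Conjugate points share the same Q, so \<open>Ares\<close> is even and
  \<open>Bres\<close> odd.\<close>

lemma Kres_cnj:
  assumes "\<omega> < \<bar>Im \<zeta>\<bar>" "\<bar>Im \<zeta>\<bar> \<le> pi"
  shows "Kres (Complex.cnj \<zeta>) (y, 0) = (fst (Kres \<zeta> (y, 0)), - snd (Kres \<zeta> (y, 0)))"
proof -
  have z: "T.pseudo_resolvent (exp \<zeta>) (Qz (exp \<zeta>))" by (rule pseudo_resolvent_Qz[OF assms])
  have e: "exp (Complex.cnj \<zeta>) = Complex.cnj (exp \<zeta>)" by (rule exp_cnj[symmetric])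
  have "Ares (exp \<zeta>) 0 = 0" "Bres (exp \<zeta>) 0 = 0"
    using bounded_linear_Ares[OF z] bounded_linear_Bres[OF z] by (simp_all add: linear_0 bounded_linear.linear)
  moreover have "Ares (Complex.cnj z) v = Ares z v" "Bres (Complex.cnj z) v = - Bres z v" for z v
    by (simp_all add: Ares_def Bres_def Qz_cnj)
  ultimately show ?thesis
    unfolding Kres_def e resolv_eq by (simp add: csc_def)
qed

end

section \<open>The calculus on the two rays\<close>

locale sectorial_operator_ray = sectorial_operator_slice D Top \<omega> \<mu> i
  for D :: "'n::{finite,linorder} option \<Rightarrow> 'v::banach set" and Top :: "'n option \<Rightarrow> 'v \<Rightarrow> 'v"
    and \<omega> \<mu> :: real and i :: "'n para" +
  fixes w C \<theta> :: real
  assumes SR: "strip_resolvent Kres w \<mu> C" and w: "\<omega> < w" and \<theta>: "w < \<theta>" "\<theta> < \<mu>"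
begin

sublocale R: strip_resolvent Kres w \<mu> C by (rule SR)

text \<open>F(T) as a real operator on V_n: for symmetric F the calculus maps real vectors to real
  vectors, so nothing is lost by taking the first component.\<close>

definition rcalc :: "(complex \<Rightarrow> complex) \<Rightarrow> ('v, 'n) modn \<Rightarrow> ('v, 'n) modn" where
  "rcalc F y = fst (R.calc \<theta> F (y, 0))"

lemma \<theta>_pos: "0 < \<theta>" and \<theta>_pi: "\<theta> < pi" and \<omega>_\<theta>: "\<omega> < \<theta>"
  using \<theta> w \<omega> \<mu> by auto

text \<open>The lower line integral is the conjugate of the upper one, so their difference is purely
  imaginary and the factor i / (2 pi) makes it real.\<close>

lemma
  assumes F: "strip_symmetric \<mu> F"
  shows snd_calc: "snd (R.calc \<theta> F (y, 0)) = 0"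
    and bounded_linear_rcalc: "bounded_linear (rcalc F)"
proof -
  obtain M \<alpha> where b: "strip_bounded \<mu> M \<alpha> F" using F by (auto simp: strip_symmetric_def)
  have s: "F (Complex.cnj \<zeta>) = Complex.cnj (F \<zeta>)" if "\<bar>Im \<zeta>\<bar> < \<mu>" for \<zeta>
    using F that by (auto simp: strip_symmetric_def)
  define L where "L = R.line_integral \<theta> F (y, 0)"
  have bl: "bounded_linear (\<lambda>p :: ('v, 'n) modn \<times> ('v, 'n) modn. (fst p, - snd p))"
    by (intro bounded_linear_Pair bounded_linear_fst bounded_linear_minus bounded_linear_snd)
  have "csc (F (Complex s (-\<theta>))) (Kres (Complex s (-\<theta>)) (y, 0)) = (\<lambda>p. (fst p, - snd p)) (csc (F (Complex s \<theta>)) (Kres (Complex s \<theta>) (y, 0)))" for s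
  proof -
    have c: "Complex s (-\<theta>) = Complex.cnj (Complex s \<theta>)" by (simp add: complex_eq_iff)
    have "Kres (Complex.cnj (Complex s \<theta>)) (y, 0) = (fst (Kres (Complex s \<theta>) (y, 0)), - snd (Kres (Complex s \<theta>) (y, 0)))"
      using \<theta>_pos \<theta>_pi \<omega>_\<theta> by (intro Kres_cnj) auto
    moreover have "F (Complex.cnj (Complex s \<theta>)) = Complex.cnj (F (Complex s \<theta>))"
      using \<theta> \<theta>_pos by (intro s) auto
    ultimately show ?thesis unfolding c by (simp add: csc_def)
  qed
  then have "R.line_integral (-\<theta>) F (y, 0) = (\<lambda>p. (fst p, - snd p)) L"
    unfolding R.line_integral_def L_def
    using integral_linear[OF R.line_integrand(3)[OF b, of \<theta> "(y, 0)"] bl] \<theta> \<theta>_pos by (simp add: o_def)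
  then show "snd (R.calc \<theta> F (y, 0)) = 0"
    by (simp add: R.calc_def csc_def L_def[symmetric] Re_divide)
  show "bounded_linear (rcalc F)"
    unfolding rcalc_def[abs_def]
    by (intro bounded_linear_compose[OF bounded_linear_fst] bounded_linear_compose[OF R.bounded_linear_calc[OF b \<theta>]]
        bounded_linear_Pair bounded_linear_ident bounded_linear_zero)
qed

lemma rcalc_mult:
  assumes F: "strip_symmetric \<mu> F" and G: "strip_symmetric \<mu> G"
  shows "rcalc (\<lambda>z. F z * G z) y = rcalc F (rcalc G y)"
proof -
  obtain M \<alpha> N \<beta> where b: "strip_bounded \<mu> M \<alpha> F" "strip_bounded \<mu> N \<beta> G"
    using F G by (auto simp: strip_symmetric_def)
  have "R.calc \<theta> G (y, 0) = (rcalc G y, 0)"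
    using snd_calc[OF G, of y] by (simp add: rcalc_def prod_eq_iff)
  then show ?thesis
    using R.calc_mult[OF b \<theta>, of "(y, 0)"] by (simp add: rcalc_def)
qed

text \<open>What commutes with T on its domain commutes with Q, hence with the resolvent and with
  every integral of it. It is applied to right multiplications, and to left ones for n = 1.\<close>

lemma rcalc_commute:
  assumes F: "strip_symmetric \<mu> F" and L: "bounded_linear L"
    and dom: "\<And>v. v \<in> opdom D \<Longrightarrow> opT Top (L v) = L (opT Top v)" "\<And>v. v \<in> opdom D \<Longrightarrow> L v \<in> opdom D"
  shows "L (rcalc F y) = rcalc F (L y)"
proof -
  obtain M \<alpha> where b: "strip_bounded \<mu> M \<alpha> F" using F by (auto simp: strip_symmetric_def)
  have lL: "linear L" using L by (rule bounded_linear.linear)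
  note Ll = linear_add[OF lL] linear_diff[OF lL] linear_scale[OF lL] linear_0[OF lL]
  define LL where "LL p = (L (fst p), L (snd p))" for p
  have bl: "bounded_linear LL"
    unfolding LL_def[abs_def]
    by (intro bounded_linear_Pair bounded_linear_compose[OF L] bounded_linear_fst bounded_linear_snd)
  have Lc: "LL (csc c p) = csc c (LL p)" for c p by (simp add: LL_def csc_def Ll)
  \<comment> \<open>Moving L through the quadratic polynomial shows that \<open>L (Q v)\<close> is
    mapped to \<open>L v\<close>. The left inverse property of Q finishes.\<close>
  have LQ: "L (Qz (exp \<zeta>) v) = Qz (exp \<zeta>) (L v)" if "\<omega> < \<bar>Im \<zeta>\<bar>" "\<bar>Im \<zeta>\<bar> \<le> pi" for \<zeta> v
  proof -
    let ?Q = "Qz (exp \<zeta>)"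
    have z: "T.pseudo_resolvent (exp \<zeta>) ?Q" by (rule pseudo_resolvent_Qz[OF that])
    have quad_Q: "T.quad (exp \<zeta>) (?Q v) = v"
      and Q_quad: "u \<in> opdom D \<Longrightarrow> opT Top u \<in> opdom D \<Longrightarrow> ?Q (T.quad (exp \<zeta>) u) = u" for u
      using z unfolding T.pseudo_resolvent_def by blast+
    note d = T.Q_dom[OF z, of v]
    note e = dom(1)[OF d(1)] dom(1)[OF d(2)]
    have "T.quad (exp \<zeta>) (L (?Q v)) = L (T.quad (exp \<zeta>) (?Q v))"
      unfolding T.quad_def e Ll ..
    then have "?Q (L v) = ?Q (T.quad (exp \<zeta>) (L (?Q v)))" by (simp only: quad_Q)
    also have "\<dots> = L (?Q v)"
      by (rule Q_quad) (simp_all only: e dom(2)[OF d(1)] dom(2)[OF d(2)])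
    finally show ?thesis by simp
  qed
  have LK: "LL (Kres \<zeta> p) = Kres \<zeta> (LL p)" if "\<zeta> \<in> R.reg" for \<zeta> p
  proof -
    have \<zeta>: "\<omega> < \<bar>Im \<zeta>\<bar>" "\<bar>Im \<zeta>\<bar> \<le> pi" using that w \<mu> by (auto simp: R.reg_def)
    have z: "T.pseudo_resolvent (exp \<zeta>) (Qz (exp \<zeta>))" by (rule pseudo_resolvent_Qz[OF \<zeta>])
    have "LL (T.resolv (Qz (exp \<zeta>)) (exp \<zeta>) p) = T.resolv (Qz (exp \<zeta>)) (exp \<zeta>) (LL p)"
      by (simp add: resolv_eq LL_def Ares_def Bres_def Ll dom(1)[OF T.Q_dom(1)[OF z], symmetric] LQ[OF \<zeta>])
    then show ?thesis by (simp add: Kres_def Lc)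
  qed
  have "LL (R.calc \<theta> F (y, 0)) = R.calc \<theta> F (LL (y, 0))"
    by (rule R.calc_commute[OF b \<theta> bl Lc LK])
  then have "fst (LL (R.calc \<theta> F (y, 0))) = fst (R.calc \<theta> F (L y, 0))"
    by (simp add: LL_def[of "(y, 0)"] Ll)
  then show ?thesis by (simp add: rcalc_def LL_def)
qed

lemma rcalc_rmul: "strip_symmetric \<mu> F \<Longrightarrow> rcalc F (rmul y a) = rmul (rcalc F y) a"
  by (rule rcalc_commute[symmetric, OF _ bounded_linear_rmul]) (simp_all add: opT_rmul rmul_opdom)

lemma rcalc_lmul:
  assumes "strip_symmetric \<mu> F" "CARD('n) = 1 \<or> a = cle {}"
  shows "rcalc F (lmul a y) = lmul a (rcalc F y)"
proof (cases "a = cle {}")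
  case False
  then show ?thesis
    using assms by (intro rcalc_commute[symmetric, OF _ lmul.bounded_linear_right]) (simp_all add: opT_lmul lmul_opdom)
qed simp

lemma ray_exp: "ray \<theta> i (exp x) = slice i (exp (Complex x (-\<theta>)))" "ray \<theta> i (- exp x) = slice i (exp (Complex x \<theta>))"
  by (simp_all add: ray_def slice_def Re_exp Im_exp algebra_simps)

text \<open>The upper ray is run inwards, which turns the factor -i of ds_i into +i there.\<close>

lemma dsi_exp: "exp x *\<^sub>R dsi \<theta> i (exp x) = iota i (exp (Complex x (-\<theta>)) * (-\<i>))"
  "exp x *\<^sub>R dsi \<theta> i (- exp x) = iota i (exp (Complex x \<theta>) * \<i>)"
proof -
  have d: "dray \<theta> i (exp x) = slice i (cis (-\<theta>))" "dray \<theta> i (- exp x) = slice i (- cis \<theta>)"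
    by (simp_all add: dray_def slice_def)
  have p: "pv (- i) = iota i (-\<i>)" by (simp add: iota_def pv_minus)
  have r: "r *\<^sub>R iota i c = iota i (of_real r * c)" for r c by (simp add: iota_def algebra_simps)
  show "exp x *\<^sub>R dsi \<theta> i (exp x) = iota i (exp (Complex x (-\<theta>)) * (-\<i>))"
    "exp x *\<^sub>R dsi \<theta> i (- exp x) = iota i (exp (Complex x \<theta>) * \<i>)"
    unfolding dsi_def d p pv_slice iota_mult[OF i] r
    by (simp_all add: exp_eq_polar[of "Complex _ _"] mult_ac)
qed

text \<open>Both integrands of the calculus for the function \<open>F\<close> on the slice have this form on the two rays;
the contribution of the second summand vanishes by symmetry of \<open>F\<close>.\<close>

lemma ray_has_integral:
  fixes g :: "real \<Rightarrow> ('v, 'n) modn"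
  assumes F: "strip_symmetric \<mu> F" and \<Lambda>: "bounded_linear \<Lambda>"
    and gm: "\<And>x. exp x *\<^sub>R g (- exp x) = fst (csc (\<i> * F (Complex x \<theta>)) (Kres (Complex x \<theta>) (y, 0)))
        + \<Lambda> (snd (csc (\<i> * F (Complex x \<theta>)) (Kres (Complex x \<theta>) (y', 0))))"
    and gp: "\<And>x. exp x *\<^sub>R g (exp x) = fst (csc (- \<i> * F (Complex x (-\<theta>))) (Kres (Complex x (-\<theta>)) (y, 0)))
        + \<Lambda> (snd (csc (- \<i> * F (Complex x (-\<theta>))) (Kres (Complex x (-\<theta>)) (y', 0))))"
  shows "(g has_integral (2 * pi) *\<^sub>R rcalc F y) UNIV"
proof -
  obtain M \<alpha> where b: "strip_bounded \<mu> M \<alpha> F" using F by (auto simp: strip_symmetric_def)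
  then have \<alpha>: "\<alpha> > 0" by (simp add: strip_bounded_def)
  define P where "P \<sigma> x = csc (F (Complex x \<sigma>)) (Kres (Complex x \<sigma>) (y, 0))" for \<sigma> x
  define P' where "P' \<sigma> x = csc (F (Complex x \<sigma>)) (Kres (Complex x \<sigma>) (y', 0))" for \<sigma> x
  define X where "X c p p' = fst (csc c p) + \<Lambda> (snd (csc c p'))" for c and p p' :: "('v, 'n) modn \<times> ('v, 'n) modn"
  have \<sigma>: "w < \<bar>\<theta>\<bar>" "\<bar>\<theta>\<bar> < \<mu>" "w < \<bar>-\<theta>\<bar>" "\<bar>-\<theta>\<bar> < \<mu>" using \<theta> \<theta>_pos by auto
  note P = R.line_integrand[OF b, where x = "(y, 0)", folded P_def]
    and P' = R.line_integrand[OF b, where x = "(y', 0)", folded P'_def]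
  have gm': "exp x *\<^sub>R g (- exp x) = X \<i> (P \<theta> x) (P' \<theta> x)" for x
    unfolding gm X_def P_def P'_def csc_csc ..
  have gp': "exp x *\<^sub>R g (exp x) = X (-\<i>) (P (-\<theta>) x) (P' (-\<theta>) x)" for x
    unfolding gp X_def P_def P'_def csc_csc ..
  obtain B where B: "B > 0" "\<And>x. norm (\<Lambda> x) \<le> norm x * B"
    using bounded_linear.pos_bounded[OF \<Lambda>] by blast
  define N where "N = 2 * (2 * M * (C * norm (y, 0 :: ('v, 'n) modn))) + 2 * (2 * M * (C * norm (y', 0 :: ('v, 'n) modn))) * B"
  have bd: "norm (X c (P \<sigma> x) (P' \<sigma> x)) \<le> N * kap \<alpha> x" if "norm c = 1" "w < \<bar>\<sigma>\<bar>" "\<bar>\<sigma>\<bar> < \<mu>" for c \<sigma> x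
  proof -
    have n: "norm (fst (csc c p)) \<le> 2 * norm p" "norm (snd (csc c p)) \<le> 2 * norm p" for p :: "('v, 'n) modn \<times> ('v, 'n) modn"
      using norm_csc_le[of c p] that(1) norm_fst_le[of "fst (csc c p)" "snd (csc c p)"] norm_snd_le[of "snd (csc c p)" "fst (csc c p)"]
      by simp_all
    have "norm (X c (P \<sigma> x) (P' \<sigma> x)) \<le> norm (fst (csc c (P \<sigma> x))) + norm (snd (csc c (P' \<sigma> x))) * B"
      unfolding X_def by (intro order_trans[OF norm_triangle_ineq] add_mono B order_refl)
    also have "\<dots> \<le> 2 * norm (P \<sigma> x) + (2 * norm (P' \<sigma> x)) * B"
      using B(1) by (intro add_mono mult_right_mono n) auto
    also have "\<dots> \<le> 2 * (2 * M * (C * norm (y, 0 :: ('v, 'n) modn)) * kap \<alpha> x) + (2 * (2 * M * (C * norm (y', 0 :: ('v, 'n) modn)) * kap \<alpha> x)) * B"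
      using B(1) P(2)[OF that(2,3)] P'(2)[OF that(2,3)] by (intro add_mono mult_right_mono mult_left_mono) auto
    finally show ?thesis by (simp add: N_def algebra_simps)
  qed
  have bX: "bounded_linear (\<lambda>p. fst (csc c p))" "bounded_linear (\<lambda>p. \<Lambda> (snd (csc c p)))" for c
    by (intro bounded_linear_compose[OF bounded_linear_fst csc.bounded_linear_right]
        bounded_linear_compose[OF \<Lambda> bounded_linear_compose[OF bounded_linear_snd csc.bounded_linear_right]])+
  have ct: "continuous_on UNIV (\<lambda>x. X c (P \<sigma> x) (P' \<sigma> x))" if "w < \<bar>\<sigma>\<bar>" "\<bar>\<sigma>\<bar> < \<mu>" for c \<sigma>
    unfolding X_def
    by (intro continuous_on_add bounded_linear.continuous_on[OF bX(1)] bounded_linear.continuous_on[OF bX(2)] P(1) P'(1) that)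
  have "(g has_integral (integral UNIV (\<lambda>x. exp x *\<^sub>R g (- exp x) + exp x *\<^sub>R g (exp x)))) UNIV"
    by (rule has_integral_log_substitution[where M = N and \<alpha> = \<alpha>])
       (unfold gm' gp', use \<sigma> \<alpha> in \<open>auto intro!: ct bd\<close>)
  moreover have "((\<lambda>x. exp x *\<^sub>R g (- exp x) + exp x *\<^sub>R g (exp x)) has_integral (2 * pi) *\<^sub>R rcalc F y) UNIV"
  proof -
    have hP: "(P \<sigma> has_integral R.line_integral \<sigma> F (y, 0)) UNIV" "(P' \<sigma> has_integral R.line_integral \<sigma> F (y', 0)) UNIV"
      if "w < \<bar>\<sigma>\<bar>" "\<bar>\<sigma>\<bar> < \<mu>" for \<sigma>
      using P(3)[OF that] P'(3)[OF that]
      by (simp_all add: R.line_integral_def P_def[symmetric] P'_def[symmetric] integrable_integral)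
    have hX: "((\<lambda>x. X c (P \<sigma> x) (P' \<sigma> x)) has_integral X c (R.line_integral \<sigma> F (y, 0)) (R.line_integral \<sigma> F (y', 0))) UNIV"
      if "w < \<bar>\<sigma>\<bar>" "\<bar>\<sigma>\<bar> < \<mu>" for c \<sigma>
      unfolding X_def
      using has_integral_linear[OF hP(1)[OF that] bX(1)] has_integral_linear[OF hP(2)[OF that] bX(2)]
      by (intro has_integral_add) (simp_all add: o_def)
    \<comment> \<open>The units +i and -i on the two rays reassemble the difference in
      \<open>calc\<close>, up to its factor 1 / (2 pi).\<close>
    have two_pi: "csc \<i> (R.line_integral \<theta> F q) + csc (-\<i>) (R.line_integral (-\<theta>) F q) = (2 * pi) *\<^sub>R R.calc \<theta> F q" for q
    proof -
      have s: "r *\<^sub>R p = csc (of_real r) p" for r and p :: "('v, 'n) modn \<times> ('v, 'n) modn"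
        by (simp add: csc_def prod_eq_iff)
      have "csc (-\<i>) p = - csc \<i> p" for p :: "('v, 'n) modn \<times> ('v, 'n) modn" by (rule csc.minus_left)
      then show ?thesis
        unfolding s R.calc_def csc_csc by (simp add: csc.diff_right)
    qed
    have \<Lambda>l: "linear \<Lambda>" using \<Lambda> by (rule bounded_linear.linear)
    have "X \<i> (R.line_integral \<theta> F (y, 0)) (R.line_integral \<theta> F (y', 0)) + X (-\<i>) (R.line_integral (-\<theta>) F (y, 0)) (R.line_integral (-\<theta>) F (y', 0))
       = fst ((2 * pi) *\<^sub>R R.calc \<theta> F (y, 0)) + \<Lambda> (snd ((2 * pi) *\<^sub>R R.calc \<theta> F (y', 0)))"
      unfolding two_pi[symmetric] X_def by (simp add: linear_add[OF \<Lambda>l])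
    also have "\<dots> = (2 * pi) *\<^sub>R rcalc F y"
      by (simp add: snd_calc[OF F] rcalc_def linear_0[OF \<Lambda>l])
    finally show ?thesis
      unfolding gm' gp' using has_integral_add[OF hX[OF \<sigma>(1,2), of \<i>] hX[OF \<sigma>(3,4), of "-\<i>"]] by simp
  qed
  ultimately show ?thesis by (simp add: integral_unique)
qed

lemma log_ray:
  fixes t :: real assumes "t \<noteq> 0"
  shows "ray \<theta> i t = slice i (exp (Complex (ln \<bar>t\<bar>) (- sgn t * \<theta>)))"
  using ray_exp[of "ln \<bar>t\<bar>"] assms by (cases "t > 0") auto

lemma \<theta>_strip:
  "\<omega> < \<bar>Im (Complex x \<theta>)\<bar>" "\<bar>Im (Complex x \<theta>)\<bar> \<le> pi" "\<omega> < \<bar>Im (Complex x (-\<theta>))\<bar>" "\<bar>Im (Complex x (-\<theta>))\<bar> \<le> pi"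
  using \<theta>_pos \<theta>_pi \<omega>_\<theta> by auto

lemma linear_SLinv_ray:
  assumes "t \<noteq> 0" shows "linear (SLinv D Top (ray \<theta> i t))"
proof -
  have "\<omega> < \<bar>Im (Complex (ln \<bar>t\<bar>) (- sgn t * \<theta>))\<bar>" "\<bar>Im (Complex (ln \<bar>t\<bar>) (- sgn t * \<theta>))\<bar> \<le> pi"
    using assms \<theta>_pos \<theta>_pi \<omega>_\<theta> by (auto simp: abs_mult abs_sgn_eq)
  from bounded_linear_SLinv[OF pseudo_resolvent_Qz[OF this]] show ?thesis
    unfolding log_ray[OF assms] by (rule bounded_linear.linear)
qed

text \<open>Each term of the representation is integrated separately. Its coefficient stands next to
  \<open>v\<close>, so it enters the argument of the complex calculus.\<close>

lemma SL_integrand_has_integral: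
  assumes rep: "left_rep \<mu> i \<psi> I F c"
  shows "(SL_integrand D Top \<theta> i \<psi> v has_integral (2 * pi) *\<^sub>R (\<Sum>k\<in>I. rcalc (F k) (lmul (c k) v))) UNIV"
proof -
  \<comment> \<open>\<open>ln \<bar>t\<bar>\<close> and \<open>- sgn t * \<theta>\<close> are the
    real and imaginary part of the logarithm of the path point.\<close>
  define g where "g k t = SLinv D Top (ray \<theta> i t) (lmul (clmul (dsi \<theta> i t) (iota i (F k (Complex (ln \<bar>t\<bar>) (- sgn t * \<theta>))))) (lmul (c k) v))" for k t
  have I: "finite I" "\<And>k. k \<in> I \<Longrightarrow> strip_symmetric \<mu> (F k)" using rep by (auto simp: left_rep_def)
  have lin: "r *\<^sub>R SLinv D Top (ray \<theta> i t) u = SLinv D Top (ray \<theta> i t) (r *\<^sub>R u)" if "t \<noteq> 0" for r t u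
    using linear_scale[OF linear_SLinv_ray[OF that]] by simp
  have mv: "r *\<^sub>R lmul (clmul a b) u = lmul (clmul (r *\<^sub>R a) b) u" for r and a b :: "'n cliff" and u :: "('v, 'n) modn"
    by (simp add: clmul_eq_lmul lmul.scaleR_left)
  have each: "(g k has_integral (2 * pi) *\<^sub>R rcalc (F k) (lmul (c k) v)) UNIV" if "k \<in> I" for k
  proof (rule ray_has_integral[OF I(2)[OF that] bounded_linear_ident, where y' = "lmul (pv i) (lmul (c k) v)"])
    fix x
    show "exp x *\<^sub>R g k (- exp x) = fst (csc (\<i> * F k (Complex x \<theta>)) (Kres (Complex x \<theta>) (lmul (c k) v, 0)))
        + snd (csc (\<i> * F k (Complex x \<theta>)) (Kres (Complex x \<theta>) (lmul (pv i) (lmul (c k) v), 0)))"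
      unfolding g_def by (subst lin, simp, subst mv, unfold dsi_exp ray_exp iota_mult[OF i])
        (simp add: SLinv_iota[OF \<theta>_strip(1,2), symmetric] mult.assoc)
    show "exp x *\<^sub>R g k (exp x) = fst (csc (- \<i> * F k (Complex x (-\<theta>))) (Kres (Complex x (-\<theta>)) (lmul (c k) v, 0)))
        + snd (csc (- \<i> * F k (Complex x (-\<theta>))) (Kres (Complex x (-\<theta>)) (lmul (pv i) (lmul (c k) v), 0)))"
      unfolding g_def by (subst lin, simp, subst mv, unfold dsi_exp ray_exp iota_mult[OF i])
        (simp add: SLinv_iota[OF \<theta>_strip(3,4), symmetric] mult.assoc)
  qed
  have "((\<lambda>t. \<Sum>k\<in>I. g k t) has_integral (\<Sum>k\<in>I. (2 * pi) *\<^sub>R rcalc (F k) (lmul (c k) v))) UNIV"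
    by (intro has_integral_sum I(1) each)
  then show ?thesis
    unfolding scaleR_sum_right[symmetric]
  \<comment> \<open>Linearity of the S-resolvent is known only off t = 0, which may lie in the
    S-spectrum. A single point does not affect the integral.\<close>
  proof (rule has_integral_spike_finite[of "{0}", rotated 2])
    fix t :: real assume "t \<in> UNIV - {0}"
    then have t: "t \<noteq> 0" by simp
    have "\<psi> (ray \<theta> i t) = (\<Sum>k\<in>I. clmul (iota i (F k (Complex (ln \<bar>t\<bar>) (- sgn t * \<theta>)))) (c k))"
      unfolding log_ray[OF t] using rep t \<theta> \<theta>_pos by (auto simp: left_rep_def abs_mult abs_sgn_eq)
    then show "SL_integrand D Top \<theta> i \<psi> v t = (\<Sum>k\<in>I. g k t)"
      unfolding SL_integrand_def g_def linear_sum[OF linear_SLinv_ray[OF t], symmetric] lmul.sum_left[symmetric]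
        lmul_lmul[symmetric] clmul_assoc
      by (simp add: clmul_eq_lmul lmul.sum_right lmul.sum_left)
  qed simp
qed

text \<open>The coefficients now stand to the left of everything and are pulled out of the integral
  as bounded operators.\<close>

lemma SR_integrand_has_integral:
  assumes rep: "right_rep \<mu> i \<psi> I F c"
  shows "(SR_integrand D Top \<theta> i \<psi> v has_integral (2 * pi) *\<^sub>R (\<Sum>k\<in>I. lmul (c k) (rcalc (F k) v))) UNIV"
proof -
  define g where "g k t = lmul (clmul (iota i (F k (Complex (ln \<bar>t\<bar>) (- sgn t * \<theta>)))) (dsi \<theta> i t)) (SRinv D Top (ray \<theta> i t) v)" for k t
  have I: "finite I" "\<And>k. k \<in> I \<Longrightarrow> strip_symmetric \<mu> (F k)" using rep by (auto simp: right_rep_def)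
  have mv: "r *\<^sub>R lmul (clmul a b) u = lmul (clmul a (r *\<^sub>R b)) u" for r and a b :: "'n cliff" and u :: "('v, 'n) modn"
    by (simp add: clmul_eq_lmul lmul.scaleR_left lmul.scaleR_right)
  have each: "(g k has_integral (2 * pi) *\<^sub>R rcalc (F k) v) UNIV" if "k \<in> I" for k
  proof (rule ray_has_integral[OF I(2)[OF that] lmul.bounded_linear_right[of "pv i"], where y' = v])
    fix x
    show "exp x *\<^sub>R g k (- exp x) = fst (csc (\<i> * F k (Complex x \<theta>)) (Kres (Complex x \<theta>) (v, 0)))
        + lmul (pv i) (snd (csc (\<i> * F k (Complex x \<theta>)) (Kres (Complex x \<theta>) (v, 0))))"
      unfolding g_def mv by (unfold dsi_exp ray_exp iota_mult[OF i])
        (simp add: SRinv_iota[OF \<theta>_strip(1,2), symmetric] mult_ac)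
    show "exp x *\<^sub>R g k (exp x) = fst (csc (- \<i> * F k (Complex x (-\<theta>))) (Kres (Complex x (-\<theta>)) (v, 0)))
        + lmul (pv i) (snd (csc (- \<i> * F k (Complex x (-\<theta>))) (Kres (Complex x (-\<theta>)) (v, 0))))"
      unfolding g_def mv by (unfold dsi_exp ray_exp iota_mult[OF i])
        (simp add: SRinv_iota[OF \<theta>_strip(3,4), symmetric] mult_ac)
  qed
  have "((\<lambda>t. lmul (c k) (g k t)) has_integral lmul (c k) ((2 * pi) *\<^sub>R rcalc (F k) v)) UNIV" if "k \<in> I" for k
    using has_integral_linear[OF each[OF that] lmul.bounded_linear_right[of "c k"]] by (simp add: o_def)
  then have "((\<lambda>t. \<Sum>k\<in>I. lmul (c k) (g k t)) has_integral (\<Sum>k\<in>I. lmul (c k) ((2 * pi) *\<^sub>R rcalc (F k) v))) UNIV"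
    by (intro has_integral_sum I(1))
  then show ?thesis
    unfolding scaleR_sum_right lmul.scaleR_right[symmetric]
  proof (rule has_integral_spike_finite[of "{0}", rotated 2])
    fix t :: real assume "t \<in> UNIV - {0}"
    then have t: "t \<noteq> 0" by simp
    have "\<psi> (ray \<theta> i t) = (\<Sum>k\<in>I. clmul (c k) (iota i (F k (Complex (ln \<bar>t\<bar>) (- sgn t * \<theta>)))))"
      unfolding log_ray[OF t] using rep t \<theta> \<theta>_pos by (auto simp: right_rep_def abs_mult abs_sgn_eq)
    then show "SR_integrand D Top \<theta> i \<psi> v t = (\<Sum>k\<in>I. lmul (c k) (g k t))"
      unfolding SR_integrand_def g_def lmul_lmul[symmetric] clmul_assoc[symmetric]
      by (simp add: clmul_eq_lmul lmul.sum_left)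
  qed simp
qed

lemma SLcalc_rep:
  assumes "left_rep \<mu> i \<psi> I F c"
  shows "SLcalc D Top \<theta> i \<psi> v = (\<Sum>k\<in>I. rcalc (F k) (lmul (c k) v))"
  using integral_unique[OF SL_integrand_has_integral[OF assms]] by (simp add: SLcalc_def)

lemma SRcalc_rep:
  assumes "right_rep \<mu> i \<psi> I F c"
  shows "SRcalc D Top \<theta> i \<psi> v = (\<Sum>k\<in>I. lmul (c k) (rcalc (F k) v))"
  using integral_unique[OF SR_integrand_has_integral[OF assms]] by (simp add: SRcalc_def)

lemma SLcalc_properties:
  assumes rep: "left_rep \<mu> i \<psi> I F c"
  shows "SL_integrand D Top \<theta> i \<psi> v integrable_on UNIV"
    "bounded_linear (SLcalc D Top \<theta> i \<psi>)" "rmod_hom (SLcalc D Top \<theta> i \<psi>)"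
proof -
  have sym: "strip_symmetric \<mu> (F k)" if "k \<in> I" for k using rep that by (simp add: left_rep_def)
  show "SL_integrand D Top \<theta> i \<psi> v integrable_on UNIV"
    using SL_integrand_has_integral[OF rep] by blast
  show "bounded_linear (SLcalc D Top \<theta> i \<psi>)"
    unfolding SLcalc_rep[OF rep, abs_def]
    by (intro bounded_linear_sum bounded_linear_compose[OF bounded_linear_rcalc lmul.bounded_linear_right] sym)
  show "rmod_hom (SLcalc D Top \<theta> i \<psi>)"
    unfolding rmod_hom_def SLcalc_rep[OF rep]
    by (simp add: lmul_rmul rcalc_rmul sym linear_sum[OF bounded_linear.linear[OF bounded_linear_rmul]])
qed

lemma SRcalc_properties:
  assumes rep: "right_rep \<mu> i \<psi> I F c"
  shows "SR_integrand D Top \<theta> i \<psi> v integrable_on UNIV"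
    "bounded_linear (SRcalc D Top \<theta> i \<psi>)" "rmod_hom (SRcalc D Top \<theta> i \<psi>)"
proof -
  have sym: "strip_symmetric \<mu> (F k)" if "k \<in> I" for k using rep that by (simp add: right_rep_def)
  show "SR_integrand D Top \<theta> i \<psi> v integrable_on UNIV"
    using SR_integrand_has_integral[OF rep] by blast
  show "bounded_linear (SRcalc D Top \<theta> i \<psi>)"
    unfolding SRcalc_rep[OF rep, abs_def]
    by (intro bounded_linear_sum bounded_linear_compose[OF lmul.bounded_linear_right bounded_linear_rcalc] sym)
  show "rmod_hom (SRcalc D Top \<theta> i \<psi>)"
    unfolding rmod_hom_def SRcalc_rep[OF rep]
    by (simp add: lmul_rmul rcalc_rmul sym linear_sum[OF bounded_linear.linear[OF bounded_linear_rmul]])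
qed

lemma SLcalc_linear:
  assumes \<psi>: "left_rep \<mu> i \<psi> I F c" and \<phi>: "left_rep \<mu> i \<phi> J G d"
  shows "SLcalc D Top \<theta> i (\<lambda>s. a *\<^sub>R \<psi> s + b *\<^sub>R \<phi> s) v = a *\<^sub>R SLcalc D Top \<theta> i \<psi> v + b *\<^sub>R SLcalc D Top \<theta> i \<phi> v"
proof -
  let ?I = "\<lambda>\<psi>. integral UNIV (SL_integrand D Top \<theta> i \<psi> v)"
  have "((\<lambda>t. a *\<^sub>R SL_integrand D Top \<theta> i \<psi> v t + b *\<^sub>R SL_integrand D Top \<theta> i \<phi> v t) has_integral a *\<^sub>R ?I \<psi> + b *\<^sub>R ?I \<phi>) UNIV"
    by (intro has_integral_add has_integral_cmul integrable_integral SLcalc_properties(1)[OF \<psi>] SLcalc_properties(1)[OF \<phi>])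
  then have "(SL_integrand D Top \<theta> i (\<lambda>s. a *\<^sub>R \<psi> s + b *\<^sub>R \<phi> s) v has_integral a *\<^sub>R ?I \<psi> + b *\<^sub>R ?I \<phi>) UNIV"
  proof (rule has_integral_spike_finite[of "{0}", rotated 2])
    fix t :: real assume "t \<in> UNIV - {0}"
    then have "linear (SLinv D Top (ray \<theta> i t))" by (simp add: linear_SLinv_ray)
    then show "SL_integrand D Top \<theta> i (\<lambda>s. a *\<^sub>R \<psi> s + b *\<^sub>R \<phi> s) v t = a *\<^sub>R SL_integrand D Top \<theta> i \<psi> v t + b *\<^sub>R SL_integrand D Top \<theta> i \<phi> v t"
      by (simp add: SL_integrand_def clmul_eq_lmul lmul.add_right lmul.add_left lmul.scaleR_right lmul.scaleR_left linear_add linear_scale)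
  qed simp
  then show ?thesis
    by (simp add: SLcalc_def integral_unique algebra_simps)
qed

lemma SRcalc_linear:
  assumes \<psi>: "right_rep \<mu> i \<psi> I F c" and \<phi>: "right_rep \<mu> i \<phi> J G d"
  shows "SRcalc D Top \<theta> i (\<lambda>s. a *\<^sub>R \<psi> s + b *\<^sub>R \<phi> s) v = a *\<^sub>R SRcalc D Top \<theta> i \<psi> v + b *\<^sub>R SRcalc D Top \<theta> i \<phi> v"
proof -
  let ?I = "\<lambda>\<psi>. integral UNIV (SR_integrand D Top \<theta> i \<psi> v)"
  have "((\<lambda>t. a *\<^sub>R SR_integrand D Top \<theta> i \<psi> v t + b *\<^sub>R SR_integrand D Top \<theta> i \<phi> v t) has_integral a *\<^sub>R ?I \<psi> + b *\<^sub>R ?I \<phi>) UNIV"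
    by (intro has_integral_add has_integral_cmul integrable_integral SRcalc_properties(1)[OF \<psi>] SRcalc_properties(1)[OF \<phi>])
  \<comment> \<open>On this side the function value multiplies the result of the resolvent, so the
    identity holds at every t, including 0.\<close>
  moreover have "SR_integrand D Top \<theta> i (\<lambda>s. a *\<^sub>R \<psi> s + b *\<^sub>R \<phi> s) v
      = (\<lambda>t. a *\<^sub>R SR_integrand D Top \<theta> i \<psi> v t + b *\<^sub>R SR_integrand D Top \<theta> i \<phi> v t)"
    by (simp add: SR_integrand_def clmul_eq_lmul lmul.add_left lmul.scaleR_left)
  ultimately show ?thesis
    by (simp add: SRcalc_def integral_unique algebra_simps)
qed

section \<open>The product rule\<close>

lemma clmul_central:
  assumes "CARD('n) = 1 \<or> c = cle {}"
  shows "clmul c a = clmul a (c :: 'n cliff)"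
  using assms clmul_commute by auto

text \<open>Centrality of \<open>c\<close> enters twice: in the algebra, to bring the product into
  the form of a representation indexed by pairs, and in the calculus, to move \<open>c k\<close>
  past \<open>rcalc (G l)\<close>.\<close>

lemma SLcalc_mult:
  assumes \<psi>: "left_rep \<mu> i \<psi> I F c" and c: "\<And>k. k \<in> I \<Longrightarrow> CARD('n) = 1 \<or> c k = cle {}" and \<phi>: "left_rep \<mu> i \<phi> J G d"
  shows "SLcalc D Top \<theta> i (\<lambda>s. clmul (\<psi> s) (\<phi> s)) v = SLcalc D Top \<theta> i \<psi> (SLcalc D Top \<theta> i \<phi> v)"
proof -
  have I: "finite I" "\<And>k. k \<in> I \<Longrightarrow> strip_symmetric \<mu> (F k)" using \<psi> by (auto simp: left_rep_def)
  have J: "finite J" "\<And>k. k \<in> J \<Longrightarrow> strip_symmetric \<mu> (G k)" using \<phi> by (auto simp: left_rep_def)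
  have "left_rep \<mu> i (\<lambda>s. clmul (\<psi> s) (\<phi> s)) (I \<times> J) (\<lambda>p z. F (fst p) z * G (snd p) z) (\<lambda>p. clmul (c (fst p)) (d (snd p)))"
    unfolding left_rep_def
  proof (intro conjI allI impI ballI)
    fix \<zeta> :: complex assume \<zeta>: "\<bar>Im \<zeta>\<bar> < \<mu>"
    have t: "clmul (clmul (iota i (F k \<zeta>)) (c k)) (clmul (iota i (G l \<zeta>)) (d l)) = clmul (iota i (F k \<zeta> * G l \<zeta>)) (clmul (c k) (d l))" if "k \<in> I" for k l
      by (metis clmul_assoc clmul_central[OF c[OF that]] iota_mult[OF i])
    have "clmul (\<psi> (slice i (exp \<zeta>))) (\<phi> (slice i (exp \<zeta>)))
        = (\<Sum>k\<in>I. \<Sum>l\<in>J. clmul (clmul (iota i (F k \<zeta>)) (c k)) (clmul (iota i (G l \<zeta>)) (d l)))"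
      using \<psi> \<phi> \<zeta> by (simp add: left_rep_def clmul_eq_lmul lmul.sum_left lmul.sum_right) (rule sum.swap)
    also have "\<dots> = (\<Sum>k\<in>I. \<Sum>l\<in>J. clmul (iota i (F k \<zeta> * G l \<zeta>)) (clmul (c k) (d l)))"
      by (intro sum.cong refl t)
    finally show "clmul (\<psi> (slice i (exp \<zeta>))) (\<phi> (slice i (exp \<zeta>)))
        = (\<Sum>p\<in>I \<times> J. clmul (iota i (F (fst p) \<zeta> * G (snd p) \<zeta>)) (clmul (c (fst p)) (d (snd p))))"
      by (simp add: sum.cartesian_product case_prod_unfold)
  qed (use I J in \<open>auto intro: strip_symmetric_mult\<close>)
  then have "SLcalc D Top \<theta> i (\<lambda>s. clmul (\<psi> s) (\<phi> s)) v
      = (\<Sum>k\<in>I. \<Sum>l\<in>J. rcalc (\<lambda>z. F k z * G l z) (lmul (clmul (c k) (d l)) v))"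
    by (simp add: SLcalc_rep sum.cartesian_product case_prod_unfold)
  also have "\<dots> = (\<Sum>k\<in>I. \<Sum>l\<in>J. rcalc (F k) (lmul (c k) (rcalc (G l) (lmul (d l) v))))"
  proof (intro sum.cong refl)
    fix k l assume "k \<in> I" "l \<in> J"
    then show "rcalc (\<lambda>z. F k z * G l z) (lmul (clmul (c k) (d l)) v) = rcalc (F k) (lmul (c k) (rcalc (G l) (lmul (d l) v)))"
      using rcalc_lmul[OF J(2) c] by (simp add: I J rcalc_mult lmul_lmul)
  qed
  also have "\<dots> = (\<Sum>k\<in>I. rcalc (F k) (lmul (c k) (\<Sum>l\<in>J. rcalc (G l) (lmul (d l) v))))"
    by (intro sum.cong refl) (simp add: I lmul.sum_right linear_sum[OF bounded_linear.linear[OF bounded_linear_rcalc]])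
  finally show ?thesis by (simp add: SLcalc_rep[OF \<psi>] SLcalc_rep[OF \<phi>])
qed

text \<open>Here the second factor carries the central coefficients, which pass the slice values of
  the first factor and then \<open>rcalc (F k)\<close>.\<close>

lemma SRcalc_mult:
  assumes \<psi>: "right_rep \<mu> i \<psi> I F c" and \<phi>: "right_rep \<mu> i \<phi> J G d" and d: "\<And>k. k \<in> J \<Longrightarrow> CARD('n) = 1 \<or> d k = cle {}"
  shows "SRcalc D Top \<theta> i (\<lambda>s. clmul (\<psi> s) (\<phi> s)) v = SRcalc D Top \<theta> i \<psi> (SRcalc D Top \<theta> i \<phi> v)"
proof -
  have I: "finite I" "\<And>k. k \<in> I \<Longrightarrow> strip_symmetric \<mu> (F k)" using \<psi> by (auto simp: right_rep_def)
  have J: "finite J" "\<And>k. k \<in> J \<Longrightarrow> strip_symmetric \<mu> (G k)" using \<phi> by (auto simp: right_rep_def)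
  have "right_rep \<mu> i (\<lambda>s. clmul (\<psi> s) (\<phi> s)) (I \<times> J) (\<lambda>p z. F (fst p) z * G (snd p) z) (\<lambda>p. clmul (c (fst p)) (d (snd p)))"
    unfolding right_rep_def
  proof (intro conjI allI impI ballI)
    fix \<zeta> :: complex assume \<zeta>: "\<bar>Im \<zeta>\<bar> < \<mu>"
    have t: "clmul (clmul (c k) (iota i (F k \<zeta>))) (clmul (d l) (iota i (G l \<zeta>))) = clmul (clmul (c k) (d l)) (iota i (F k \<zeta> * G l \<zeta>))" if "l \<in> J" for k l
      by (metis clmul_assoc clmul_central[OF d[OF that]] iota_mult[OF i])
    have "clmul (\<psi> (slice i (exp \<zeta>))) (\<phi> (slice i (exp \<zeta>)))
        = (\<Sum>k\<in>I. \<Sum>l\<in>J. clmul (clmul (c k) (iota i (F k \<zeta>))) (clmul (d l) (iota i (G l \<zeta>))))"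
      using \<psi> \<phi> \<zeta> by (simp add: right_rep_def clmul_eq_lmul lmul.sum_left lmul.sum_right) (rule sum.swap)
    also have "\<dots> = (\<Sum>k\<in>I. \<Sum>l\<in>J. clmul (clmul (c k) (d l)) (iota i (F k \<zeta> * G l \<zeta>)))"
      by (intro sum.cong refl t)
    finally show "clmul (\<psi> (slice i (exp \<zeta>))) (\<phi> (slice i (exp \<zeta>)))
        = (\<Sum>p\<in>I \<times> J. clmul (clmul (c (fst p)) (d (snd p))) (iota i (F (fst p) \<zeta> * G (snd p) \<zeta>)))"
      by (simp add: sum.cartesian_product case_prod_unfold)
  qed (use I J in \<open>auto intro: strip_symmetric_mult\<close>)
  then have "SRcalc D Top \<theta> i (\<lambda>s. clmul (\<psi> s) (\<phi> s)) v
      = (\<Sum>k\<in>I. \<Sum>l\<in>J. lmul (clmul (c k) (d l)) (rcalc (\<lambda>z. F k z * G l z) v))"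
    by (simp add: SRcalc_rep sum.cartesian_product case_prod_unfold)
  also have "\<dots> = (\<Sum>k\<in>I. \<Sum>l\<in>J. lmul (c k) (rcalc (F k) (lmul (d l) (rcalc (G l) v))))"
  proof (intro sum.cong refl)
    fix k l assume "k \<in> I" "l \<in> J"
    then show "lmul (clmul (c k) (d l)) (rcalc (\<lambda>z. F k z * G l z) v) = lmul (c k) (rcalc (F k) (lmul (d l) (rcalc (G l) v)))"
      using rcalc_lmul[OF I(2) d] by (simp add: I J rcalc_mult lmul_lmul)
  qed
  also have "\<dots> = (\<Sum>k\<in>I. lmul (c k) (rcalc (F k) (\<Sum>l\<in>J. lmul (d l) (rcalc (G l) v))))"
    by (intro sum.cong refl) (simp add: I lmul.sum_right linear_sum[OF bounded_linear.linear[OF bounded_linear_rcalc]])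
  finally show ?thesis by (simp add: SRcalc_rep[OF \<psi>] SRcalc_rep[OF \<phi>])
qed

end

theorem theorem7p20:
  fixes D :: "'n::{finite,linorder} option \<Rightarrow> 'v::banach set"
    and Top :: "'n option \<Rightarrow> 'v \<Rightarrow> 'v"
    and \<omega> \<mu> :: real
  assumes "0 \<le> \<omega>" and "\<omega> < \<mu>" and "\<mu> \<le> pi"
    and "\<forall>m. lin_op (D m) (Top m)"
    and "type_op \<omega> D Top"
  shows "\<forall>\<theta> \<in> {\<omega><..<\<mu>}. \<forall>i \<in> sph.
     (\<forall>\<psi>. PsiL \<mu> \<psi> \<longrightarrow> (\<forall>v. SL_integrand D Top \<theta> i \<psi> v integrable_on UNIV)
          \<and> bounded_linear (SLcalc D Top \<theta> i \<psi>) \<and> rmod_hom (SLcalc D Top \<theta> i \<psi>))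
   \<and> (\<forall>\<psi>. PsiR \<mu> \<psi> \<longrightarrow> (\<forall>v. SR_integrand D Top \<theta> i \<psi> v integrable_on UNIV)
          \<and> bounded_linear (SRcalc D Top \<theta> i \<psi>) \<and> rmod_hom (SRcalc D Top \<theta> i \<psi>))
   \<and> (\<forall>\<psi> \<phi> a b. PsiL \<mu> \<psi> \<and> PsiL \<mu> \<phi> \<longrightarrow>
        SLcalc D Top \<theta> i (\<lambda>s. a *\<^sub>R \<psi> s + b *\<^sub>R \<phi> s)
          = (\<lambda>v. a *\<^sub>R SLcalc D Top \<theta> i \<psi> v + b *\<^sub>R SLcalc D Top \<theta> i \<phi> v))
   \<and> (\<forall>\<psi> \<phi> a b. PsiR \<mu> \<psi> \<and> PsiR \<mu> \<phi> \<longrightarrow>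
        SRcalc D Top \<theta> i (\<lambda>s. a *\<^sub>R \<psi> s + b *\<^sub>R \<phi> s)
          = (\<lambda>v. a *\<^sub>R SRcalc D Top \<theta> i \<psi> v + b *\<^sub>R SRcalc D Top \<theta> i \<phi> v))
   \<and> (\<forall>\<psi> \<phi>. Psi \<mu> \<psi> \<and> PsiL \<mu> \<phi> \<longrightarrow>
        SLcalc D Top \<theta> i (\<lambda>s. clmul (\<psi> s) (\<phi> s))
          = SLcalc D Top \<theta> i \<psi> \<circ> SLcalc D Top \<theta> i \<phi>)
   \<and> (\<forall>\<psi> \<phi>. PsiR \<mu> \<psi> \<and> Psi \<mu> \<phi> \<longrightarrow>
        SRcalc D Top \<theta> i (\<lambda>s. clmul (\<psi> s) (\<phi> s))
          = SRcalc D Top \<theta> i \<psi> \<circ> SRcalc D Top \<theta> i \<phi>)"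
proof (intro ballI, goal_cases)
  case (1 \<theta> i)
  then have \<theta>: "\<theta> \<in> {\<omega><..<\<mu>}" and i: "i \<in> sph" .
  interpret sectorial_operator_slice D Top \<omega> \<mu> i
    using assms i by unfold_locales auto
  \<comment> \<open>Any angle strictly between \<open>\<omega>\<close> and \<open>\<theta>\<close>
    will do: above \<open>\<omega>\<close> for a uniform resolvent bound, below
    \<open>\<theta>\<close> so that the rays lie in the region of that bound.\<close>
  define w where "w = (\<omega> + \<theta>) / 2"
  have w: "\<omega> < w" "w < \<theta>" "\<theta> < \<mu>" using \<theta> by (auto simp: w_def)
  then obtain C where C: "strip_resolvent Kres w \<mu> C"
    using strip_resolvent_Kres[of w] by auto
  interpret sectorial_operator_ray D Top \<omega> \<mu> i w C \<theta>
    by (intro sectorial_operator_ray.intro sectorial_operator_slice_axioms sectorial_operator_ray_axioms.intro C w)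
  have \<mu>0: "0 < \<mu>" using assms by simp
  have L: "\<exists>F. left_rep \<mu> i \<psi> UNIV F cle" if "PsiL \<mu> \<psi>" for \<psi>
    using PsiL_left_rep[OF that i assms(3)] by blast
  have R: "\<exists>F. right_rep \<mu> i \<psi> UNIV F cle" if "PsiR \<mu> \<psi>" for \<psi>
    using PsiR_right_rep[OF that i assms(3)] by blast
  have I: "\<exists>I F. left_rep \<mu> i \<psi> I F cle \<and> right_rep \<mu> i \<psi> I F cle \<and> (\<forall>B\<in>I. CARD('n) = 1 \<or> B = {})" if "Psi \<mu> \<psi>" for \<psi>
    by (rule Psi_rep[OF that i \<mu>0 assms(3)]) blast
  show ?case
  proof (intro conjI allI impI)
    fix \<psi> :: "'n para \<Rightarrow> 'n cliff" assume "PsiL \<mu> \<psi>"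
    then obtain F where rep: "left_rep \<mu> i \<psi> UNIV F cle" using L by blast
    show "SL_integrand D Top \<theta> i \<psi> v integrable_on UNIV" for v by (rule SLcalc_properties(1)[OF rep])
    show "bounded_linear (SLcalc D Top \<theta> i \<psi>)" by (rule SLcalc_properties(2)[OF rep])
    show "rmod_hom (SLcalc D Top \<theta> i \<psi>)" by (rule SLcalc_properties(3)[OF rep])
  next
    fix \<psi> :: "'n para \<Rightarrow> 'n cliff" assume "PsiR \<mu> \<psi>"
    then obtain F where rep: "right_rep \<mu> i \<psi> UNIV F cle" using R by blast
    show "SR_integrand D Top \<theta> i \<psi> v integrable_on UNIV" for v by (rule SRcalc_properties(1)[OF rep])
    show "bounded_linear (SRcalc D Top \<theta> i \<psi>)" by (rule SRcalc_properties(2)[OF rep])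
    show "rmod_hom (SRcalc D Top \<theta> i \<psi>)" by (rule SRcalc_properties(3)[OF rep])
  next
    fix \<psi> \<phi> :: "'n para \<Rightarrow> 'n cliff" and a b :: real assume "PsiL \<mu> \<psi> \<and> PsiL \<mu> \<phi>"
    then obtain F G where "left_rep \<mu> i \<psi> UNIV F cle" "left_rep \<mu> i \<phi> UNIV G cle" using L by blast
    then show "SLcalc D Top \<theta> i (\<lambda>s. a *\<^sub>R \<psi> s + b *\<^sub>R \<phi> s) = (\<lambda>v. a *\<^sub>R SLcalc D Top \<theta> i \<psi> v + b *\<^sub>R SLcalc D Top \<theta> i \<phi> v)"
      by (intro ext SLcalc_linear)
  next
    fix \<psi> \<phi> :: "'n para \<Rightarrow> 'n cliff" and a b :: real assume "PsiR \<mu> \<psi> \<and> PsiR \<mu> \<phi>"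
    then obtain F G where "right_rep \<mu> i \<psi> UNIV F cle" "right_rep \<mu> i \<phi> UNIV G cle" using R by blast
    then show "SRcalc D Top \<theta> i (\<lambda>s. a *\<^sub>R \<psi> s + b *\<^sub>R \<phi> s) = (\<lambda>v. a *\<^sub>R SRcalc D Top \<theta> i \<psi> v + b *\<^sub>R SRcalc D Top \<theta> i \<phi> v)"
      by (intro ext SRcalc_linear)
  next
    fix \<psi> \<phi> :: "'n para \<Rightarrow> 'n cliff" assume "Psi \<mu> \<psi> \<and> PsiL \<mu> \<phi>"
    then obtain I F G where "left_rep \<mu> i \<psi> I F cle" "\<forall>B\<in>I. CARD('n) = 1 \<or> B = {}" "left_rep \<mu> i \<phi> UNIV G cle"
      using L I by metis
    then show "SLcalc D Top \<theta> i (\<lambda>s. clmul (\<psi> s) (\<phi> s)) = SLcalc D Top \<theta> i \<psi> \<circ> SLcalc D Top \<theta> i \<phi>"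
      by (intro ext, unfold o_def, intro SLcalc_mult) auto
  next
    fix \<psi> \<phi> :: "'n para \<Rightarrow> 'n cliff" assume "PsiR \<mu> \<psi> \<and> Psi \<mu> \<phi>"
    then obtain I F G where "right_rep \<mu> i \<phi> I G cle" "\<forall>B\<in>I. CARD('n) = 1 \<or> B = {}" "right_rep \<mu> i \<psi> UNIV F cle"
      using R I by metis
    then show "SRcalc D Top \<theta> i (\<lambda>s. clmul (\<psi> s) (\<phi> s)) = SRcalc D Top \<theta> i \<psi> \<circ> SRcalc D Top \<theta> i \<phi>"
      by (intro ext, unfold o_def, intro SRcalc_mult) auto
  qed
qed

end
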